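(* Let $\nu>-1$, let $a\in L^\infty(\mathbb{R}_+)\cap L^1(\mathbb{R}_+)$ and assume that (i) $a$ is continuous and piecewise $C^2$ on $[0,\infty)$, and $\lim_{t\to\infty}a(t)=0$; (ii) $(1+t)^{-1/2}a'\in L^1(\mathbb{R}_+)$ and $a''\in L^1(\mathbb{R}_+)$. Then the operator $B(a)-W(a)$ is a Hilbert-Schmidt operator on $L^2(\mathbb{R}_+)$, where the symbol of $W(a)$ is the even extension $a(-x)=a(x)$ of $a$ to $\mathbb{R}$.
   Context: Functions are complex-valued and $\mathbb{R}_+=[0,\infty)$. $J_\nu$ is the Bessel function of the first kind. For $a\in L^\infty(\mathbb{R}_+)\cap L^1(\mathbb{R}_+)$, the Bessel operator $B(a)$ is the bounded integral operator on $L^2(\mathbb{R}_+)$ with kernel $K(x,y)=\int_0^\infty t\sqrt{xy}\,J_\nu(xt)J_\nu(yt)\,a(t)\,dt$; equivalently $B(a)=\mathbf{H}_\nu M(a)\mathbf{H}_\nu$, where $M(a)$ is multiplication by $a$ and $\mathbf{H}_\nu$ is the (unitary, selfadjoint) Hankel transform on $L^2(\mathbb{R}_+)$, $(\mathbf{H}_\nu f)(x)=\int_0^\infty\sqrt{tx}\,J_\nu(tx)f(t)\,dt$. For $a\in L^\infty(\mathbb{R})\cap L^1(\mathbb{R})$, the Wiener-Hopf operator $W(a)$ is the bounded integral operator on $L^2(\mathbb{R}_+)$ with kernel $\hat a(x-y)$, where $\hat a(x)=\frac1{2\pi}\int_{-\infty}^\infty e^{-ixt}a(t)\,dt$; equivalently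 $W(a)$ is the compression to $L^2(\mathbb{R}_+)$ of $\mathbf{F}M(a)\mathbf{F}^{-1}$ with $\mathbf{F}$ the Fourier transform $\mathbf{F}a=\hat a$. A function $a$ on $[0,\infty)$ is piecewise $C^2$ on $[0,\infty)$ if there exist $0=t_0<t_1<\dots<t_N<\infty$, $N\ge0$, such that $a$ is two times continuously differentiable on each of the closed intervals $[0,t_1],\dots,[t_{N-1},t_N],[t_N,\infty)$, derivatives at $t_0,\dots,t_N$ being one-sided. *)

theory Defs
  imports "HOL-Analysis.Analysis"
begin

section \<open>The space \<open>L\<^sup>2\<close> and Hilbert-Schmidt operators\<close>

text \<open>
  Elements of \<open>L\<^sup>2(M)\<close> are represented by functions, with equality almost everywhere in the
  role of equality. An operator on \<open>L\<^sup>2(M)\<close> is a map on functions that is compatible with this.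
\<close>

definition L2_set :: "'a measure \<Rightarrow> ('a \<Rightarrow> complex) set" where
  "L2_set M = {f \<in> borel_measurable M. integrable M (\<lambda>x. (cmod (f x))\<^sup>2)}"

definition L2_inner :: "'a measure \<Rightarrow> ('a \<Rightarrow> complex) \<Rightarrow> ('a \<Rightarrow> complex) \<Rightarrow> complex" where
  "L2_inner M f g = (LINT x|M. f x * cnj (g x))"

definition L2_nrm :: "'a measure \<Rightarrow> ('a \<Rightarrow> complex) \<Rightarrow> real" where
  "L2_nrm M f = sqrt (LINT x|M. (cmod (f x))\<^sup>2)"

definition Linf_set :: "'a measure \<Rightarrow> ('a \<Rightarrow> complex) set" where
  "Linf_set M = {f \<in> borel_measurable M. \<exists>C. AE x in M. cmod (f x) \<le> C}"

definition bounded_operator_L2 ::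
  "'a measure \<Rightarrow> (('a \<Rightarrow> complex) \<Rightarrow> ('a \<Rightarrow> complex)) \<Rightarrow> bool" where
  "bounded_operator_L2 M T \<longleftrightarrow>
     (\<forall>f\<in>L2_set M. T f \<in> L2_set M) \<and>
     (\<forall>f\<in>L2_set M. \<forall>g\<in>L2_set M.
        (AE x in M. f x = g x) \<longrightarrow> (AE x in M. T f x = T g x)) \<and>
     (\<forall>f\<in>L2_set M. \<forall>g\<in>L2_set M. \<forall>c d.
        AE x in M. T (\<lambda>x. c * f x + d * g x) x = c * T f x + d * T g x) \<and>
     (\<exists>C. \<forall>f\<in>L2_set M. L2_nrm M (T f) \<le> C * L2_nrm M f)"

definition orthonormal_basis_L2 :: "'a measure \<Rightarrow> ('a \<Rightarrow> complex) set \<Rightarrow> bool" where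
  "orthonormal_basis_L2 M E \<longleftrightarrow>
     E \<subseteq> L2_set M \<and>
     (\<forall>e\<in>E. \<forall>e'\<in>E. L2_inner M e e' = (if e = e' then 1 else 0)) \<and>
     (\<forall>f\<in>L2_set M. (\<forall>e\<in>E. L2_inner M f e = 0) \<longrightarrow> (AE x in M. f x = 0))"

definition hilbert_schmidt_L2 ::
  "'a measure \<Rightarrow> (('a \<Rightarrow> complex) \<Rightarrow> ('a \<Rightarrow> complex)) \<Rightarrow> bool" where
  "hilbert_schmidt_L2 M T \<longleftrightarrow>
     bounded_operator_L2 M T \<and>
     (\<exists>E. orthonormal_basis_L2 M E \<and> (\<lambda>e. (L2_nrm M (T e))\<^sup>2) summable_on E)"

section \<open>Bessel and Wiener-Hopf operators\<close>

abbreviation half_line :: "real measure" where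
  "half_line \<equiv> restrict_space lborel {0..}"

text \<open>
  For \<open>x > 0\<close> and \<open>\<nu> > -1\<close> this is the usual power series. For \<open>\<nu> \<le> 0\<close> the value at the single
  point \<open>x = 0\<close> is a convention (it is \<open>0\<close>, as \<open>0 powr \<nu> = 0\<close>); it has no influence on the
  operators below.
\<close>

definition bessel_J :: "real \<Rightarrow> real \<Rightarrow> real" where
  "bessel_J \<nu> x =
     (\<Sum>m. (-1) ^ m / (fact m * Gamma (real m + \<nu> + 1)) * (x / 2) powr (2 * real m + \<nu>))"

definition bessel_kernel :: "real \<Rightarrow> (real \<Rightarrow> complex) \<Rightarrow> real \<Rightarrow> real \<Rightarrow> complex" where
  "bessel_kernel \<nu> a x y =
     (LINT t|half_line. of_real (t * sqrt (x * y) * bessel_J \<nu> (x * t) * bessel_J \<nu> (y * t)) * a t)"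

text \<open>
  For \<open>a\<close> in \<open>L\<^sup>1\<close> and \<open>L\<^sup>\<infinity>\<close>, both kernels below are square integrable in \<open>y\<close> for every fixed
  \<open>x > 0\<close>, so that the integrals converge absolutely for all \<open>f\<close> in \<open>L\<^sup>2\<close>.
\<close>

definition bessel_operator ::
  "real \<Rightarrow> (real \<Rightarrow> complex) \<Rightarrow> (real \<Rightarrow> complex) \<Rightarrow> (real \<Rightarrow> complex)" where
  "bessel_operator \<nu> a f = (\<lambda>x. LINT y|half_line. bessel_kernel \<nu> a x y * f y)"

definition fourier_hat :: "(real \<Rightarrow> complex) \<Rightarrow> real \<Rightarrow> complex" where
  "fourier_hat a x = of_real (1 / (2 * pi)) * (LINT t|lborel. exp (- \<i> * of_real (x * t)) * a t)"

definition wiener_hopf_operator ::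
  "(real \<Rightarrow> complex) \<Rightarrow> (real \<Rightarrow> complex) \<Rightarrow> (real \<Rightarrow> complex)" where
  "wiener_hopf_operator a f = (\<lambda>x. LINT y|half_line. fourier_hat a (x - y) * f y)"

definition even_extension :: "(real \<Rightarrow> complex) \<Rightarrow> real \<Rightarrow> complex" where
  "even_extension a = (\<lambda>x. a \<bar>x\<bar>)"

section \<open>Piecewise \<open>C\<^sup>2\<close> functions on the half-line\<close>

text \<open>Derivatives are taken within \<open>S\<close>, hence are one-sided at the endpoints of an interval.\<close>

definition C2_on :: "real set \<Rightarrow> (real \<Rightarrow> complex) \<Rightarrow> bool" where
  "C2_on S a \<longleftrightarrow> (\<exists>a' a''.
     (\<forall>t\<in>S. (a has_vector_derivative a' t) (at t within S)) \<and>
     (\<forall>t\<in>S. (a' has_vector_derivative a'' t) (at t within S)) \<and>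
     continuous_on S a'')"

definition piecewise_C2_half_line :: "(real \<Rightarrow> complex) \<Rightarrow> bool" where
  "piecewise_C2_half_line a \<longleftrightarrow> (\<exists>N (\<tau> :: nat \<Rightarrow> real).
     \<tau> 0 = 0 \<and> (\<forall>i<N. \<tau> i < \<tau> (Suc i)) \<and>
     (\<forall>i<N. C2_on {\<tau> i..\<tau> (Suc i)} a) \<and> C2_on {\<tau> N..} a)"

text \<open>
  For a piecewise \<open>C\<^sup>2\<close> function, this and its iterate are the first and second derivative off the
  finite set of break points, where the value is unspecified.
\<close>

definition half_line_deriv :: "(real \<Rightarrow> complex) \<Rightarrow> real \<Rightarrow> complex" where
  "half_line_deriv a t = vector_derivative a (at t within {0..})"

end

theory Submission
  imports Defs "HOL-Real_Asymp.Real_Asymp"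
begin

text \<open>
  The difference of the two operators has an integral kernel \<open>D(x,y)\<close>, and it suffices to show
  that \<open>D\<close> is square integrable over the quadrant.

  Put \<open>u(z) = \<surd>z J\<^sub>\<nu>(z)\<close>, \<open>v(z) = \<surd>z J\<^sub>\<nu>\<^sub>+\<^sub>1(z)\<close>, \<open>\<kappa> = \<nu> + 1/2\<close>. Then \<open>u' = \<kappa>u/z - v\<close> and \<open>v' = u - \<kappa>v/z\<close>,
  which yields \<open>u + iv = e\<^sup>i\<^sup>z \<Theta> + O(1/z)\<close> for a constant \<open>\<Theta>\<close>. Only \<open>|\<Theta>|\<^sup>2 = 2/\<pi>\<close> is needed. It comes from
  \<open>Y(p) = \<integral> e\<^sup>-\<^sup>p\<^sup>t t\<^sup>\<kappa> v(t) dt\<close>: the system gives \<open>(1+p\<^sup>2) Y' = -(2\<kappa>+2) p Y\<close>, so \<open>Y(p) (1+p\<^sup>2)\<^sup>\<kappa>\<^sup>+\<^sup>1\<close> is constant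
  along \<open>p = \<sigma> + i\<close>. Its limit as \<open>\<sigma> \<rightarrow> \<infinity>\<close> is read off from \<open>v\<close> at \<open>0\<close>, its limit as \<open>\<sigma> \<rightarrow> 0\<close> from \<open>\<Theta>\<close>, and
  they are compared by the duplication formula for \<open>\<Gamma>\<close>.

  Since \<open>L(t) = x v(xt) u(yt) - y u(xt) v(yt)\<close> satisfies \<open>L' = (x\<^sup>2 - y\<^sup>2) u(xt) u(yt)\<close>, integration by parts
  writes the Bessel kernel as \<open>- (x\<^sup>2 - y\<^sup>2)\<^sup>-\<^sup>1 \<integral> L a'\<close>. Replacing \<open>u, v\<close> by their asymptotics turns this into the
  Wiener-Hopf kernel plus \<open>O((x+y)\<^sup>-\<^sup>2)\<close>; for \<open>1 \<le> y < x\<close> the error is \<open>O(y\<^sup>-\<^sup>\<theta> / (x-y))\<close> with some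
  \<open>\<theta> > 1/2\<close>, and near the diagonal the original integral gives \<open>O(y\<^sup>-\<^sup>\<theta>)\<close>. For \<open>y < 1\<close> crude
  bounds suffice.
\<close>

section \<open>Integral operators with square integrable kernels\<close>

text \<open>The phase of \<Theta> never matters: in a product of two leading terms it survives only
  in the part oscillating with frequency x + y, while the part of frequency x - y carries
  |\<Theta>|^2 / 2 = 1 / \<pi>, which is the constant of the Wiener-Hopf kernel. The line p =
  \<sigma> + i is chosen because the factor e^(-it) makes the leading term of u + iv stationary; its
  size then appears as the strength of the singularity of (1 + p^2)^(-\<kappa>-1) at p = i. The
  estimates are shaped by the origin. The error 1/z cannot be used down to 0, since the weight 1/t
  is not integrable there, and for \<nu> < -1/2 the function u itself may blow up. The error is
  therefore weakened to z^(-\<theta>) with \<theta> < 1; a value above 1/2 remains possible because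
  \<nu> > -1 keeps the singularity of u weaker than t^(-1/2). The factor 1 / (x - y) gained by
  integration by parts is square integrable away from the diagonal but not across it, so a second
  estimate without that division is needed there.\<close>

lemma L2_setD:
  assumes "f \<in> L2_set M"
  shows "f \<in> borel_measurable M" "integrable M (\<lambda>x. (cmod (f x))\<^sup>2)"
  using assms by (auto simp: L2_set_def)

lemma L2_mult_integrable:
  assumes f: "f \<in> L2_set M" and g: "g \<in> L2_set M"
  shows "integrable M (\<lambda>x. f x * g x)"
proof (rule Bochner_Integration.integrable_bound)
  show "integrable M (\<lambda>x. (cmod (f x))\<^sup>2 + (cmod (g x))\<^sup>2)"
    using L2_setD[OF f] L2_setD[OF g] by auto
  show "(\<lambda>x. f x * g x) \<in> borel_measurable M"
    using L2_setD[OF f] L2_setD[OF g] by auto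
  show "AE x in M. norm (f x * g x) \<le> norm ((cmod (f x))\<^sup>2 + (cmod (g x))\<^sup>2)"
  proof (rule AE_I2)
    fix x
    have "cmod (f x) * cmod (g x) \<le> (cmod (f x))\<^sup>2 + (cmod (g x))\<^sup>2"
      using sum_squares_bound[of "cmod (f x)" "cmod (g x)"]
        mult_nonneg_nonneg[OF norm_ge_zero[of "f x"] norm_ge_zero[of "g x"]] by linarith
    then show "norm (f x * g x) \<le> norm ((cmod (f x))\<^sup>2 + (cmod (g x))\<^sup>2)"
      by (simp add: norm_mult)
  qed
qed

lemma L2_cnj: "f \<in> L2_set M \<Longrightarrow> (\<lambda>x. cnj (f x)) \<in> L2_set M"
  using measurable_compose[OF _ borel_measurable_continuous_onI[of cnj], of f M]
  by (auto simp: L2_set_def intro: continuous_intros)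

lemma L2_lincomb:
  assumes f: "f \<in> L2_set M" and g: "g \<in> L2_set M"
  shows "(\<lambda>x. c * f x + d * g x) \<in> L2_set M"
proof -
  have [measurable]: "f \<in> borel_measurable M" "g \<in> borel_measurable M"
    using L2_setD[OF f] L2_setD[OF g] by auto
  have "integrable M (\<lambda>x. (cmod (c * f x + d * g x))\<^sup>2)"
  proof (rule Bochner_Integration.integrable_bound)
    show "integrable M (\<lambda>x. 2 * (cmod c)\<^sup>2 * (cmod (f x))\<^sup>2 + 2 * (cmod d)\<^sup>2 * (cmod (g x))\<^sup>2)"
      using L2_setD[OF f] L2_setD[OF g] by auto
    show "AE x in M. norm ((cmod (c * f x + d * g x))\<^sup>2)
      \<le> norm (2 * (cmod c)\<^sup>2 * (cmod (f x))\<^sup>2 + 2 * (cmod d)\<^sup>2 * (cmod (g x))\<^sup>2)"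
    proof (rule AE_I2)
      fix x
      let ?p = "cmod c * cmod (f x)" and ?q = "cmod d * cmod (g x)"
      have "(cmod (c * f x + d * g x))\<^sup>2 \<le> (?p + ?q)\<^sup>2"
        using norm_triangle_ineq[of "c * f x" "d * g x"] by (intro power_mono) (auto simp: norm_mult)
      also have "\<dots> \<le> 2 * ?p\<^sup>2 + 2 * ?q\<^sup>2"
        using sum_squares_bound[of ?p ?q] by (simp add: power2_sum)
      finally show "norm ((cmod (c * f x + d * g x))\<^sup>2)
          \<le> norm (2 * (cmod c)\<^sup>2 * (cmod (f x))\<^sup>2 + 2 * (cmod d)\<^sup>2 * (cmod (g x))\<^sup>2)"
        by (simp add: power_mult_distrib)
    qed
  qed measurable
  then show ?thesis by (simp add: L2_set_def)
qed

section \<open>Inner products, Bessel's inequality and the Cauchy-Schwarz inequality\<close>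

lemma L2_inner_self: "L2_inner M f f = of_real (LINT x|M. (cmod (f x))\<^sup>2)"
  unfolding L2_inner_def by (simp add: complex_norm_square[symmetric] flip: of_real_power)

lemma L2_inner_lincomb:
  assumes "f \<in> L2_set M" "g \<in> L2_set M" "h \<in> L2_set M"
  shows "L2_inner M (\<lambda>x. c * f x + d * g x) h = c * L2_inner M f h + d * L2_inner M g h"
proof -
  have "integrable M (\<lambda>x. f x * cnj (h x))" "integrable M (\<lambda>x. g x * cnj (h x))"
    using assms by (auto intro!: L2_mult_integrable L2_cnj)
  then show ?thesis
    unfolding L2_inner_def by (simp add: algebra_simps)
qed

lemma L2_inner_cnj: "cnj (L2_inner M f g) = L2_inner M g f"
  unfolding L2_inner_def by (simp flip: Bochner_Integration.integral_cnj add: mult.commute)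

text \<open>Pythagoras: the remainder is orthogonal to the unit vector \<open>e\<close>, so the
  squared norm drops by the squared coefficient. This is the induction step of Bessel's
  inequality.\<close>

lemma L2_project_away:
  assumes f: "f \<in> L2_set M" and e: "e \<in> L2_set M" and 1: "L2_inner M e e = 1"
  shows "(LINT x|M. (cmod (f x - L2_inner M f e * e x))\<^sup>2)
      = (LINT x|M. (cmod (f x))\<^sup>2) - (cmod (L2_inner M f e))\<^sup>2"
proof -
  define c where "c = L2_inner M f e"
  define g where "g = (\<lambda>x. 1 * f x + (- c) * e x)"
  have g: "g \<in> L2_set M"
    unfolding g_def by (rule L2_lincomb[OF f e])
  have ge: "L2_inner M g e = 0"
    unfolding g_def L2_inner_lincomb[OF f e e] by (simp add: c_def 1)
  have "L2_inner M g g = 1 * L2_inner M f g + (- c) * L2_inner M e g"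
    using L2_inner_lincomb[OF f e g, of 1 "- c"] by (simp add: g_def)
  also have "L2_inner M e g = 0"
    using L2_inner_cnj[of M g e] ge by simp
  also have "L2_inner M f g = cnj (L2_inner M g f)"
    by (simp add: L2_inner_cnj)
  also have "L2_inner M g f = L2_inner M f f - c * cnj c"
    using L2_inner_lincomb[OF f e f, of 1 "- c"] L2_inner_cnj[of M f e] by (simp add: g_def c_def)
  finally have "L2_inner M g g = L2_inner M f f - c * cnj c"
    by (simp add: L2_inner_cnj)
  then have "complex_of_real (LINT x|M. (cmod (g x))\<^sup>2)
      = of_real ((LINT x|M. (cmod (f x))\<^sup>2) - (cmod c)\<^sup>2)"
    by (simp add: L2_inner_self complex_norm_square[symmetric] flip: of_real_power)
  then show ?thesis
    unfolding of_real_eq_iff by (simp add: g_def c_def)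
qed

text \<open>Removing the component of \<open>f\<close> along \<open>e0\<close> leaves the
  coefficients against the rest of \<open>F\<close> unchanged, by orthogonality. The induction
  therefore keeps \<open>f\<close> arbitrary and continues with the remainder.\<close>

lemma L2_bessel_inequality:
  assumes "finite F" "F \<subseteq> L2_set M" "f \<in> L2_set M"
    and "\<And>e e'. e \<in> F \<Longrightarrow> e' \<in> F \<Longrightarrow> L2_inner M e e' = (if e = e' then 1 else 0)"
  shows "(\<Sum>e\<in>F. (cmod (L2_inner M f e))\<^sup>2) \<le> (LINT x|M. (cmod (f x))\<^sup>2)"
  using assms
proof (induction F arbitrary: f rule: finite_induct)
  case (insert e0 F)
  define g where "g = (\<lambda>x. f x - L2_inner M f e0 * e0 x)"
  have g_alt: "g = (\<lambda>x. 1 * f x + (- L2_inner M f e0) * e0 x)"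
    by (simp add: g_def)
  have e0: "e0 \<in> L2_set M" "L2_inner M e0 e0 = 1"
    using insert.prems by auto
  have g: "g \<in> L2_set M"
    unfolding g_alt by (rule L2_lincomb) (use insert.prems e0 in auto)
  have "L2_inner M g e = L2_inner M f e" if "e \<in> F" for e
  proof -
    have "L2_inner M e0 e = 0" "e \<in> L2_set M"
      using that insert by auto
    then show ?thesis
      unfolding g_alt using insert.prems e0 by (subst L2_inner_lincomb) auto
  qed
  then have "(\<Sum>e\<in>F. (cmod (L2_inner M f e))\<^sup>2) \<le> (LINT x|M. (cmod (g x))\<^sup>2)"
    using insert.IH[OF _ g] insert.prems by auto
  also have "\<dots> = (LINT x|M. (cmod (f x))\<^sup>2) - (cmod (L2_inner M f e0))\<^sup>2"
    unfolding g_def by (rule L2_project_away) (use insert.prems e0 in auto)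
  finally show ?case
    using insert.hyps by simp
qed simp

text \<open>Stated without conjugation, because integral operators apply their kernel bilinearly. It
  is transferred from the inequality for nonnegative extended integrals.\<close>

lemma L2_cauchy_schwarz:
  assumes f: "f \<in> L2_set M" and g: "g \<in> L2_set M"
  shows "(cmod (LINT x|M. f x * g x))\<^sup>2 \<le> (LINT x|M. (cmod (f x))\<^sup>2) * (LINT x|M. (cmod (g x))\<^sup>2)"
proof -
  have [measurable]: "f \<in> borel_measurable M" "g \<in> borel_measurable M"
    using L2_setD[OF f] L2_setD[OF g] by auto
  have "ennreal (cmod (LINT x|M. f x * g x)) \<le> (\<integral>\<^sup>+x. ennreal (cmod (f x * g x)) \<partial>M)"
    by (rule integral_norm_bound_ennreal[OF L2_mult_integrable[OF f g]])
  then have "(ennreal (cmod (LINT x|M. f x * g x)))\<^sup>2 \<le> (\<integral>\<^sup>+x. ennreal (cmod (f x * g x)) \<partial>M)\<^sup>2"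
    by (rule power_mono) simp
  also have "(\<integral>\<^sup>+x. ennreal (cmod (f x * g x)) \<partial>M)
      = (\<integral>\<^sup>+x. ennreal (cmod (f x)) * ennreal (cmod (g x)) \<partial>M)"
    by (simp add: norm_mult ennreal_mult)
  also have "\<dots>\<^sup>2 \<le> (\<integral>\<^sup>+x. (ennreal (cmod (f x)))\<^sup>2 \<partial>M) * (\<integral>\<^sup>+x. (ennreal (cmod (g x)))\<^sup>2 \<partial>M)"
    by (rule Cauchy_Schwarz_nn_integral) auto
  also have "\<dots> = ennreal (LINT x|M. (cmod (f x))\<^sup>2) * ennreal (LINT x|M. (cmod (g x))\<^sup>2)"
    using L2_setD[OF f] L2_setD[OF g]
    by (simp add: nn_integral_eq_integral ennreal_power)
  also have "\<dots> = ennreal ((LINT x|M. (cmod (f x))\<^sup>2) * (LINT x|M. (cmod (g x))\<^sup>2))"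
    by (simp add: ennreal_mult)
  finally show ?thesis
    by (simp add: ennreal_power)
qed

text \<open>Zorn's lemma yields a maximal orthonormal set; a non-null \<open>f\<close> orthogonal to
  it could be normalised and added. That elements are functions and not classes does no harm: two
  distinct functions that agree almost everywhere cannot both be in an orthonormal set.\<close>

lemma exists_orthonormal_basis_L2: "\<exists>E. orthonormal_basis_L2 M E"
proof -
  define ons where "ons = {E. E \<subseteq> L2_set M \<and>
     (\<forall>e\<in>E. \<forall>e'\<in>E. L2_inner M e e' = (if e = e' then 1 else 0))}"
  have "\<exists>E\<in>ons. \<forall>X\<in>ons. E \<subseteq> X \<longrightarrow> X = E"
  proof (rule subset_Zorn')
    fix C assume C: "subset.chain ons C"
    have "L2_inner M e e' = (if e = e' then 1 else 0)" if ee: "e \<in> \<Union>C" "e' \<in> \<Union>C" for e e'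
    proof -
      obtain X X' where X: "X \<in> C" "e \<in> X" "X' \<in> C" "e' \<in> X'"
        using ee by blast
      then have "X \<subseteq> X' \<or> X' \<subseteq> X" "X \<in> ons" "X' \<in> ons"
        using C by (auto simp: subset_chain_def)
      then show ?thesis
        using X unfolding ons_def by blast
    qed
    then show "\<Union>C \<in> ons"
      using C unfolding ons_def subset_chain_def by blast
  qed
  then obtain E where E: "E \<in> ons" and max: "\<And>X. X \<in> ons \<Longrightarrow> E \<subseteq> X \<Longrightarrow> X = E"
    by blast
  have "AE x in M. f x = 0" if f: "f \<in> L2_set M" and orth: "\<forall>e\<in>E. L2_inner M f e = 0" for f
  proof (rule ccontr)
    assume neg: "\<not> (AE x in M. f x = 0)"
    define I where "I = (LINT x|M. (cmod (f x))\<^sup>2)"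
    have "I \<noteq> 0"
      using neg integral_nonneg_eq_0_iff_AE[OF L2_setD(2)[OF f]] by (auto simp: I_def)
    moreover have "I \<ge> 0" by (simp add: I_def)
    ultimately have I: "I > 0" by simp
    define c where "c = complex_of_real (1 / sqrt I)"
    \<comment> \<open>The summand with coefficient 0 only gives the scalar multiple the shape to
      which \<open>L2_lincomb\<close> and \<open>L2_inner_lincomb\<close> apply.\<close>
    define g where "g = (\<lambda>x. c * f x + 0 * f x)"
    have g: "g \<in> L2_set M"
      unfolding g_def by (rule L2_lincomb[OF f f])
    have gi: "L2_inner M g h = c * L2_inner M f h" if "h \<in> L2_set M" for h
      unfolding g_def using L2_inner_lincomb[OF f f that, of c 0] by simp
    have "L2_inner M f g = cnj c * L2_inner M f f"
      using gi[OF f] L2_inner_cnj[of M g f] L2_inner_cnj[of M f f] by (metis complex_cnj_mult)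
    moreover have "L2_inner M f f = of_real I"
      by (simp add: L2_inner_self I_def)
    ultimately have "L2_inner M g g = of_real (1 / sqrt I * (1 / sqrt I) * I)"
      using gi[OF g] by (simp only: c_def complex_cnj_complex_of_real of_real_mult mult.assoc)
    also have "1 / sqrt I * (1 / sqrt I) * I = 1"
      using I by simp
    finally have gg: "L2_inner M g g = 1" by simp
    have EL: "E \<subseteq> L2_set M"
      using E by (simp add: ons_def)
    have ge: "L2_inner M g e = 0" "L2_inner M e g = 0" if "e \<in> E" for e
    proof -
      show "L2_inner M g e = 0"
        using gi[of e] orth EL that by auto
      then show "L2_inner M e g = 0"
        using L2_inner_cnj[of M g e] by simp
    qed
    have "g \<notin> E"
      using ge gg by auto
    moreover have "insert g E \<in> ons"
      using E g gg ge unfolding ons_def by auto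
    ultimately show False
      using max[of "insert g E"] by auto
  qed
  then show ?thesis
    using E unfolding ons_def orthonormal_basis_L2_def by blast
qed

text \<open>The two integrals are formed separately, and each is 0 by convention where its integrand
  is not integrable. They may be merged only where both kernels are square integrable in the second
  variable; this is what the hypothesis on \<open>k2\<close> secures, and \<open>k1 = k + k2\<close>
  inherits it for almost every x. After merging, Bessel's inequality applied to the conjugate of
  \<open>k x\<close> bounds every finite sum of |(T e)(x)|^2 by \<open>N x\<close>, and integration
  over x gives the trace bound for any orthonormal basis.\<close>

theorem hilbert_schmidt_L2_kernel_difference:
  fixes k1 k2 :: "'a \<Rightarrow> 'a \<Rightarrow> complex"
  assumes sf: "sigma_finite_measure M"
    and k1: "case_prod k1 \<in> borel_measurable (M \<Otimes>\<^sub>M M)"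
    and k2: "case_prod k2 \<in> borel_measurable (M \<Otimes>\<^sub>M M)"
    and fin: "(\<integral>\<^sup>+x. \<integral>\<^sup>+y. ennreal ((cmod (k1 x y - k2 x y))\<^sup>2) \<partial>M \<partial>M) < \<infinity>"
    and k2_L2: "AE x in M. k2 x \<in> L2_set M"
  shows "hilbert_schmidt_L2 M (\<lambda>f x. (LINT y|M. k1 x y * f y) - (LINT y|M. k2 x y * f y))"
proof -
  interpret sigma_finite_measure M by (rule sf)
  note [measurable] = k1 k2
  define k where "k = (\<lambda>x y. k1 x y - k2 x y)"
  have k[measurable]: "case_prod k \<in> borel_measurable (M \<Otimes>\<^sub>M M)"
    unfolding k_def by measurable
  define T where "T = (\<lambda>f x. (LINT y|M. k1 x y * f y) - (LINT y|M. k2 x y * f y))"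
  define N where "N = (\<lambda>x. LINT y|M. (cmod (k x y))\<^sup>2)"
  have N_nonneg: "N x \<ge> 0" for x
    unfolding N_def by simp
  have "AE x in M. (\<integral>\<^sup>+y. ennreal ((cmod (k x y))\<^sup>2) \<partial>M) \<noteq> \<infinity>"
    by (rule nn_integral_PInf_AE) (use fin in \<open>auto simp: k_def\<close>)
  then have "AE x in M. k x \<in> L2_set M \<and> k2 x \<in> L2_set M"
    using k2_L2 AE_space
  proof eventually_elim
    case (elim x)
    have "integrable M (\<lambda>y. (cmod (k x y))\<^sup>2)"
      unfolding integrable_iff_bounded using elim by (auto simp: top.not_eq_extremum)
    then show ?case
      using elim by (auto simp: L2_set_def)
  qed
  \<comment> \<open>Square integrability of \<open>k1 x\<close> is recovered from
    \<open>k x + k2 x\<close>; the coefficients 1 match the form of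
    \<open>L2_lincomb\<close>.\<close>
  then have AEk: "AE x in M. k x \<in> L2_set M \<and> k1 x \<in> L2_set M \<and> k2 x \<in> L2_set M"
  proof eventually_elim
    case (elim x)
    then have "(\<lambda>y. 1 * k x y + 1 * k2 x y) \<in> L2_set M"
      by (intro L2_lincomb) auto
    then show ?case
      using elim by (simp add: k_def)
  qed
  have AET: "AE x in M. T f x = (LINT y|M. k x y * f y)" if f: "f \<in> L2_set M" for f
    using AEk
  proof eventually_elim
    case (elim x)
    then have "integrable M (\<lambda>y. k1 x y * f y)" "integrable M (\<lambda>y. k2 x y * f y)"
      using f by (auto intro: L2_mult_integrable)
    then show ?case
      by (simp add: T_def k_def algebra_simps)
  qed
  have N_int: "integrable M N"
  proof -
    have "AE x in M. ennreal (N x) = (\<integral>\<^sup>+y. ennreal ((cmod (k x y))\<^sup>2) \<partial>M)"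
      using AEk by eventually_elim (auto simp: N_def L2_set_def nn_integral_eq_integral)
    then have "(\<integral>\<^sup>+x. ennreal (N x) \<partial>M) = (\<integral>\<^sup>+x. \<integral>\<^sup>+y. ennreal ((cmod (k x y))\<^sup>2) \<partial>M \<partial>M)"
      by (rule nn_integral_cong_AE)
    moreover have "N \<in> borel_measurable M"
      unfolding N_def by measurable
    ultimately show ?thesis
      using fin by (auto simp: integrable_iff_bounded k_def N_nonneg)
  qed
  have T_meas: "T f \<in> borel_measurable M" if "f \<in> L2_set M" for f
  proof -
    have [measurable]: "f \<in> borel_measurable M" using that by (rule L2_setD)
    show ?thesis unfolding T_def by measurable
  qed
  have T_bound: "AE x in M. (cmod (T f x))\<^sup>2 \<le> N x * (LINT x|M. (cmod (f x))\<^sup>2)"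
    if f: "f \<in> L2_set M" for f
    using AEk AET[OF f] by eventually_elim (auto simp: N_def intro!: L2_cauchy_schwarz f)
  have T_L2: "T f \<in> L2_set M" if f: "f \<in> L2_set M" for f
  proof -
    have "integrable M (\<lambda>x. (cmod (T f x))\<^sup>2)"
    proof (rule Bochner_Integration.integrable_bound)
      show "integrable M (\<lambda>x. N x * (LINT x|M. (cmod (f x))\<^sup>2))"
        using N_int by simp
      show "(\<lambda>x. (cmod (T f x))\<^sup>2) \<in> borel_measurable M"
        using T_meas[OF f] by measurable
      show "AE x in M. norm ((cmod (T f x))\<^sup>2) \<le> norm (N x * (LINT x|M. (cmod (f x))\<^sup>2))"
        using T_bound[OF f] by eventually_elim (simp add: N_nonneg)
    qed
    then show ?thesis
      using T_meas[OF f] by (simp add: L2_set_def)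
  qed
  have "bounded_operator_L2 M T"
    unfolding bounded_operator_L2_def
  proof (intro conjI ballI impI allI exI[of _ "sqrt (integral\<^sup>L M N)"])
    fix f assume f: "f \<in> L2_set M"
    show "T f \<in> L2_set M" by (rule T_L2[OF f])
    have "(LINT x|M. (cmod (T f x))\<^sup>2) \<le> (LINT x|M. N x * (LINT x|M. (cmod (f x))\<^sup>2))"
      using T_L2[OF f] T_bound[OF f] N_int by (intro integral_mono_AE) (auto simp: L2_set_def)
    then show "L2_nrm M (T f) \<le> sqrt (integral\<^sup>L M N) * L2_nrm M f"
      unfolding L2_nrm_def by (simp flip: real_sqrt_mult)
  next
    fix f g assume f: "f \<in> L2_set M" and g: "g \<in> L2_set M" and eq: "AE x in M. f x = g x"
    have [measurable]: "f \<in> borel_measurable M" "g \<in> borel_measurable M"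
      using f g by (auto dest: L2_setD)
    \<comment> \<open>Integrals of measurable functions that agree almost everywhere coincide even
      when they take the default value 0, so the equality below holds at every point of the
      space.\<close>
    have "AE y in M. h x y * f y = h x y * g y" for h :: "'a \<Rightarrow> 'a \<Rightarrow> complex" and x
      using eq by eventually_elim simp
    note eq' = this
    show "AE x in M. T f x = T g x"
      unfolding T_def by (rule AE_I2, intro arg_cong2[where f=minus] integral_cong_AE eq') auto
  next
    fix f g c d assume f: "f \<in> L2_set M" and g: "g \<in> L2_set M"
    show "AE x in M. T (\<lambda>x. c * f x + d * g x) x = c * T f x + d * T g x"
      using AEk AET[OF f] AET[OF g] AET[OF L2_lincomb[OF f g, of c d]]
    proof eventually_elim
      case (elim x)
      then have "integrable M (\<lambda>y. k x y * f y)" "integrable M (\<lambda>y. k x y * g y)"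
        using f g by (auto intro: L2_mult_integrable)
      then have "(LINT y|M. c * (k x y * f y) + d * (k x y * g y))
          = c * (LINT y|M. k x y * f y) + d * (LINT y|M. k x y * g y)"
        by simp
      then show ?case
        using elim by (simp add: algebra_simps)
    qed
  qed
  moreover have "(\<lambda>e. (L2_nrm M (T e))\<^sup>2) summable_on E" if E: "orthonormal_basis_L2 M E" for E
  proof (rule nonneg_bdd_above_summable_on)
    show "bdd_above (sum (\<lambda>e. (L2_nrm M (T e))\<^sup>2) ` {F. F \<subseteq> E \<and> finite F})"
    proof (rule bdd_aboveI2)
      fix F assume "F \<in> {F. F \<subseteq> E \<and> finite F}"
      then have F: "F \<subseteq> E" "finite F" by auto
      have FL: "F \<subseteq> L2_set M"
        and on: "\<And>e e'. e \<in> F \<Longrightarrow> e' \<in> F \<Longrightarrow> L2_inner M e e' = (if e = e' then 1 else 0)"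
        using E F unfolding orthonormal_basis_L2_def by blast+
      have "AE x in M. \<forall>e\<in>F. T e x = (LINT y|M. k x y * e y)"
        using FL AET by (intro AE_finite_allI[OF F(2)]) auto
      then have le: "AE x in M. (\<Sum>e\<in>F. (cmod (T e x))\<^sup>2) \<le> N x"
        using AEk
      proof eventually_elim
        case (elim x)
        \<comment> \<open>The inner product conjugates its second argument, so \<open>T e x\<close>
          is the coefficient of \<open>e\<close> against the conjugated kernel; only its modulus
          enters.\<close>
        have "cmod (T e x) = cmod (L2_inner M (\<lambda>y. cnj (k x y)) e)" if "e \<in> F" for e
        proof -
          have "L2_inner M (\<lambda>y. cnj (k x y)) e = cnj (L2_inner M e (\<lambda>y. cnj (k x y)))"
            by (simp add: L2_inner_cnj)
          also have "L2_inner M e (\<lambda>y. cnj (k x y)) = T e x"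
            using elim that by (simp add: L2_inner_def mult.commute)
          finally show ?thesis by simp
        qed
        then have "(\<Sum>e\<in>F. (cmod (T e x))\<^sup>2) = (\<Sum>e\<in>F. (cmod (L2_inner M (\<lambda>y. cnj (k x y)) e))\<^sup>2)"
          by simp
        also have "\<dots> \<le> (LINT y|M. (cmod (cnj (k x y)))\<^sup>2)"
          by (rule L2_bessel_inequality[OF F(2) FL L2_cnj on]) (use elim in auto)
        finally show ?case by (simp add: N_def)
      qed
      have int: "integrable M (\<lambda>x. (cmod (T e x))\<^sup>2)" if "e \<in> F" for e
        using T_L2[of e] FL that by (auto simp: L2_set_def)
      have "(\<Sum>e\<in>F. (L2_nrm M (T e))\<^sup>2) = (LINT x|M. (\<Sum>e\<in>F. (cmod (T e x))\<^sup>2))"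
        using int by (simp add: L2_nrm_def)
      also have "\<dots> \<le> integral\<^sup>L M N"
        using le int N_int by (intro integral_mono_AE) auto
      finally show "(\<Sum>e\<in>F. (L2_nrm M (T e))\<^sup>2) \<le> integral\<^sup>L M N" .
    qed
  qed simp
  ultimately show ?thesis
    using exists_orthonormal_basis_L2[of M] unfolding hilbert_schmidt_L2_def T_def by blast
qed

section \<open>Integration on the half-line\<close>

text \<open>The endpoint 0 is a null set. Dropping it lets all later pointwise estimates be made for
  t > 0 only, where powers with negative exponent behave.\<close>

lemma half_line_integrable_iff:
  fixes f :: "real \<Rightarrow> 'b::{banach, second_countable_topology}"
  shows "integrable half_line f \<longleftrightarrow> set_integrable lborel {0<..} f"
proof -
  have "integrable half_line f \<longleftrightarrow> integrable lborel (\<lambda>x. indicator {0..} x *\<^sub>R f x)"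
    by (simp add: integrable_restrict_space)
  also have "\<dots> \<longleftrightarrow> integrable lborel (\<lambda>x. indicator {0<..} x *\<^sub>R f x)"
  proof (rule integrable_discrete_difference[where X="{0::real}"])
    fix x :: real assume "x \<notin> {0}"
    then show "indicator {0..} x *\<^sub>R f x = indicator {0<..} x *\<^sub>R f x"
      by (auto simp: indicator_def)
  qed (auto simp: emeasure_lborel_countable)
  finally show ?thesis by (simp add: set_integrable_def)
qed

lemma half_line_integral_eq:
  fixes f :: "real \<Rightarrow> 'b::{banach, second_countable_topology}"
  shows "(LINT t|half_line. f t) = (LINT t:{0<..}|lborel. f t)"
proof -
  have "(LINT t|half_line. f t) = (LINT x|lborel. indicator {0..} x *\<^sub>R f x)"
    by (simp add: integral_restrict_space)
  also have "\<dots> = (LINT x|lborel. indicator {0<..} x *\<^sub>R f x)"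
  proof (rule integral_discrete_difference[where X="{0::real}"])
    fix x :: real assume "x \<notin> {0}"
    then show "indicator {0..} x *\<^sub>R f x = indicator {0<..} x *\<^sub>R f x"
      by (auto simp: indicator_def)
  qed (auto simp: emeasure_lborel_countable)
  finally show ?thesis by (simp add: set_lebesgue_integral_def)
qed

lemma AE_half_line_pos: "AE t in half_line. 0 < t"
proof -
  have "AE t in lborel. t \<noteq> (0::real)"
    by (rule AE_lborel_singleton)
  then show ?thesis
    by (subst AE_restrict_space_iff) auto
qed

lemma half_line_integrable_bound:
  fixes f :: "real \<Rightarrow> 'b::{banach, second_countable_topology}" and g :: "real \<Rightarrow> real"
  assumes "integrable half_line g" "f \<in> borel_measurable half_line"
    and "\<And>t. t > 0 \<Longrightarrow> norm (f t) \<le> g t"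
  shows "integrable half_line f"
proof (rule Bochner_Integration.integrable_bound[OF assms(1,2)])
  show "AE t in half_line. norm (f t) \<le> norm (g t)"
    using AE_half_line_pos by eventually_elim (use assms(3) in force)
qed

lemma half_line_integral_norm_le:
  fixes f :: "real \<Rightarrow> 'b::{banach, second_countable_topology}" and g :: "real \<Rightarrow> real"
  assumes g: "integrable half_line g" and le: "\<And>t. t > 0 \<Longrightarrow> norm (f t) \<le> g t"
  shows "norm (LINT t|half_line. f t) \<le> (LINT t|half_line. g t)"
proof (cases "integrable half_line f")
  case True
  then have "norm (LINT t|half_line. f t) \<le> (LINT t|half_line. norm (f t))"
    by (intro integral_norm_bound)
  also have "\<dots> \<le> (LINT t|half_line. g t)"
    using AE_half_line_pos True g by (intro integral_mono_AE) (auto elim!: eventually_mono intro: le)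
  finally show ?thesis .
next
  case False
  have "AE t in half_line. 0 \<le> g t"
    using AE_half_line_pos by eventually_elim (use le norm_ge_zero order_trans in blast)
  then have "0 \<le> (LINT t|half_line. g t)"
    by (rule integral_nonneg_AE)
  then show ?thesis
    using False by (simp add: not_integrable_integral_eq)
qed

lemma half_line_integral_cong:
  fixes f g :: "real \<Rightarrow> 'b::{banach, second_countable_topology}"
  assumes "\<And>t. t > 0 \<Longrightarrow> f t = g t"
  shows "(LINT t|half_line. f t) = (LINT t|half_line. g t)"
  unfolding half_line_integral_eq using assms by (intro set_lebesgue_integral_cong) auto

section \<open>Fundamental theorem of calculus on the half-line\<close>

lemma has_vector_derivative_exp_of_real:
  "((\<lambda>t. exp (c * complex_of_real t)) has_vector_derivative c * exp (c * of_real t)) (at t within A)"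
proof -
  have "((\<lambda>z. exp (c * z)) has_field_derivative c * exp (c * of_real t)) (at (of_real t))"
    by (auto intro!: derivative_eq_intros)
  then show ?thesis
    using has_vector_derivative_real_field by blast
qed

text \<open>The half-line is exhausted by the intervals [1/(n+1), n+1]; integrability of
  \<open>g\<close> gives convergence of the integrals by domination, and the boundary values
  converge to the prescribed limits. Points of \<open>S\<close> contribute nothing because
  \<open>G\<close> is continuous across them.\<close>

lemma fundamental_theorem_half_line:
  fixes G g :: "real \<Rightarrow> complex"
  assumes S: "finite S" and G: "\<And>t. t > 0 \<Longrightarrow> t \<notin> S \<Longrightarrow> (G has_vector_derivative g t) (at t)"
    and cont: "continuous_on {0<..} G" and g: "integrable half_line g"
    and l0: "(G \<longlongrightarrow> l0) (at_right 0)" and l1: "(G \<longlongrightarrow> l1) at_top"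
  shows "(LINT t|half_line. g t) = l1 - l0"
proof -
  define p q :: "nat \<Rightarrow> real" where "p = (\<lambda>n. 1 / (real n + 1))" and "q = (\<lambda>n. real n + 1)"
  have pq: "0 < p n" "p n \<le> q n" for n
    by (auto simp: p_def q_def field_simps)
  have g': "set_integrable lborel {0<..} g"
    using g by (simp add: half_line_integrable_iff)
  have "(LINT t|lborel. indicator {p n..q n} t *\<^sub>R g t) = G (q n) - G (p n)" for n
  proof -
    have "(g has_integral (G (q n) - G (p n))) {p n..q n}"
      using pq[of n] S G cont
      by (intro fundamental_theorem_of_calculus_interior_strong) (auto intro: continuous_on_subset)
    moreover have "set_integrable lborel {p n..q n} g"
      using pq[of n] by (intro set_integrable_subset[OF g']) auto
    then have "(LINT t:{p n..q n}|lborel. g t) = integral {p n..q n} g"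
      by (rule set_borel_integral_eq_integral)
    ultimately show ?thesis
      by (simp add: set_lebesgue_integral_def integral_unique)
  qed
  moreover have "(\<lambda>n. LINT t|lborel. indicator {p n..q n} t *\<^sub>R g t)
      \<longlonglongrightarrow> (LINT t|lborel. indicator {0<..} t *\<^sub>R g t)"
  proof (rule integral_dominated_convergence)
    show "integrable lborel (\<lambda>t. norm (indicator {0<..} t *\<^sub>R g t))"
      using g' by (intro integrable_norm) (simp add: set_integrable_def)
    show "(\<lambda>t. indicator {0<..} t *\<^sub>R g t) \<in> borel_measurable lborel"
      using g' unfolding set_integrable_def by (rule borel_measurable_integrable)
    show "(\<lambda>t. indicator {p n..q n} t *\<^sub>R g t) \<in> borel_measurable lborel" for n
    proof -
      have "set_integrable lborel {p n..q n} g"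
        using pq[of n] by (intro set_integrable_subset[OF g']) auto
      then show ?thesis
        unfolding set_integrable_def by (rule borel_measurable_integrable)
    qed
    show "AE t in lborel. norm (indicator {p n..q n} t *\<^sub>R g t) \<le> norm (indicator {0<..} t *\<^sub>R g t)" for n
      using pq[of n] by (intro AE_I2) (auto simp: indicator_def)
    show "AE t in lborel. (\<lambda>n. indicator {p n..q n} t *\<^sub>R g t) \<longlonglongrightarrow> indicator {0<..} t *\<^sub>R g t"
    proof (rule AE_I2)
      fix t :: real
      show "(\<lambda>n. indicator {p n..q n} t *\<^sub>R g t) \<longlonglongrightarrow> indicator {0<..} t *\<^sub>R g t"
      proof (cases "t > 0")
        case True
        obtain m where m: "t < real m" "1 / t < real m"
          using reals_Archimedean2[of "max t (1/t)"] by auto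
        have "t \<in> {p n..q n}" if "n \<ge> m" for n
        proof -
          have "1 / t < real n + 1" "t < real n + 1"
            using m that by auto
          then show ?thesis
            using True by (auto simp: p_def q_def field_simps)
        qed
        then have "eventually (\<lambda>n. indicator {p n..q n} t *\<^sub>R g t = indicator {0<..} t *\<^sub>R g t) sequentially"
          using True by (intro eventually_sequentiallyI[of m]) auto
        then show ?thesis by (rule tendsto_eventually)
      next
        case False
        then have "t \<notin> {p n..q n}" for n
          using pq[of n] by auto
        then show ?thesis
          using False by simp
      qed
    qed
  qed
  moreover have "(\<lambda>n. G (q n) - G (p n)) \<longlonglongrightarrow> l1 - l0"
  proof (rule tendsto_diff)
    have "filterlim q at_top sequentially"
      using filterlim_compose[OF filterlim_real_sequentially filterlim_Suc] by (simp add: q_def add.commute)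
    then show "(\<lambda>n. G (q n)) \<longlonglongrightarrow> l1"
      using l1 filterlim_compose by blast
    have "filterlim p (at_right 0) sequentially"
      unfolding filterlim_at
    proof
      have "p = (\<lambda>n. inverse (real (Suc n)))"
        by (auto simp: p_def field_simps)
      then show "p \<longlonglongrightarrow> 0"
        using LIMSEQ_inverse_real_of_nat by simp
    qed (use pq in \<open>auto intro!: always_eventually simp: less_imp_neq[symmetric]\<close>)
    then show "(\<lambda>n. G (p n)) \<longlonglongrightarrow> l0"
      using l0 filterlim_compose by blast
  qed
  ultimately have "(LINT t|lborel. indicator {0<..} t *\<^sub>R g t) = l1 - l0"
    by (auto intro: LIMSEQ_unique)
  then show ?thesis
    by (simp add: half_line_integral_eq set_lebesgue_integral_def)
qed

text \<open>For nonnegative integrands gauge and Lebesgue integrability coincide; Borel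
  measurability then permits the passage from the completion to \<open>lborel\<close>
  itself.\<close>

lemma set_integrable_of_has_integral:
  fixes f :: "real \<Rightarrow> real"
  assumes "(f has_integral I) A" "\<And>x. x \<in> A \<Longrightarrow> f x \<ge> 0"
    and "f \<in> borel_measurable borel" "A \<in> sets borel"
  shows "set_integrable lborel A f"
proof -
  have "f absolutely_integrable_on A"
    using assms by (intro nonnegative_absolutely_integrable_1) (auto simp: has_integral_iff)
  then have "integrable (completion lborel) (\<lambda>x. indicator A x *\<^sub>R f x)"
    by (simp add: set_integrable_def)
  then show ?thesis
    using assms by (subst (asm) integrable_completion) (auto simp: set_integrable_def)
qed

section \<open>Bessel functions and their asymptotics\<close>

definition bessel_coeff :: "real \<Rightarrow> nat \<Rightarrow> real" where
  "bessel_coeff \<nu> m = (-1) ^ m / (fact m * Gamma (real m + \<nu> + 1))"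

text \<open>The Bessel-Clifford function at -x, that is, the entire factor in J(z) = (z/2)^\<nu>
  E(z^2/4). Once the power is split off, the series can be differentiated term by term at every real
  point.\<close>

definition bessel_entire :: "real \<Rightarrow> real \<Rightarrow> real" where
  "bessel_entire \<nu> x = (\<Sum>m. bessel_coeff \<nu> m * x ^ m)"

text \<open>Each identity cancels one factor of the denominator: the first uses \<Gamma>(s+1) = s
  \<Gamma>(s), the second the factorial. They are the coefficient forms of the recurrence and of the
  derivative formula for the series.\<close>

lemma bessel_coeff_shift:
  assumes "\<nu> > -1"
  shows "bessel_coeff \<nu> m = (real m + \<nu> + 1) * bessel_coeff (\<nu> + 1) m"
    and "real (Suc m) * bessel_coeff \<nu> (Suc m) = - bessel_coeff (\<nu> + 1) m"
proof -
  have pos: "real m + \<nu> + 1 > 0"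
    using assms by (simp add: add_pos_nonneg add.commute)
  then have "Gamma (real m + \<nu> + 1 + 1) = (real m + \<nu> + 1) * Gamma (real m + \<nu> + 1)"
    by (intro Gamma_plus1) (auto elim: nonpos_Ints_cases)
  moreover have "Gamma (real m + \<nu> + 1) > 0"
    using pos by (rule Gamma_real_pos)
  ultimately show "bessel_coeff \<nu> m = (real m + \<nu> + 1) * bessel_coeff (\<nu> + 1) m"
    using pos by (simp add: bessel_coeff_def add_ac)
  have "real (Suc m) / fact (Suc m) = 1 / fact m"
    by (simp add: fact_Suc del: of_nat_Suc)
  then show "real (Suc m) * bessel_coeff \<nu> (Suc m) = - bessel_coeff (\<nu> + 1) m"
    by (simp add: bessel_coeff_def add_ac divide_simps)
qed

lemma summable_bessel_coeff:
  assumes "\<nu> > -1"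
  shows "summable (\<lambda>m. bessel_coeff \<nu> m * x ^ m)"
proof -
  obtain n :: nat where n: "2 * \<bar>x\<bar> \<le> real n"
    using real_arch_simple by blast
  \<comment> \<open>From this index on m \<ge> 1, so m + \<nu> + 1 \<ge> 1 for every \<nu> > -1, and
    m \<ge> 2|x| makes the ratio of consecutive terms at most 1/2.\<close>
  define N where "N = Suc n"
  have N: "2 * \<bar>x\<bar> \<le> real N" "N \<ge> 1"
    using n by (auto simp: N_def)
  show ?thesis
  proof (rule summable_ratio_test[of "1/2" N])
    fix m :: nat assume m: "m \<ge> N"
    have pos: "real m + \<nu> + 1 \<ge> 1"
      using assms m N by auto
    have "real (Suc m) * \<bar>bessel_coeff \<nu> (Suc m)\<bar> = \<bar>bessel_coeff (\<nu> + 1) m\<bar>"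
      using bessel_coeff_shift(2)[OF assms, of m] by (metis abs_minus_cancel abs_mult abs_of_nat)
    also have "\<dots> \<le> (real m + \<nu> + 1) * \<bar>bessel_coeff (\<nu> + 1) m\<bar>"
      using pos mult_right_mono[of 1 "real m + \<nu> + 1" "\<bar>bessel_coeff (\<nu> + 1) m\<bar>"] by simp
    also have "\<dots> = \<bar>bessel_coeff \<nu> m\<bar>"
      using bessel_coeff_shift(1)[OF assms, of m] pos by (simp add: abs_mult)
    finally have le: "real (Suc m) * \<bar>bessel_coeff \<nu> (Suc m)\<bar> \<le> \<bar>bessel_coeff \<nu> m\<bar>" .
    have "2 * \<bar>x\<bar> * \<bar>bessel_coeff \<nu> (Suc m)\<bar> \<le> real (Suc m) * \<bar>bessel_coeff \<nu> (Suc m)\<bar>"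
      using N m by (intro mult_right_mono) auto
    then have "\<bar>x\<bar> * \<bar>bessel_coeff \<nu> (Suc m)\<bar> \<le> 1 / 2 * \<bar>bessel_coeff \<nu> m\<bar>"
      using le by linarith
    then have "(\<bar>x\<bar> * \<bar>bessel_coeff \<nu> (Suc m)\<bar>) * \<bar>x\<bar> ^ m \<le> (1 / 2 * \<bar>bessel_coeff \<nu> m\<bar>) * \<bar>x\<bar> ^ m"
      by (intro mult_right_mono) auto
    then show "norm (bessel_coeff \<nu> (Suc m) * x ^ Suc m) \<le> 1 / 2 * norm (bessel_coeff \<nu> m * x ^ m)"
      by (simp add: abs_mult power_abs mult_ac)
  qed simp
qed

lemma bessel_entire_has_derivative:
  assumes "\<nu> > -1"
  shows "(bessel_entire \<nu> has_real_derivative - bessel_entire (\<nu> + 1) x) (at x)"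
proof -
  have "((\<lambda>x. \<Sum>m. bessel_coeff \<nu> m * x ^ m) has_real_derivative (\<Sum>m. diffs (bessel_coeff \<nu>) m * x ^ m)) (at x)"
    by (rule termdiffs_strong_converges_everywhere) (rule summable_bessel_coeff[OF assms])
  moreover have "diffs (bessel_coeff \<nu>) m = - bessel_coeff (\<nu> + 1) m" for m
    using bessel_coeff_shift(2)[OF assms] by (simp add: diffs_def)
  moreover have "(\<Sum>m. - bessel_coeff (\<nu> + 1) m * x ^ m) = - bessel_entire (\<nu> + 1) x"
    using suminf_minus[OF summable_bessel_coeff[of "\<nu> + 1" x]] assms by (simp add: bessel_entire_def)
  ultimately show ?thesis
    unfolding bessel_entire_def[abs_def] by simp
qed

text \<open>In \<open>bessel_coeff_shift(1)\<close> the factor m + \<nu> + 1 is split: \<nu> + 1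
  multiplies the series of order \<nu> + 1, and m produces x times the derivative of that series.
  This is the usual three-term recurrence of Bessel functions.\<close>

lemma bessel_entire_recurrence:
  assumes "\<nu> > -1"
  shows "bessel_entire \<nu> x = (\<nu> + 1) * bessel_entire (\<nu> + 1) x - x * bessel_entire (\<nu> + 2) x"
proof -
  define d where "d = bessel_coeff (\<nu> + 1)"
  have s2: "(\<lambda>m. diffs d m * x ^ m) sums (- bessel_entire (\<nu> + 2) x)"
  proof -
    have "diffs d m = - bessel_coeff (\<nu> + 2) m" for m
      using bessel_coeff_shift(2)[of "\<nu> + 1" m] assms by (simp add: diffs_def d_def add_ac)
    moreover have "(\<lambda>m. bessel_coeff (\<nu> + 2) m * x ^ m) sums bessel_entire (\<nu> + 2) x"
      unfolding bessel_entire_def using assms by (intro summable_sums summable_bessel_coeff) simp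
    ultimately show ?thesis
      using sums_minus by fastforce
  qed
  have "(\<lambda>m. real m * d m * x ^ (m - Suc 0)) sums (- bessel_entire (\<nu> + 2) x)"
    using diffs_equiv[of d x] s2 by (simp add: sums_iff)
  then have "(\<lambda>m. x * (real m * d m * x ^ (m - Suc 0))) sums (x * (- bessel_entire (\<nu> + 2) x))"
    by (rule sums_mult)
  \<comment> \<open>At m = 0 the truncated exponent is harmless, since the factor m
    vanishes.\<close>
  moreover have "x * (real m * d m * x ^ (m - Suc 0)) = real m * d m * x ^ m" for m
    by (cases m) auto
  ultimately have "(\<lambda>m. real m * d m * x ^ m) sums (x * (- bessel_entire (\<nu> + 2) x))"
    by simp
  moreover have "(\<lambda>m. (\<nu> + 1) * (d m * x ^ m)) sums ((\<nu> + 1) * bessel_entire (\<nu> + 1) x)"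
    unfolding bessel_entire_def d_def using assms by (intro sums_mult summable_sums summable_bessel_coeff) simp
  ultimately have "(\<lambda>m. (\<nu> + 1) * (d m * x ^ m) + real m * d m * x ^ m) sums
      ((\<nu> + 1) * bessel_entire (\<nu> + 1) x + x * (- bessel_entire (\<nu> + 2) x))"
    by (intro sums_add)
  moreover have "(\<nu> + 1) * (d m * x ^ m) + real m * d m * x ^ m = bessel_coeff \<nu> m * x ^ m" for m
    using bessel_coeff_shift(1)[OF assms, of m] by (simp add: d_def algebra_simps)
  ultimately show ?thesis
    by (simp add: bessel_entire_def sums_iff)
qed

text \<open>The overview's u; its v is \<open>bessel_u (\<nu> + 1)\<close>. The square root turns
  the Bessel kernel into the integral of u(xt) u(yt) a(t) and gives the oscillation a constant
  amplitude at infinity.\<close>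

definition bessel_u :: "real \<Rightarrow> real \<Rightarrow> real" where
  "bessel_u \<nu> t = sqrt t * bessel_J \<nu> t"

lemma bessel_u_eq:
  assumes "\<nu> > -1" "t > 0"
  shows "bessel_u \<nu> t = 2 powr (- \<nu>) * t powr (\<nu> + 1 / 2) * bessel_entire \<nu> (t\<^sup>2 / 4)"
proof -
  have "bessel_J \<nu> t = (\<Sum>m. (t / 2) powr \<nu> * (bessel_coeff \<nu> m * (t\<^sup>2 / 4) ^ m))"
    unfolding bessel_J_def
  proof (rule suminf_cong)
    fix m
    have "(t / 2) powr (2 * real m + \<nu>) = (t / 2) powr (real (2 * m)) * (t / 2) powr \<nu>"
      by (simp add: powr_add)
    also have "(t / 2) powr (real (2 * m)) = (t\<^sup>2 / 4) ^ m"
      using assms(2) by (subst powr_realpow) (auto simp: power_mult power_divide)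
    finally show "(- 1) ^ m / (fact m * Gamma (real m + \<nu> + 1)) * (t / 2) powr (2 * real m + \<nu>)
        = (t / 2) powr \<nu> * (bessel_coeff \<nu> m * (t\<^sup>2 / 4) ^ m)"
      by (simp add: bessel_coeff_def)
  qed
  also have "\<dots> = (t / 2) powr \<nu> * bessel_entire \<nu> (t\<^sup>2 / 4)"
    unfolding bessel_entire_def by (rule suminf_mult[OF summable_bessel_coeff[OF assms(1)]])
  also have "(t / 2) powr \<nu> = 2 powr (- \<nu>) * t powr \<nu>"
    using assms(2) by (simp add: powr_divide powr_minus_divide)
  finally show ?thesis
    using assms(2) by (simp add: bessel_u_def powr_add powr_half_sqrt)
qed

text \<open>Differentiating the series raises its order by one. In the second formula this would
  introduce order \<nu> + 2; the recurrence trades it for order \<nu>, which closes the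
  system.\<close>

lemma bessel_u_has_derivative:
  assumes "\<nu> > -1" "t > 0"
  shows "(bessel_u \<nu> has_real_derivative (\<nu> + 1 / 2) * bessel_u \<nu> t / t - bessel_u (\<nu> + 1) t) (at t)"
    and "(bessel_u (\<nu> + 1) has_real_derivative bessel_u \<nu> t - (\<nu> + 1 / 2) * bessel_u (\<nu> + 1) t / t) (at t)"
proof -
  have ent: "((\<lambda>t. bessel_entire \<mu> (t\<^sup>2 / 4)) has_real_derivative - bessel_entire (\<mu> + 1) (t\<^sup>2 / 4) * (t / 2)) (at t)"
    if "\<mu> > -1" for \<mu>
    by (rule DERIV_chain'[OF _ bessel_entire_has_derivative[OF that]]) (auto intro!: derivative_eq_intros)
  have der: "(bessel_u \<mu> has_real_derivative
      2 powr (- \<mu>) * ((\<mu> + 1 / 2) * t powr (\<mu> + 1 / 2 - 1) * bessel_entire \<mu> (t\<^sup>2 / 4)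
        - t powr (\<mu> + 1 / 2) * bessel_entire (\<mu> + 1) (t\<^sup>2 / 4) * (t / 2))) (at t)" if \<mu>: "\<mu> > -1" for \<mu>
  proof -
    have "((\<lambda>t. 2 powr (- \<mu>) * t powr (\<mu> + 1 / 2) * bessel_entire \<mu> (t\<^sup>2 / 4)) has_real_derivative
      2 powr (- \<mu>) * ((\<mu> + 1 / 2) * t powr (\<mu> + 1 / 2 - 1) * bessel_entire \<mu> (t\<^sup>2 / 4)
        - t powr (\<mu> + 1 / 2) * bessel_entire (\<mu> + 1) (t\<^sup>2 / 4) * (t / 2))) (at t)"
      using assms(2) \<mu>
      by (auto intro!: derivative_eq_intros ent simp: algebra_simps)
    then show ?thesis
      by (rule has_field_derivative_transform_within_open[where S="{0<..}"])
        (use assms(2) \<mu> in \<open>auto simp: bessel_u_eq\<close>)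
  qed
  have t1: "t powr (\<nu> + 1 / 2 - 1) = t powr (\<nu> + 1 / 2) / t"
    using assms(2) powr_diff[of t "\<nu> + 1 / 2" 1] by simp
  have t2: "t powr (\<nu> + 1 + 1 / 2) = t powr (\<nu> + 1 / 2) * t"
    using assms(2) powr_add[of t "\<nu> + 1 / 2" 1] by (simp add: algebra_simps)
  have t3: "2 powr (- \<nu>) = 2 * 2 powr (- (\<nu> + 1))"
    by (simp add: powr_diff powr_minus_divide powr_add)
  \<comment> \<open>With the powers and the series values opaque, both claims become rational
    identities in t.\<close>
  define P Q e0 e1 e2 where "P = t powr (\<nu> + 1 / 2)" and "Q = 2 powr (- (\<nu> + 1))"
    and "e0 = bessel_entire \<nu> (t\<^sup>2 / 4)" and "e1 = bessel_entire (\<nu> + 1) (t\<^sup>2 / 4)"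
    and "e2 = bessel_entire (\<nu> + 1 + 1) (t\<^sup>2 / 4)"
  have u0: "bessel_u \<nu> t = 2 * Q * P * e0" and u1: "bessel_u (\<nu> + 1) t = Q * (P * t) * e1"
    using assms by (simp_all only: bessel_u_eq t2 t3 P_def Q_def e0_def e1_def)
  have d0: "(bessel_u \<nu> has_real_derivative 2 * Q * ((\<nu> + 1 / 2) * (P / t) * e0 - P * e1 * (t / 2))) (at t)"
    using der[OF assms(1)] by (simp only: t1 t3 P_def Q_def e0_def e1_def)
  show "(bessel_u \<nu> has_real_derivative (\<nu> + 1 / 2) * bessel_u \<nu> t / t - bessel_u (\<nu> + 1) t) (at t)"
    unfolding u0 u1 by (rule DERIV_cong[OF d0]) (use assms in \<open>simp add: field_simps\<close>)
  have rec: "e0 = (\<nu> + 1) * e1 - t\<^sup>2 / 4 * e2"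
    using bessel_entire_recurrence[OF assms(1), of "t\<^sup>2 / 4"]
    by (simp add: e0_def e1_def e2_def add.assoc)
  have "t powr (\<nu> + 1 + 1 / 2 - 1) = P"
    by (simp add: P_def add.commute)
  then have d1: "(bessel_u (\<nu> + 1) has_real_derivative
      Q * ((\<nu> + 1 + 1 / 2) * P * e1 - P * t * e2 * (t / 2))) (at t)"
    using der[of "\<nu> + 1"] assms by (simp only: t2 P_def Q_def e1_def e2_def)
  show "(bessel_u (\<nu> + 1) has_real_derivative bessel_u \<nu> t - (\<nu> + 1 / 2) * bessel_u (\<nu> + 1) t / t) (at t)"
    unfolding u0 u1 rec by (rule DERIV_cong[OF d1]) (use assms in \<open>simp add: field_simps power2_eq_square\<close>)
qed

lemma borel_measurable_bessel_u [measurable]: "bessel_u \<nu> \<in> borel_measurable borel"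
  unfolding bessel_u_def[abs_def] bessel_J_def by measurable

lemma bessel_u_near_zero:
  assumes "\<nu> > -1"
  obtains K where "\<And>t. 0 < t \<Longrightarrow> t \<le> 1 \<Longrightarrow> \<bar>bessel_u \<nu> t\<bar> \<le> K * t powr (\<nu> + 1 / 2)"
proof -
  have "continuous_on {0..1} (\<lambda>x. bessel_entire \<nu> x)"
    using bessel_entire_has_derivative[OF assms]
    by (intro continuous_at_imp_continuous_on) (auto intro: DERIV_isCont)
  then have "bounded (bessel_entire \<nu> ` {0..1})"
    by (intro compact_imp_bounded compact_continuous_image) auto
  then obtain C where C: "\<And>x. x \<in> {0..1} \<Longrightarrow> \<bar>bessel_entire \<nu> x\<bar> \<le> C"
    unfolding bounded_iff by (metis imageI real_norm_def)
  have "\<bar>bessel_u \<nu> t\<bar> \<le> (2 powr (- \<nu>) * C) * t powr (\<nu> + 1 / 2)" if t: "0 < t" "t \<le> 1" for t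
  proof -
    have "t\<^sup>2 \<le> 1"
      using t by (simp add: power_le_one)
    then have "\<bar>bessel_entire \<nu> (t\<^sup>2 / 4)\<bar> \<le> C"
      by (intro C) auto
    then have "(2 powr (- \<nu>) * t powr (\<nu> + 1 / 2)) * \<bar>bessel_entire \<nu> (t\<^sup>2 / 4)\<bar>
        \<le> (2 powr (- \<nu>) * t powr (\<nu> + 1 / 2)) * C"
      by (intro mult_left_mono) auto
    then show ?thesis
      using t assms by (simp add: bessel_u_eq abs_mult mult_ac)
  qed
  then show ?thesis by (rule that)
qed

text \<open>With r = v - \<kappa>u/t the system becomes u' = -r, r' = u - c u/t^2 with c =
  \<kappa>^2 - \<kappa>, a rotation with an integrable perturbation. The energy u^2 + r^2 stays
  bounded, so e^(-it) (u + ir) has derivative O(t^-2) and converges at rate 1/t. Returning from r to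
  v costs another term of order 1/t.\<close>

lemma oscillator_asymptotics:
  fixes u v :: "real \<Rightarrow> real"
  assumes u: "\<And>t. t > 0 \<Longrightarrow> (u has_real_derivative \<kappa> * u t / t - v t) (at t)"
    and v: "\<And>t. t > 0 \<Longrightarrow> (v has_real_derivative u t - \<kappa> * v t / t) (at t)"
  obtains \<Theta> K where "\<And>t. t \<ge> 1 \<Longrightarrow> norm (Complex (u t) (v t) - exp (\<i> * of_real t) * \<Theta>) \<le> K / t"
proof -
  define c where "c = \<kappa>\<^sup>2 - \<kappa>"
  define r where "r = (\<lambda>t. v t - \<kappa> * u t / t)"
  have du: "(u has_real_derivative - r t) (at t)" if "t > 0" for t
    using u[OF that] by (simp add: r_def)
  have dr: "(r has_real_derivative u t - c * u t / t\<^sup>2) (at t)" if t: "t > 0" for t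
    unfolding r_def
    by (rule DERIV_cong[OF DERIV_diff[OF v[OF t] DERIV_divide[OF DERIV_cmult[OF u[OF t], of \<kappa>] DERIV_ident]]])
      (use t in \<open>auto simp: c_def field_simps power2_eq_square\<close>)
  \<comment> \<open>The energy grows at relative rate at most |c|/t^2. The factor exp(|c|/t) has
    logarithmic derivative -|c|/t^2, so the product is nonincreasing.\<close>
  define M where "M = (\<lambda>t. ((u t)\<^sup>2 + (r t)\<^sup>2) * exp (\<bar>c\<bar> / t))"
  have "M t \<le> M 1" if t: "t \<ge> 1" for t
  proof (rule DERIV_nonpos_imp_nonincreasing[OF t])
    fix s assume "1 \<le> s" "s \<le> t"
    then have s: "s > 0" by simp
    have E: "((\<lambda>t. exp (\<bar>c\<bar> / t)) has_real_derivative exp (\<bar>c\<bar> / s) * (- \<bar>c\<bar> / s\<^sup>2)) (at s)"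
      using s by (auto intro!: derivative_eq_intros simp: power2_eq_square)
    have "(M has_real_derivative (2 * u s * (- r s) + 2 * r s * (u s - c * u s / s\<^sup>2)) * exp (\<bar>c\<bar> / s)
        + ((u s)\<^sup>2 + (r s)\<^sup>2) * (exp (\<bar>c\<bar> / s) * (- \<bar>c\<bar> / s\<^sup>2))) (at s)"
      unfolding M_def
      by (rule DERIV_cong[OF DERIV_mult[OF DERIV_add[OF DERIV_power[OF du[OF s], of 2]
            DERIV_power[OF dr[OF s], of 2]] E]])
        (use s in \<open>simp add: field_simps power2_eq_square\<close>)
    moreover have "(2 * u s * (- r s) + 2 * r s * (u s - c * u s / s\<^sup>2)) * exp (\<bar>c\<bar> / s)
        + ((u s)\<^sup>2 + (r s)\<^sup>2) * (exp (\<bar>c\<bar> / s) * (- \<bar>c\<bar> / s\<^sup>2))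
      = - (exp (\<bar>c\<bar> / s) / s\<^sup>2 * (2 * c * u s * r s + \<bar>c\<bar> * ((u s)\<^sup>2 + (r s)\<^sup>2)))"
      using s by (simp add: field_simps)
    moreover have "2 * c * u s * r s + \<bar>c\<bar> * ((u s)\<^sup>2 + (r s)\<^sup>2) \<ge> 0"
    proof -
      have "\<bar>2 * u s * r s\<bar> \<le> (u s)\<^sup>2 + (r s)\<^sup>2"
        using sum_squares_bound[of "u s" "r s"] sum_squares_bound[of "u s" "- r s"] by auto
      then have "\<bar>c\<bar> * \<bar>2 * u s * r s\<bar> \<le> \<bar>c\<bar> * ((u s)\<^sup>2 + (r s)\<^sup>2)"
        by (intro mult_left_mono) auto
      moreover have "\<bar>c\<bar> * \<bar>2 * u s * r s\<bar> = \<bar>2 * c * u s * r s\<bar>"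
        by (simp add: abs_mult)
      ultimately show ?thesis by linarith
    qed
    then have "- (exp (\<bar>c\<bar> / s) / s\<^sup>2 * (2 * c * u s * r s + \<bar>c\<bar> * ((u s)\<^sup>2 + (r s)\<^sup>2))) \<le> 0"
      by simp
    ultimately show "\<exists>y. DERIV M s :> y \<and> y \<le> 0"
      by metis
  qed
  moreover have "(u t)\<^sup>2 + (r t)\<^sup>2 \<le> M t" if "t \<ge> 1" for t
    using that mult_left_mono[of 1 "exp (\<bar>c\<bar> / t)" "(u t)\<^sup>2 + (r t)\<^sup>2"] by (simp add: M_def)
  ultimately have "(u t)\<^sup>2 \<le> M 1" if "t \<ge> 1" for t
    using that by (smt (verit) zero_le_power2)
  then have ub: "\<bar>u t\<bar> \<le> sqrt (M 1)" if "t \<ge> 1" for t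
    using that real_le_rsqrt[of "\<bar>u t\<bar>" "M 1"] by simp
  define K1 where "K1 = sqrt (M 1)"
  have K1: "K1 \<ge> 0"
    using order_trans[OF abs_ge_zero ub[of 1]] by (simp add: K1_def)
  \<comment> \<open>Passing to the rotating frame: only the perturbation c u/t^2 is left in the
    derivative.\<close>
  define \<theta> where "\<theta> = (\<lambda>t. exp (- \<i> * of_real t) * Complex (u t) (r t))"
  have d\<theta>: "(\<theta> has_vector_derivative exp (- \<i> * of_real t) * (- \<i> * of_real (c * u t / t\<^sup>2))) (at t)"
    if t: "t > 0" for t
  proof -
    have cu: "((\<lambda>t. complex_of_real (u t)) has_vector_derivative of_real (- r t)) (at t)"
      by (rule has_vector_derivative_of_real) (use du[OF t] in \<open>simp add: has_real_derivative_iff_has_vector_derivative\<close>)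
    have cr: "((\<lambda>t. complex_of_real (r t)) has_vector_derivative of_real (u t - c * u t / t\<^sup>2)) (at t)"
      by (rule has_vector_derivative_of_real) (use dr[OF t] in \<open>simp add: has_real_derivative_iff_has_vector_derivative\<close>)
    have "((\<lambda>t. exp (- \<i> * of_real t) * (complex_of_real (u t) + \<i> * complex_of_real (r t))) has_vector_derivative
        exp (- \<i> * of_real t) * (of_real (- r t) + \<i> * of_real (u t - c * u t / t\<^sup>2))
        + (- \<i> * exp (- \<i> * of_real t)) * (complex_of_real (u t) + \<i> * complex_of_real (r t))) (at t)"
      by (intro has_vector_derivative_mult has_vector_derivative_add
          has_vector_derivative_mult_right cu cr has_vector_derivative_exp_of_real)
    moreover have "exp (- \<i> * of_real t) * (of_real (- r t) + \<i> * of_real (u t - c * u t / t\<^sup>2))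
        + (- \<i> * exp (- \<i> * of_real t)) * (complex_of_real (u t) + \<i> * complex_of_real (r t))
      = exp (- \<i> * of_real t) * (- \<i> * of_real (c * u t / t\<^sup>2))"
      by (simp add: algebra_simps)
    ultimately show ?thesis
      unfolding \<theta>_def Complex_eq by simp
  qed
  define L where "L = \<bar>c\<bar> * K1"
  have L: "L \<ge> 0"
    using K1 by (simp add: L_def)
  have step: "norm (\<theta> t - \<theta> s) \<le> L / s" if st: "1 \<le> s" "s < t" for s t
  proof -
    have "norm (\<theta> t - \<theta> s) \<le> (- L / t) - (- L / s)"
    proof (rule differentiable_bound_general[OF st(2), where \<phi>="\<lambda>t. - L / t" and \<phi>'="\<lambda>t. L / t\<^sup>2"])
      show "continuous_on {s..t} \<theta>"
        using st by (intro continuous_at_imp_continuous_on ballI has_vector_derivative_continuous[OF d\<theta>]) auto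
      show "continuous_on {s..t} (\<lambda>t. - L / t)"
        using st by (intro continuous_intros) auto
      fix x assume x: "s < x" "x < t"
      show "(\<theta> has_vector_derivative exp (- \<i> * of_real x) * (- \<i> * of_real (c * u x / x\<^sup>2))) (at x)"
        using x st by (intro d\<theta>) auto
      show "((\<lambda>t. - L / t) has_vector_derivative L / x\<^sup>2) (at x)"
        using x st unfolding has_real_derivative_iff_has_vector_derivative[symmetric]
        by (auto intro!: derivative_eq_intros simp: power2_eq_square)
      have "\<bar>c\<bar> * \<bar>u x\<bar> \<le> L"
        unfolding L_def K1_def using x st ub[of x] by (intro mult_left_mono) auto
      moreover have "norm (exp (- \<i> * of_real x)) = 1"
        by (simp add: norm_exp_eq_Re)
      ultimately show "norm (exp (- \<i> * of_real x) * (- \<i> * of_real (c * u x / x\<^sup>2))) \<le> L / x\<^sup>2"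
        by (simp add: norm_mult norm_divide norm_power abs_mult divide_right_mono)
    qed
    also have "\<dots> \<le> L / s"
      using st L by simp
    finally show ?thesis .
  qed
  \<comment> \<open>The limit is built along the integers; \<open>step\<close> then carries it over
    to all real t with the same rate. The shift to \<open>Suc n\<close> keeps the points in the
    range t \<ge> 1.\<close>
  have "Cauchy (\<lambda>n. \<theta> (real (Suc n)))"
  proof (rule CauchyI')
    fix e :: real assume e: "e > 0"
    obtain N :: nat where N: "L / e < real N"
      using reals_Archimedean2 by blast
    have "dist (\<theta> (real (Suc m))) (\<theta> (real (Suc n))) < e" if "m \<ge> N" "m < n" for m n
    proof -
      have "dist (\<theta> (real (Suc m))) (\<theta> (real (Suc n))) \<le> L / real (Suc m)"
        using step[of "real (Suc m)" "real (Suc n)"] that by (simp add: dist_norm norm_minus_commute)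
      also have "L / real (Suc m) < e"
      proof -
        have "L < e * real N"
          using N e by (simp add: field_simps)
        also have "\<dots> \<le> e * real (Suc m)"
          using that e by (intro mult_left_mono) auto
        finally show ?thesis
          by (simp add: field_simps)
      qed
      finally show ?thesis .
    qed
    then show "\<exists>M. \<forall>m\<ge>M. \<forall>n>m. dist (\<theta> (real (Suc m))) (\<theta> (real (Suc n))) < e"
      by blast
  qed
  then obtain \<Theta> where \<Theta>: "(\<lambda>n. \<theta> (real (Suc n))) \<longlonglongrightarrow> \<Theta>"
    using Cauchy_convergent convergent_def by blast
  have lim: "norm (\<theta> t - \<Theta>) \<le> L / t" if t: "t \<ge> 1" for t
  proof -
    have "(\<lambda>n. \<theta> (real (Suc n)) - \<theta> t) \<longlonglongrightarrow> \<Theta> - \<theta> t"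
      by (intro tendsto_intros \<Theta>)
    moreover obtain N :: nat where N: "t < real N"
      using reals_Archimedean2 by blast
    have "\<forall>\<^sub>F n in sequentially. norm (\<theta> (real (Suc n)) - \<theta> t) \<le> L / t"
    proof (rule eventually_sequentiallyI[of N])
      fix n assume "n \<ge> N"
      then have "t < real (Suc n)" using N by simp
      then show "norm (\<theta> (real (Suc n)) - \<theta> t) \<le> L / t"
        using t by (intro step) auto
    qed
    ultimately have "norm (\<Theta> - \<theta> t) \<le> L / t"
      using Lim_norm_ubound[OF trivial_limit_sequentially] by blast
    then show ?thesis by (simp add: norm_minus_commute)
  qed
  have "norm (Complex (u t) (v t) - exp (\<i> * of_real t) * \<Theta>) \<le> (L + \<bar>\<kappa>\<bar> * K1) / t" if t: "t \<ge> 1" for t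
  proof -
    have "Complex (u t) (v t) = Complex (u t) (r t) + \<i> * of_real (\<kappa> * u t / t)"
      by (simp add: r_def complex_eq_iff)
    moreover have "Complex (u t) (r t) = exp (\<i> * of_real t) * \<theta> t"
      by (simp add: \<theta>_def exp_minus field_simps)
    ultimately have "Complex (u t) (v t) - exp (\<i> * of_real t) * \<Theta>
        = exp (\<i> * of_real t) * (\<theta> t - \<Theta>) + \<i> * of_real (\<kappa> * u t / t)"
      by (simp add: algebra_simps)
    also have "norm \<dots> \<le> norm (\<theta> t - \<Theta>) + \<bar>\<kappa> * u t / t\<bar>"
      by (rule norm_triangle_le) (simp add: norm_mult norm_divide abs_mult)
    also have "\<bar>\<kappa> * u t / t\<bar> \<le> \<bar>\<kappa>\<bar> * K1 / t"
      using t ub[OF t] by (auto simp: abs_mult K1_def intro!: divide_right_mono mult_left_mono)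
    also have "norm (\<theta> t - \<Theta>) \<le> L / t"
      by (rule lim[OF t])
    finally show ?thesis
      by (simp add: add_divide_distrib)
  qed
  then show ?thesis by (rule that)
qed

section \<open>The amplitude of the asymptotics\<close>

lemma half_line_scale:
  fixes f :: "real \<Rightarrow> 'b::{banach, second_countable_topology}"
  assumes "c > 0"
  shows "integrable half_line (\<lambda>t. f (c * t)) \<longleftrightarrow> integrable half_line f"
    and "(LINT t|half_line. f t) = c *\<^sub>R (LINT t|half_line. f (c * t))"
proof -
  have ind: "indicator {0<..} (c * t) = (indicator {0<..} t :: real)" for t
    using assms by (auto simp: indicator_def zero_less_mult_iff)
  show "integrable half_line (\<lambda>t. f (c * t)) \<longleftrightarrow> integrable half_line f"
    unfolding half_line_integrable_iff set_integrable_def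
    using assms lborel_integrable_real_affine_iff[of c "\<lambda>t. indicator {0<..} t *\<^sub>R f t" 0]
    by (simp add: ind)
  show "(LINT t|half_line. f t) = c *\<^sub>R (LINT t|half_line. f (c * t))"
    unfolding half_line_integral_eq set_lebesgue_integral_def
    using assms lborel_integral_real_affine[of c "\<lambda>t. indicator {0<..} t *\<^sub>R f t" 0]
    by (simp add: ind)
qed

lemma half_line_gamma:
  assumes "\<alpha> > -1"
  shows "integrable half_line (\<lambda>t. t powr \<alpha> * exp (- t))"
    and "(LINT t|half_line. t powr \<alpha> * exp (- t)) = Gamma (\<alpha> + 1)"
proof -
  have eq: "t powr (\<alpha> + 1 - 1) / exp t = t powr \<alpha> * exp (- t)" for t :: real
    by (simp add: exp_minus field_simps)
  have h: "((\<lambda>t. t powr \<alpha> * exp (- t)) has_integral Gamma (\<alpha> + 1)) {0..}"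
    using Gamma_integral_real[of "\<alpha> + 1"] assms unfolding eq by simp
  then have si: "set_integrable lborel {0..} (\<lambda>t. t powr \<alpha> * exp (- t))"
    by (rule set_integrable_of_has_integral) auto
  then show "integrable half_line (\<lambda>t. t powr \<alpha> * exp (- t))"
    by (simp add: integrable_restrict_space set_integrable_def)
  have "(LINT t|half_line. t powr \<alpha> * exp (- t)) = (LINT t:{0..}|lborel. t powr \<alpha> * exp (- t))"
    by (simp add: integral_restrict_space set_lebesgue_integral_def)
  also have "\<dots> = integral {0..} (\<lambda>t. t powr \<alpha> * exp (- t))"
    by (rule set_borel_integral_eq_integral[OF si])
  finally show "(LINT t|half_line. t powr \<alpha> * exp (- t)) = Gamma (\<alpha> + 1)"
    using h by (simp add: integral_unique)
qed

lemma half_line_gamma_scaled: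
  assumes "\<alpha> > -1" "\<sigma> > 0"
  shows "integrable half_line (\<lambda>t. t powr \<alpha> * exp (- (\<sigma> * t)))"
proof -
  have "integrable half_line (\<lambda>t. (\<sigma> * t) powr \<alpha> * exp (- (\<sigma> * t)))"
    using half_line_scale(1)[OF assms(2), of "\<lambda>t. t powr \<alpha> * exp (- t)"] half_line_gamma[OF assms(1)] by simp
  then have "integrable half_line (\<lambda>t. \<sigma> powr (- \<alpha>) * ((\<sigma> * t) powr \<alpha> * exp (- (\<sigma> * t))))"
    by (rule integrable_mult_right)
  then show ?thesis
  proof (rule half_line_integrable_bound)
    show "(\<lambda>t. t powr \<alpha> * exp (- (\<sigma> * t))) \<in> borel_measurable half_line"
      by (rule measurable_restrict_space1) measurable
    show "norm (t powr \<alpha> * exp (- (\<sigma> * t))) \<le> \<sigma> powr - \<alpha> * ((\<sigma> * t) powr \<alpha> * exp (- (\<sigma> * t)))" if "t > 0" for t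
      using that assms by (simp add: powr_mult powr_minus field_simps)
  qed
qed

text \<open>Applied to -ht it bounds the difference quotient (e^(-ht) - 1)/h by t e^(|h|t), which is
  the majorant used when differentiating under the Laplace integral.\<close>

lemma abs_exp_minus_one_le: "\<bar>exp x - 1\<bar> \<le> \<bar>x\<bar> * exp \<bar>x\<bar>" for x :: real
proof -
  have "exp x - 1 \<le> \<bar>x\<bar> * exp \<bar>x\<bar>"
  proof -
    have "1 - exp (- \<bar>x\<bar>) \<le> \<bar>x\<bar>"
      using exp_ge_add_one_self[of "- \<bar>x\<bar>"] by simp
    then have "exp \<bar>x\<bar> * (1 - exp (- \<bar>x\<bar>)) \<le> exp \<bar>x\<bar> * \<bar>x\<bar>"
      by (intro mult_left_mono) auto
    moreover have "exp \<bar>x\<bar> * (1 - exp (- \<bar>x\<bar>)) = exp \<bar>x\<bar> - 1"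
      by (simp add: algebra_simps flip: exp_add)
    moreover have "exp x \<le> exp \<bar>x\<bar>" by simp
    ultimately show ?thesis
      unfolding mult.commute[of "\<bar>x\<bar>"] by linarith
  qed
  moreover have "1 - exp x \<le> \<bar>x\<bar> * exp \<bar>x\<bar>"
  proof -
    have "1 - exp x \<le> \<bar>x\<bar>"
      using exp_ge_add_one_self[of x] by linarith
    also have "\<dots> \<le> \<bar>x\<bar> * exp \<bar>x\<bar>"
      using mult_left_mono[of 1 "exp \<bar>x\<bar>" "\<bar>x\<bar>"] by simp
    finally show ?thesis .
  qed
  ultimately show ?thesis by linarith
qed

text \<open>For increments |h| < \<sigma>/2 the difference quotients are dominated by t
  e^(-\<sigma>t/2) |f(t)|, which is integrable by the second hypothesis at \<sigma>/2. Dominated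
  convergence is applied along arbitrary null sequences of increments.\<close>

lemma laplace_has_vector_derivative:
  fixes f :: "real \<Rightarrow> complex"
  assumes f: "\<And>\<sigma>. \<sigma> > 0 \<Longrightarrow> integrable half_line (\<lambda>t. of_real (exp (- (\<sigma> * t))) * f t)"
    and tf: "\<And>\<sigma>. \<sigma> > 0 \<Longrightarrow> integrable half_line (\<lambda>t. of_real (exp (- (\<sigma> * t))) * (of_real t * f t))"
    and \<sigma>: "\<sigma> > 0"
  shows "((\<lambda>\<sigma>. LINT t|half_line. of_real (exp (- (\<sigma> * t))) * f t) has_vector_derivative
     - (LINT t|half_line. of_real (exp (- (\<sigma> * t))) * (of_real t * f t))) (at \<sigma>)"
proof -
  define Y where "Y = (\<lambda>\<sigma>. LINT t|half_line. of_real (exp (- (\<sigma> * t))) * f t)"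
  define D where "D = - (LINT t|half_line. of_real (exp (- (\<sigma> * t))) * (of_real t * f t))"
  have "((\<lambda>h. (Y (\<sigma> + h) - Y \<sigma>) /\<^sub>R h) \<longlongrightarrow> D) (at 0)"
    unfolding tendsto_at_iff_sequentially
  proof (intro allI impI)
    fix X :: "nat \<Rightarrow> real"
    assume X0: "\<forall>i. X i \<in> UNIV - {0}" and X: "X \<longlonglongrightarrow> 0"
    have "\<forall>\<^sub>F n in sequentially. \<bar>X n\<bar> < \<sigma> / 2"
      using X \<sigma> order_tendstoD(2)[OF tendsto_rabs_zero[OF X], of "\<sigma> / 2"] by simp
    then obtain N where N: "\<And>n. n \<ge> N \<Longrightarrow> \<bar>X n\<bar> < \<sigma> / 2"
      by (auto simp: eventually_sequentially)
    \<comment> \<open>The tail of the sequence is taken so that the domination holds for every index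
      and not only eventually.\<close>
    define H where "H = (\<lambda>n. X (n + N))"
    have H: "H n \<noteq> 0" "\<bar>H n\<bar> < \<sigma> / 2" for n
      using X0 N[of "n + N"] by (auto simp: H_def)
    have Hlim: "H \<longlonglongrightarrow> 0"
      unfolding H_def using X by (rule LIMSEQ_ignore_initial_segment)
    define q where "q = (\<lambda>n t. (exp (- ((\<sigma> + H n) * t)) - exp (- (\<sigma> * t))) / H n)"
    have "(\<lambda>n. LINT t|half_line. of_real (q n t) * f t)
        \<longlonglongrightarrow> (LINT t|half_line. of_real (- t * exp (- (\<sigma> * t))) * f t)"
    proof (rule integral_dominated_convergence)
      show "integrable half_line (\<lambda>t. norm (complex_of_real (exp (- (\<sigma> / 2 * t))) * (of_real t * f t)))"
        using tf[of "\<sigma> / 2"] \<sigma> by (intro integrable_norm) simp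
      \<comment> \<open>Measurability of \<open>f\<close> is recovered from its damped version by
        multiplying with the inverse exponential.\<close>
      have fm: "f \<in> borel_measurable half_line"
      proof -
        have m1: "(\<lambda>t. complex_of_real (exp (\<sigma> * t))) \<in> borel_measurable half_line"
          by (rule measurable_restrict_space1) measurable
        have "(\<lambda>t. complex_of_real (exp (\<sigma> * t)) * (of_real (exp (- (\<sigma> * t))) * f t)) \<in> borel_measurable half_line"
          using m1 borel_measurable_integrable[OF f[OF \<sigma>]] by (rule borel_measurable_times)
        then show ?thesis
          by (simp add: mult.assoc[symmetric] flip: of_real_mult exp_add)
      qed
      have m2: "(\<lambda>t. complex_of_real (q n t)) \<in> borel_measurable half_line" for n
        unfolding q_def by (rule measurable_restrict_space1) measurable
      show "(\<lambda>t. complex_of_real (q n t) * f t) \<in> borel_measurable half_line" for n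
        using m2 fm by (rule borel_measurable_times)
      have m3: "(\<lambda>t. complex_of_real (- t * exp (- (\<sigma> * t)))) \<in> borel_measurable half_line"
        by (rule measurable_restrict_space1) measurable
      show "(\<lambda>t. complex_of_real (- t * exp (- (\<sigma> * t))) * f t) \<in> borel_measurable half_line"
        using m3 fm by (rule borel_measurable_times)
      show "AE t in half_line. (\<lambda>n. complex_of_real (q n t) * f t) \<longlonglongrightarrow> complex_of_real (- t * exp (- (\<sigma> * t))) * f t"
      proof (rule AE_I2)
        fix t
        have "((\<lambda>s. exp (- (s * t))) has_real_derivative - t * exp (- (\<sigma> * t))) (at \<sigma>)"
          by (auto intro!: derivative_eq_intros)
        then have "((\<lambda>h. (exp (- ((\<sigma> + h) * t)) - exp (- (\<sigma> * t))) / h) \<longlongrightarrow> - t * exp (- (\<sigma> * t))) (at 0)"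
          by (simp add: DERIV_def)
        then have "(\<lambda>n. q n t) \<longlonglongrightarrow> - t * exp (- (\<sigma> * t))"
          unfolding q_def tendsto_at_iff_sequentially using H Hlim by (auto simp: o_def)
        then show "(\<lambda>n. complex_of_real (q n t) * f t) \<longlonglongrightarrow> complex_of_real (- t * exp (- (\<sigma> * t))) * f t"
          by (intro tendsto_intros)
      qed
      show "AE t in half_line. norm (complex_of_real (q n t) * f t)
          \<le> norm (complex_of_real (exp (- (\<sigma> / 2 * t))) * (of_real t * f t))" for n
        using AE_half_line_pos
      proof eventually_elim
        case (elim t)
        have "q n t = exp (- (\<sigma> * t)) * ((exp (- (H n * t)) - 1) / H n)"
          by (simp add: q_def algebra_simps flip: exp_add)
        then have "\<bar>q n t\<bar> = exp (- (\<sigma> * t)) * (\<bar>exp (- (H n * t)) - 1\<bar> / \<bar>H n\<bar>)"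
          by (simp add: abs_mult)
        also have "\<dots> \<le> exp (- (\<sigma> * t)) * ((\<bar>H n * t\<bar> * exp \<bar>H n * t\<bar>) / \<bar>H n\<bar>)"
          using abs_exp_minus_one_le[of "- (H n * t)"] by (intro mult_left_mono divide_right_mono) auto
        also have "\<dots> = t * exp (\<bar>H n\<bar> * t - \<sigma> * t)"
          using H(1)[of n] elim by (simp add: abs_mult exp_diff exp_minus field_simps)
        also have "\<dots> \<le> t * exp (- (\<sigma> / 2 * t))"
        proof -
          have "\<bar>H n\<bar> * t \<le> \<sigma> / 2 * t"
            using H(2)[of n] elim by (intro mult_right_mono) auto
          then have "\<bar>H n\<bar> * t - \<sigma> * t \<le> - (\<sigma> / 2 * t)"
            by linarith
          then show ?thesis
            using elim by (intro mult_left_mono) auto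
        qed
        finally show ?case
          using elim mult_right_mono[of "\<bar>q n t\<bar>" "t * exp (- (\<sigma> / 2 * t))" "norm (f t)"]
          by (simp add: norm_mult mult_ac del: exp_less_mono exp_le_cancel_iff)
      qed
    qed
    moreover have "(LINT t|half_line. of_real (q n t) * f t) = (Y (\<sigma> + H n) - Y \<sigma>) /\<^sub>R H n" for n
    proof -
      have "\<sigma> + H n > 0"
        using H(2)[of n] \<sigma> by (simp add: abs_less_iff)
      then have "Y (\<sigma> + H n) - Y \<sigma> = (LINT t|half_line. of_real (exp (- ((\<sigma> + H n) * t))) * f t - of_real (exp (- (\<sigma> * t))) * f t)"
        unfolding Y_def using f \<sigma> by (intro Bochner_Integration.integral_diff[symmetric]) auto
      then have "(Y (\<sigma> + H n) - Y \<sigma>) /\<^sub>R H n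
        = (LINT t|half_line. (of_real (exp (- ((\<sigma> + H n) * t))) * f t - of_real (exp (- (\<sigma> * t))) * f t) /\<^sub>R H n)"
        by simp
      also have "\<dots> = (LINT t|half_line. of_real (q n t) * f t)"
        by (intro Bochner_Integration.integral_cong refl)
          (simp add: q_def scaleR_conv_of_real algebra_simps divide_inverse)
      finally show ?thesis by simp
    qed
    moreover have "(LINT t|half_line. of_real (- t * exp (- (\<sigma> * t))) * f t) = D"
      unfolding D_def by (subst Bochner_Integration.integral_minus[symmetric])
        (intro Bochner_Integration.integral_cong refl, simp)
    ultimately have "(\<lambda>n. (Y (\<sigma> + H n) - Y \<sigma>) /\<^sub>R H n) \<longlonglongrightarrow> D"
      by simp
    then show "((\<lambda>h. (Y (\<sigma> + h) - Y \<sigma>) /\<^sub>R h) \<circ> X) \<longlonglongrightarrow> D"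
      unfolding H_def o_def by (rule LIMSEQ_offset[of "\<lambda>n. (Y (\<sigma> + X n) - Y \<sigma>) /\<^sub>R X n" N])
  qed
  then have "((\<lambda>h. norm ((Y (\<sigma> + h) - Y \<sigma>) /\<^sub>R h - D)) \<longlongrightarrow> 0) (at 0)"
    by (intro tendsto_norm_zero LIM_zero)
  moreover have "\<forall>\<^sub>F h in at 0. norm ((Y (\<sigma> + h) - Y \<sigma>) /\<^sub>R h - D) = norm (Y (\<sigma> + h) - Y \<sigma> - h *\<^sub>R D) / norm h"
  proof (rule eventually_mono[OF eventually_neq_at_within])
    fix h :: real assume "h \<noteq> 0"
    then have "Y (\<sigma> + h) - Y \<sigma> - h *\<^sub>R D = h *\<^sub>R ((Y (\<sigma> + h) - Y \<sigma>) /\<^sub>R h - D)"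
      by (simp add: algebra_simps)
    then show "norm ((Y (\<sigma> + h) - Y \<sigma>) /\<^sub>R h - D) = norm (Y (\<sigma> + h) - Y \<sigma> - h *\<^sub>R D) / norm h"
      using \<open>h \<noteq> 0\<close> by simp
  qed
  ultimately have "((\<lambda>h. norm (Y (\<sigma> + h) - Y \<sigma> - h *\<^sub>R D) / norm h) \<longlongrightarrow> 0) (at 0)"
    by (rule Lim_transform_eventually)
  then have "(Y has_vector_derivative D) (at \<sigma>)"
    unfolding has_vector_derivative_def has_derivative_at by (simp add: bounded_linear_scaleR_left)
  then show ?thesis
    by (simp only: Y_def D_def)
qed

text \<open>A single \<open>K\<close> serves in all bounds, so that later estimates need not keep
  constants apart. \<Theta> is a parameter known only through the asymptotics; its modulus is
  determined inside the locale.\<close>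

locale bessel_pair =
  fixes \<nu> K :: real and \<Theta> :: complex and u v :: "real \<Rightarrow> real" and \<kappa> :: real
  defines "u \<equiv> bessel_u \<nu>" and "v \<equiv> bessel_u (\<nu> + 1)" and "\<kappa> \<equiv> \<nu> + 1 / 2"
  assumes nu: "\<nu> > -1"
    and near: "\<And>t. 0 < t \<Longrightarrow> t \<le> 1 \<Longrightarrow> \<bar>u t\<bar> \<le> K * t powr \<kappa>"
              "\<And>t. 0 < t \<Longrightarrow> t \<le> 1 \<Longrightarrow> \<bar>v t\<bar> \<le> K * t powr (\<kappa> + 1)"
    and far: "\<And>t. t \<ge> 1 \<Longrightarrow> \<bar>u t\<bar> \<le> K" "\<And>t. t \<ge> 1 \<Longrightarrow> \<bar>v t\<bar> \<le> K"
    and asym: "\<And>t. t \<ge> 1 \<Longrightarrow> norm (Complex (u t) (v t) - exp (\<i> * of_real t) * \<Theta>) \<le> K / t"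

lemma exists_bessel_pair:
  assumes "\<nu> > -1"
  obtains K \<Theta> where "bessel_pair \<nu> K \<Theta>"
proof -
  have nu1: "\<nu> + 1 > -1" using assms by simp
  obtain K1 where K1: "\<And>t. 0 < t \<Longrightarrow> t \<le> 1 \<Longrightarrow> \<bar>bessel_u \<nu> t\<bar> \<le> K1 * t powr (\<nu> + 1 / 2)"
    using bessel_u_near_zero[OF assms] by blast
  obtain K2 where K2: "\<And>t. 0 < t \<Longrightarrow> t \<le> 1 \<Longrightarrow> \<bar>bessel_u (\<nu> + 1) t\<bar> \<le> K2 * t powr (\<nu> + 1 + 1 / 2)"
    using bessel_u_near_zero[OF nu1] by blast
  obtain \<Theta> K3 where K3: "\<And>t. t \<ge> 1 \<Longrightarrow>
      norm (Complex (bessel_u \<nu> t) (bessel_u (\<nu> + 1) t) - exp (\<i> * of_real t) * \<Theta>) \<le> K3 / t"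
    using oscillator_asymptotics[OF bessel_u_has_derivative[OF assms]] by blast
  \<comment> \<open>The modulus of \<Theta> enters because for t \<ge> 1 the size of u + iv is at
    most K3/t plus that modulus.\<close>
  define K where "K = \<bar>K1\<bar> + \<bar>K2\<bar> + \<bar>K3\<bar> + norm \<Theta>"
  have KK: "K1 \<le> K" "K2 \<le> K" "K3 \<le> K"
    using norm_ge_zero[of \<Theta>] unfolding K_def by linarith+
  have far: "norm (Complex (bessel_u \<nu> t) (bessel_u (\<nu> + 1) t)) \<le> K" if t: "t \<ge> 1" for t
  proof -
    have "norm (Complex (bessel_u \<nu> t) (bessel_u (\<nu> + 1) t)) \<le> K3 / t + norm (exp (\<i> * of_real t) * \<Theta>)"
      using K3[OF t] norm_triangle_sub[of "Complex (bessel_u \<nu> t) (bessel_u (\<nu> + 1) t)" "exp (\<i> * of_real t) * \<Theta>"]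
      by linarith
    moreover have "K3 / t \<le> \<bar>K3\<bar>"
    proof -
      have "K3 \<le> \<bar>K3\<bar> * t"
        using t mult_left_mono[of 1 t "\<bar>K3\<bar>"] by linarith
      then show ?thesis
        using t by (simp add: divide_le_eq)
    qed
    ultimately show ?thesis by (simp add: K_def norm_mult)
  qed
  have "bessel_pair \<nu> K \<Theta>"
  proof
    show "\<nu> > -1" by (rule assms)
    show "\<bar>bessel_u \<nu> t\<bar> \<le> K * t powr (\<nu> + 1 / 2)" if "0 < t" "t \<le> 1" for t
      by (rule order_trans[OF K1[OF that] mult_right_mono[OF KK(1) powr_ge_zero]])
    show "\<bar>bessel_u (\<nu> + 1) t\<bar> \<le> K * t powr (\<nu> + 1 / 2 + 1)" if "0 < t" "t \<le> 1" for t
    proof -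
      have "\<nu> + 1 / 2 + 1 = \<nu> + 1 + 1 / 2" by simp
      then show ?thesis
        using order_trans[OF K2[OF that] mult_right_mono[OF KK(2) powr_ge_zero]] by metis
    qed
    show "\<bar>bessel_u \<nu> t\<bar> \<le> K" "\<bar>bessel_u (\<nu> + 1) t\<bar> \<le> K" if "t \<ge> 1" for t
      using far[OF that] abs_Re_le_cmod[of "Complex (bessel_u \<nu> t) (bessel_u (\<nu> + 1) t)"]
        abs_Im_le_cmod[of "Complex (bessel_u \<nu> t) (bessel_u (\<nu> + 1) t)"] by auto
    show "norm (Complex (bessel_u \<nu> t) (bessel_u (\<nu> + 1) t) - exp (\<i> * of_real t) * \<Theta>) \<le> K / t" if "t \<ge> 1" for t
      using order_trans[OF K3[OF that] divide_right_mono[OF KK(3)]] that by simp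
  qed
  then show ?thesis by (rule that)
qed

section \<open>Laplace transforms of the weighted pair and their differential equation\<close>

context bessel_pair
begin

lemma kappa: "\<kappa> > - 1 / 2"
  using nu by (simp add: \<kappa>_def)

lemma K_nonneg: "K \<ge> 0"
  using far(1)[of 1] by simp

lemma measurable_uv [measurable]: "u \<in> borel_measurable borel" "v \<in> borel_measurable borel"
  unfolding u_def v_def by measurable

lemma derivs:
  assumes "t > 0"
  shows "(u has_real_derivative \<kappa> * u t / t - v t) (at t)"
    and "(v has_real_derivative u t - \<kappa> * v t / t) (at t)"
  using bessel_u_has_derivative[OF nu assms] by (simp_all add: u_def v_def \<kappa>_def)

text \<open>The overview's Y at p = \<sigma> + i, as a function of the real part only.
  \<open>Z\<close> is the analogue for u; \<open>TY\<close> and \<open>TZ\<close> carry an extra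
  factor t and are minus the \<sigma>-derivatives of \<open>Y\<close> and \<open>Z\<close>.\<close>

definition Y :: "real \<Rightarrow> complex" where
  "Y \<sigma> = (LINT t|half_line. of_real (exp (- (\<sigma> * t))) * (exp (- \<i> * of_real t) * of_real (t powr \<kappa> * v t)))"

definition Z :: "real \<Rightarrow> complex" where
  "Z \<sigma> = (LINT t|half_line. of_real (exp (- (\<sigma> * t))) * (exp (- \<i> * of_real t) * of_real (t powr \<kappa> * u t)))"

definition TY :: "real \<Rightarrow> complex" where
  "TY \<sigma> = (LINT t|half_line. of_real (exp (- (\<sigma> * t))) * (of_real t * (exp (- \<i> * of_real t) * of_real (t powr \<kappa> * v t))))"

definition TZ :: "real \<Rightarrow> complex" where
  "TZ \<sigma> = (LINT t|half_line. of_real (exp (- (\<sigma> * t))) * (of_real t * (exp (- \<i> * of_real t) * of_real (t powr \<kappa> * u t))))"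

text \<open>For t \<le> 1 the near bounds give order 2\<kappa>, for t > 1 boundedness gives order
  \<kappa>; the sum of both powers is valid throughout. The third bound retains the additional order
  of v at 0 and extends to large t because \<kappa> \<le> 2\<kappa> + 1.\<close>

lemma yz_bound:
  assumes "t > 0"
  shows "\<bar>t powr \<kappa> * u t\<bar> \<le> K * (t powr (2 * \<kappa>) + t powr \<kappa>)"
    and "\<bar>t powr \<kappa> * v t\<bar> \<le> K * (t powr (2 * \<kappa>) + t powr \<kappa>)"
    and "\<bar>t powr \<kappa> * v t\<bar> \<le> K * t powr (2 * \<kappa> + 1)"
proof -
  have p: "t powr \<kappa> * (K * t powr \<kappa>) = K * t powr (2 * \<kappa>)"
    "t powr \<kappa> * (K * t powr (\<kappa> + 1)) = K * t powr (2 * \<kappa> + 1)"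
    using assms by (simp_all add: mult_ac flip: powr_add)
  have K0: "0 \<le> K * t powr x" for x
    using K_nonneg by simp
  have "\<bar>t powr \<kappa> * u t\<bar> \<le> K * (t powr (2 * \<kappa>) + t powr \<kappa>) \<and> \<bar>t powr \<kappa> * v t\<bar> \<le> K * (t powr (2 * \<kappa>) + t powr \<kappa>)
    \<and> \<bar>t powr \<kappa> * v t\<bar> \<le> K * t powr (2 * \<kappa> + 1)"
  proof (cases "t \<le> 1")
    case True
    have "\<bar>t powr \<kappa> * u t\<bar> \<le> K * t powr (2 * \<kappa>)"
      using mult_left_mono[OF near(1)[OF assms True], of "t powr \<kappa>"] by (simp add: abs_mult p)
    moreover have "\<bar>t powr \<kappa> * v t\<bar> \<le> K * t powr (2 * \<kappa> + 1)"
      using mult_left_mono[OF near(2)[OF assms True], of "t powr \<kappa>"] by (simp add: abs_mult p)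
    moreover have "K * t powr (2 * \<kappa> + 1) \<le> K * t powr (2 * \<kappa>)"
      using True assms K_nonneg by (intro mult_left_mono powr_mono') auto
    ultimately show ?thesis
      using K0[of \<kappa>] by (simp add: algebra_simps)
  next
    case False
    have "\<bar>t powr \<kappa> * u t\<bar> \<le> K * t powr \<kappa>" "\<bar>t powr \<kappa> * v t\<bar> \<le> K * t powr \<kappa>"
      using mult_left_mono[OF far(1)[of t], of "t powr \<kappa>"] mult_left_mono[OF far(2)[of t], of "t powr \<kappa>"] False
      by (simp_all add: abs_mult mult.commute)
    moreover have "K * t powr \<kappa> \<le> K * t powr (2 * \<kappa> + 1)"
      using False K_nonneg kappa by (intro mult_left_mono powr_mono) auto
    ultimately show ?thesis
      using K0[of "2 * \<kappa>"] by (simp add: algebra_simps)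
  qed
  then show "\<bar>t powr \<kappa> * u t\<bar> \<le> K * (t powr (2 * \<kappa>) + t powr \<kappa>)"
    "\<bar>t powr \<kappa> * v t\<bar> \<le> K * (t powr (2 * \<kappa>) + t powr \<kappa>)"
    "\<bar>t powr \<kappa> * v t\<bar> \<le> K * t powr (2 * \<kappa> + 1)"
    by auto
qed

text \<open>Both powers are integrable at 0 because \<nu> > -1 means 2\<kappa> > -1; the exponential
  takes care of infinity, also with the extra factor t.\<close>

lemma laplace_integrable:
  fixes f :: "real \<Rightarrow> real"
  assumes [measurable]: "f \<in> borel_measurable borel"
    and f: "\<And>t. t > 0 \<Longrightarrow> \<bar>f t\<bar> \<le> K * (t powr (2 * \<kappa>) + t powr \<kappa>)" and \<sigma>: "\<sigma> > 0"
  shows "integrable half_line (\<lambda>t. of_real (exp (- (\<sigma> * t))) * (exp (- \<i> * of_real t) * of_real (f t)))"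
    and "integrable half_line (\<lambda>t. of_real (exp (- (\<sigma> * t))) * (of_real t * (exp (- \<i> * of_real t) * of_real (f t))))"
proof -
  have nE: "norm (exp (- \<i> * complex_of_real t)) = 1" for t
    by (simp add: norm_exp_eq_Re)
  have i: "integrable half_line (\<lambda>t. t powr \<alpha> * exp (- (\<sigma> * t)))" if "\<alpha> > -1" for \<alpha>
    using half_line_gamma_scaled[OF that \<sigma>] .
  show "integrable half_line (\<lambda>t. of_real (exp (- (\<sigma> * t))) * (exp (- \<i> * of_real t) * of_real (f t)))"
  proof (rule half_line_integrable_bound)
    show "integrable half_line (\<lambda>t. K * (t powr (2 * \<kappa>) * exp (- (\<sigma> * t)) + t powr \<kappa> * exp (- (\<sigma> * t))))"
      using kappa by (intro integrable_mult_right Bochner_Integration.integrable_add i) auto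
    show "(\<lambda>t. of_real (exp (- (\<sigma> * t))) * (exp (- \<i> * of_real t) * complex_of_real (f t))) \<in> borel_measurable half_line"
      by (rule measurable_restrict_space1) measurable
    show "norm (of_real (exp (- (\<sigma> * t))) * (exp (- \<i> * of_real t) * complex_of_real (f t)))
      \<le> K * (t powr (2 * \<kappa>) * exp (- (\<sigma> * t)) + t powr \<kappa> * exp (- (\<sigma> * t)))" if "t > 0" for t
      using mult_left_mono[OF f[OF that], of "exp (- (\<sigma> * t))"]
      by (simp only: norm_mult nE norm_of_real abs_exp_cancel algebra_simps mult_1) simp
  qed
  show "integrable half_line (\<lambda>t. of_real (exp (- (\<sigma> * t))) * (of_real t * (exp (- \<i> * of_real t) * of_real (f t))))"
  proof (rule half_line_integrable_bound)
    show "integrable half_line (\<lambda>t. K * (t powr (2 * \<kappa> + 1) * exp (- (\<sigma> * t)) + t powr (\<kappa> + 1) * exp (- (\<sigma> * t))))"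
      using kappa by (intro integrable_mult_right Bochner_Integration.integrable_add i) auto
    show "(\<lambda>t. of_real (exp (- (\<sigma> * t))) * (of_real t * (exp (- \<i> * of_real t) * complex_of_real (f t)))) \<in> borel_measurable half_line"
      by (rule measurable_restrict_space1) measurable
    show "norm (of_real (exp (- (\<sigma> * t))) * (of_real t * (exp (- \<i> * of_real t) * complex_of_real (f t))))
      \<le> K * (t powr (2 * \<kappa> + 1) * exp (- (\<sigma> * t)) + t powr (\<kappa> + 1) * exp (- (\<sigma> * t)))" if t: "t > 0" for t
    proof -
      have "norm (of_real (exp (- (\<sigma> * t))) * (of_real t * (exp (- \<i> * of_real t) * complex_of_real (f t))))
          = exp (- (\<sigma> * t)) * t * \<bar>f t\<bar>"
        using t by (simp only: norm_mult nE norm_of_real abs_exp_cancel abs_of_pos mult_1 mult.assoc)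
      also have "\<dots> \<le> exp (- (\<sigma> * t)) * t * (K * (t powr (2 * \<kappa>) + t powr \<kappa>))"
        using f[OF t] t by (intro mult_left_mono) auto
      also have "\<dots> = K * (t powr (2 * \<kappa> + 1) * exp (- (\<sigma> * t)) + t powr (\<kappa> + 1) * exp (- (\<sigma> * t)))"
        using t by (simp add: powr_add algebra_simps)
      finally show ?thesis .
    qed
  qed
qed

lemma laplace_integrable_yz:
  assumes "\<sigma> > 0"
  shows "integrable half_line (\<lambda>t. of_real (exp (- (\<sigma> * t))) * (exp (- \<i> * of_real t) * of_real (t powr \<kappa> * v t)))"
    "integrable half_line (\<lambda>t. of_real (exp (- (\<sigma> * t))) * (exp (- \<i> * of_real t) * of_real (t powr \<kappa> * u t)))"
    "integrable half_line (\<lambda>t. of_real (exp (- (\<sigma> * t))) * (of_real t * (exp (- \<i> * of_real t) * of_real (t powr \<kappa> * v t))))"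
    "integrable half_line (\<lambda>t. of_real (exp (- (\<sigma> * t))) * (of_real t * (exp (- \<i> * of_real t) * of_real (t powr \<kappa> * u t))))"
proof -
  have mv: "(\<lambda>t. t powr \<kappa> * v t) \<in> borel_measurable borel" and mu: "(\<lambda>t. t powr \<kappa> * u t) \<in> borel_measurable borel"
    by measurable
  show "integrable half_line (\<lambda>t. of_real (exp (- (\<sigma> * t))) * (exp (- \<i> * of_real t) * of_real (t powr \<kappa> * v t)))"
    by (rule laplace_integrable(1)[OF mv _ assms]) (rule yz_bound(2))
  show "integrable half_line (\<lambda>t. of_real (exp (- (\<sigma> * t))) * (exp (- \<i> * of_real t) * of_real (t powr \<kappa> * u t)))"
    by (rule laplace_integrable(1)[OF mu _ assms]) (rule yz_bound(1))
  show "integrable half_line (\<lambda>t. of_real (exp (- (\<sigma> * t))) * (of_real t * (exp (- \<i> * of_real t) * of_real (t powr \<kappa> * v t))))"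
    by (rule laplace_integrable(2)[OF mv _ assms]) (rule yz_bound(2))
  show "integrable half_line (\<lambda>t. of_real (exp (- (\<sigma> * t))) * (of_real t * (exp (- \<i> * of_real t) * of_real (t powr \<kappa> * u t))))"
    by (rule laplace_integrable(2)[OF mu _ assms]) (rule yz_bound(1))
qed

end

lemma powr_times_exp_minus_tendsto_0:
  fixes \<alpha> \<sigma> :: real
  assumes "\<sigma> > 0"
  shows "((\<lambda>t. t powr \<alpha> * exp (- (\<sigma> * t))) \<longlongrightarrow> 0) at_top"
  using assms by real_asymp

lemma powr_tendsto_0_at_right:
  fixes \<alpha> :: real
  assumes "\<alpha> > 0"
  shows "((\<lambda>t. t powr \<alpha>) \<longlongrightarrow> 0) (at_right 0)"
  using assms by real_asymp

context bessel_pair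
begin

text \<open>The weight t^\<kappa> is an integrating factor: the terms with \<kappa>/t cancel in the
  derivative of t^\<kappa> v and double in that of t^\<kappa> u.\<close>

lemma yz_has_derivative:
  assumes t: "t > 0"
  shows "((\<lambda>t. t powr \<kappa> * v t) has_real_derivative t powr \<kappa> * u t) (at t)"
    and "((\<lambda>t. t powr \<kappa> * u t) has_real_derivative 2 * \<kappa> / t * (t powr \<kappa> * u t) - t powr \<kappa> * v t) (at t)"
proof -
  have p: "((\<lambda>t. t powr \<kappa>) has_real_derivative \<kappa> * (t powr \<kappa> / t)) (at t)"
    using t by (auto intro!: derivative_eq_intros simp: powr_diff)
  show "((\<lambda>t. t powr \<kappa> * v t) has_real_derivative t powr \<kappa> * u t) (at t)"
    by (rule DERIV_cong[OF DERIV_mult[OF p derivs(2)[OF t]]]) (use t in \<open>simp add: field_simps\<close>)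
  show "((\<lambda>t. t powr \<kappa> * u t) has_real_derivative 2 * \<kappa> / t * (t powr \<kappa> * u t) - t powr \<kappa> * v t) (at t)"
    by (rule DERIV_cong[OF DERIV_mult[OF p derivs(1)[OF t]]]) (use t in \<open>simp add: field_simps\<close>)
qed

definition E :: "real \<Rightarrow> real \<Rightarrow> complex" where
  "E \<sigma> t = of_real (exp (- (\<sigma> * t))) * exp (- \<i> * of_real t)"

lemma E_eq: "E \<sigma> t = exp (- (of_real \<sigma> + \<i>) * of_real t)"
  by (simp add: E_def exp_of_real[symmetric] algebra_simps flip: exp_add)

lemma norm_E: "norm (E \<sigma> t) = exp (- (\<sigma> * t))"
  by (simp add: E_def norm_mult norm_exp_eq_Re)

lemma E_has_derivative: "(E \<sigma> has_vector_derivative - (of_real \<sigma> + \<i>) * E \<sigma> t) (at t)"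
  unfolding E_eq[abs_def] by (rule has_vector_derivative_exp_of_real)

text \<open>The rule L[f'] = p L[f] at p = \<sigma> + i: the boundary value at 0 vanishes by
  hypothesis, and at infinity exponential decay beats the power growth.\<close>

lemma laplace_integration_by_parts:
  fixes f f' :: "real \<Rightarrow> real"
  assumes f': "\<And>t. t > 0 \<Longrightarrow> (f has_real_derivative f' t) (at t)" and \<sigma>: "\<sigma> > 0"
    and int: "integrable half_line (\<lambda>t. E \<sigma> t * of_real (f t))" "integrable half_line (\<lambda>t. E \<sigma> t * of_real (f' t))"
    and zero: "(f \<longlongrightarrow> 0) (at_right 0)" and bound: "\<And>t. t > 1 \<Longrightarrow> \<bar>f t\<bar> \<le> C * t powr \<alpha>"
  shows "(LINT t|half_line. E \<sigma> t * of_real (f' t)) = (of_real \<sigma> + \<i>) * (LINT t|half_line. E \<sigma> t * of_real (f t))"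
proof -
  have der: "((\<lambda>t. E \<sigma> t * of_real (f t)) has_vector_derivative
      E \<sigma> t * of_real (f' t) + (- (of_real \<sigma> + \<i>) * E \<sigma> t) * of_real (f t)) (at t)" if "t > 0" for t
    using f'[OF that] by (intro has_vector_derivative_mult E_has_derivative has_vector_derivative_of_real)
      (simp add: has_real_derivative_iff_has_vector_derivative)
  have int2: "integrable half_line (\<lambda>t. (- (of_real \<sigma> + \<i>) * E \<sigma> t) * of_real (f t))"
    using integrable_mult_right[OF int(1), of "- (of_real \<sigma> + \<i>)"] by (simp add: mult.assoc)
  have "(LINT t|half_line. E \<sigma> t * of_real (f' t) + (- (of_real \<sigma> + \<i>) * E \<sigma> t) * of_real (f t)) = 0 - 0"
  proof (rule fundamental_theorem_half_line[of "{}" "\<lambda>t. E \<sigma> t * of_real (f t)"])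
    show "continuous_on {0<..} (\<lambda>t. E \<sigma> t * of_real (f t))"
      by (intro continuous_at_imp_continuous_on ballI has_vector_derivative_continuous[OF der]) auto
    show "integrable half_line (\<lambda>t. E \<sigma> t * of_real (f' t) + (- (of_real \<sigma> + \<i>) * E \<sigma> t) * of_real (f t))"
      using int(2) int2 by (rule Bochner_Integration.integrable_add)
    show "((\<lambda>t. E \<sigma> t * of_real (f t)) \<longlongrightarrow> 0) (at_right 0)"
    proof (rule Lim_null_comparison[OF _ zero[THEN tendsto_rabs_zero]])
      show "\<forall>\<^sub>F t in at_right 0. norm (E \<sigma> t * of_real (f t)) \<le> \<bar>f t\<bar>"
        unfolding eventually_at_right_field using \<sigma>
        by (intro exI[of _ 1]) (auto simp: norm_mult norm_E intro!: mult_left_le_one_le)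
    qed
    show "((\<lambda>t. E \<sigma> t * of_real (f t)) \<longlongrightarrow> 0) at_top"
    proof (rule Lim_null_comparison)
      show "\<forall>\<^sub>F t in at_top. norm (E \<sigma> t * of_real (f t)) \<le> C * (t powr \<alpha> * exp (- (\<sigma> * t)))"
        using eventually_gt_at_top[of 1]
      proof eventually_elim
        case (elim t)
        then show ?case
          using mult_right_mono[OF bound[OF elim], of "exp (- (\<sigma> * t))"] by (simp add: norm_mult norm_E mult_ac)
      qed
      show "((\<lambda>t. C * (t powr \<alpha> * exp (- (\<sigma> * t)))) \<longlongrightarrow> 0) at_top"
        using tendsto_mult_left[OF powr_times_exp_minus_tendsto_0[OF \<sigma>], of C \<alpha>] by simp
    qed
  qed (rule finite.emptyI, erule der)
  moreover have "(LINT t|half_line. (- (of_real \<sigma> + \<i>) * E \<sigma> t) * of_real (f t))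
      = - (of_real \<sigma> + \<i>) * (LINT t|half_line. E \<sigma> t * of_real (f t))"
    by (simp add: mult.assoc)
  ultimately have "(LINT t|half_line. E \<sigma> t * of_real (f' t))
      + - (of_real \<sigma> + \<i>) * (LINT t|half_line. E \<sigma> t * of_real (f t)) = 0"
    using Bochner_Integration.integral_add[OF int(2) int2] by simp
  moreover have "x = q * y" if "x + - q * y = 0" for x q y :: complex
    using that by (simp add: algebra_simps)
  ultimately show ?thesis by blast
qed

lemma YZ_E:
  "Y \<sigma> = (LINT t|half_line. E \<sigma> t * of_real (t powr \<kappa> * v t))"
  "Z \<sigma> = (LINT t|half_line. E \<sigma> t * of_real (t powr \<kappa> * u t))"
  "TY \<sigma> = (LINT t|half_line. E \<sigma> t * of_real (t * (t powr \<kappa> * v t)))"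
  "TZ \<sigma> = (LINT t|half_line. E \<sigma> t * of_real (t * (t powr \<kappa> * u t)))"
  by (simp_all add: Y_def Z_def TY_def TZ_def E_def mult_ac)

lemma laplace_integrable_E:
  assumes "\<sigma> > 0"
  shows "integrable half_line (\<lambda>t. E \<sigma> t * of_real (t powr \<kappa> * v t))"
    "integrable half_line (\<lambda>t. E \<sigma> t * of_real (t powr \<kappa> * u t))"
    "integrable half_line (\<lambda>t. E \<sigma> t * of_real (t * (t powr \<kappa> * v t)))"
    "integrable half_line (\<lambda>t. E \<sigma> t * of_real (t * (t powr \<kappa> * u t)))"
  using laplace_integrable_yz[OF assms] by (simp_all add: E_def mult_ac)

text \<open>These are the boundary values needed in \<open>laplace_ode\<close>. The function
  t^\<kappa> u enters only with a factor t, since by itself it is of order t^(2\<kappa>) and need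
  not tend to 0.\<close>

lemma yz_limits:
  "((\<lambda>t. t powr \<kappa> * v t) \<longlongrightarrow> 0) (at_right 0)"
  "((\<lambda>t. t * (t powr \<kappa> * v t)) \<longlongrightarrow> 0) (at_right 0)"
  "((\<lambda>t. t * (t powr \<kappa> * u t)) \<longlongrightarrow> 0) (at_right 0)"
proof -
  have ev: "\<forall>\<^sub>F t in at_right (0::real). 0 < t"
    by (simp add: eventually_at_right_less)
  have k: "2 * \<kappa> + 1 > 0" "\<kappa> + 1 > 0"
    using kappa by auto
  show v: "((\<lambda>t. t powr \<kappa> * v t) \<longlongrightarrow> 0) (at_right 0)"
  proof (rule Lim_null_comparison)
    show "\<forall>\<^sub>F t in at_right 0. norm (t powr \<kappa> * v t) \<le> K * t powr (2 * \<kappa> + 1)"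
      using ev by eventually_elim (use yz_bound(3) in simp)
    show "((\<lambda>t. K * t powr (2 * \<kappa> + 1)) \<longlongrightarrow> 0) (at_right 0)"
      using tendsto_mult_left[OF powr_tendsto_0_at_right[OF k(1)], of K] by simp
  qed
  have "((\<lambda>t. t) \<longlongrightarrow> 0) (at_right (0::real))"
    by (rule tendsto_ident_at)
  from tendsto_mult[OF this v] show "((\<lambda>t. t * (t powr \<kappa> * v t)) \<longlongrightarrow> 0) (at_right 0)"
    by simp
  show "((\<lambda>t. t * (t powr \<kappa> * u t)) \<longlongrightarrow> 0) (at_right 0)"
  proof (rule Lim_null_comparison)
    show "\<forall>\<^sub>F t in at_right 0. norm (t * (t powr \<kappa> * u t)) \<le> K * t powr (2 * \<kappa> + 1) + K * t powr (\<kappa> + 1)"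
      using ev
    proof eventually_elim
      case (elim t)
      then show ?case
        using mult_left_mono[OF yz_bound(1)[OF elim], of t] by (simp add: abs_mult powr_add algebra_simps)
    qed
    show "((\<lambda>t. K * t powr (2 * \<kappa> + 1) + K * t powr (\<kappa> + 1)) \<longlongrightarrow> 0) (at_right 0)"
      using tendsto_add[OF tendsto_mult_left[OF powr_tendsto_0_at_right[OF k(1)], of K]
          tendsto_mult_left[OF powr_tendsto_0_at_right[OF k(2)], of K]] by simp
  qed
qed

lemma yz_growth:
  assumes "t > 1"
  shows "\<bar>t powr \<kappa> * v t\<bar> \<le> K * t powr \<kappa>"
    "\<bar>t * (t powr \<kappa> * v t)\<bar> \<le> K * t powr (\<kappa> + 1)"
    "\<bar>t * (t powr \<kappa> * u t)\<bar> \<le> K * t powr (\<kappa> + 1)"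
  using assms mult_left_mono[OF far(2)[of t], of "t powr \<kappa>"]
    mult_left_mono[OF far(2)[of t], of "t powr \<kappa> * t"] mult_left_mono[OF far(1)[of t], of "t powr \<kappa> * t"]
  by (simp_all add: abs_mult powr_add mult_ac)

text \<open>Write y = t^\<kappa> v and z = t^\<kappa> u. Transforming y' = z, (ty)' = y + tz and
  (tz)' = (1 + 2\<kappa>) z - ty gives three linear relations, from which \<open>Z\<close> and
  \<open>TZ\<close> are eliminated. Multiplying by t before transforming removes the singular term
  2\<kappa> z/t.\<close>

lemma laplace_ode:
  assumes \<sigma>: "\<sigma> > 0"
  defines "p \<equiv> of_real \<sigma> + \<i>"
  shows "Z \<sigma> = p * Y \<sigma>" and "(1 + p\<^sup>2) * TY \<sigma> = of_real (2 * (\<kappa> + 1)) * p * Y \<sigma>"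
proof -
  note I = laplace_integrable_E[OF \<sigma>]
  show Z: "Z \<sigma> = p * Y \<sigma>"
    unfolding YZ_E p_def
    by (rule laplace_integration_by_parts[OF yz_has_derivative(1) \<sigma> I(1,2) yz_limits(1) yz_growth(1)])
  have dv: "((\<lambda>t. t * (t powr \<kappa> * v t)) has_real_derivative t powr \<kappa> * v t + t * (t powr \<kappa> * u t)) (at t)"
    if "t > 0" for t
    using DERIV_mult[OF DERIV_ident yz_has_derivative(1)[OF that]] by (simp add: add.commute mult.commute)
  have du: "((\<lambda>t. t * (t powr \<kappa> * u t)) has_real_derivative
      (1 + 2 * \<kappa>) * (t powr \<kappa> * u t) - t * (t powr \<kappa> * v t)) (at t)" if "t > 0" for t
    by (rule DERIV_cong[OF DERIV_mult[OF DERIV_ident yz_has_derivative(2)[OF that]]])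
      (use that in \<open>simp add: field_simps\<close>)
  have e1: "(LINT t|half_line. E \<sigma> t * of_real (t powr \<kappa> * v t + t * (t powr \<kappa> * u t))) = Y \<sigma> + TZ \<sigma>"
    unfolding YZ_E using Bochner_Integration.integral_add[OF I(1) I(4)] by (simp add: distrib_left)
  have i1: "integrable half_line (\<lambda>t. E \<sigma> t * of_real (t powr \<kappa> * v t + t * (t powr \<kappa> * u t)))"
    using Bochner_Integration.integrable_add[OF I(1) I(4)] by (simp add: distrib_left)
  have eq: "E \<sigma> t * of_real ((1 + 2 * \<kappa>) * (t powr \<kappa> * u t) - t * (t powr \<kappa> * v t))
      = of_real (1 + 2 * \<kappa>) * (E \<sigma> t * of_real (t powr \<kappa> * u t)) - E \<sigma> t * of_real (t * (t powr \<kappa> * v t))" for t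
    by (simp add: algebra_simps)
  note diff = integrable_mult_right[OF I(2), of "of_real (1 + 2 * \<kappa>)"] I(3)
  have e2: "(LINT t|half_line. E \<sigma> t * of_real ((1 + 2 * \<kappa>) * (t powr \<kappa> * u t) - t * (t powr \<kappa> * v t)))
      = of_real (1 + 2 * \<kappa>) * Z \<sigma> - TY \<sigma>"
    unfolding eq YZ_E Bochner_Integration.integral_diff[OF diff] integral_mult_right_zero ..
  have i2: "integrable half_line (\<lambda>t. E \<sigma> t * of_real ((1 + 2 * \<kappa>) * (t powr \<kappa> * u t) - t * (t powr \<kappa> * v t)))"
    unfolding eq by (rule Bochner_Integration.integrable_diff[OF diff])
  have A: "Y \<sigma> + TZ \<sigma> = p * TY \<sigma>"
    using laplace_integration_by_parts[OF dv \<sigma> I(3) i1 yz_limits(2) yz_growth(2)]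
    unfolding e1 by (simp add: YZ_E p_def)
  have B: "of_real (1 + 2 * \<kappa>) * Z \<sigma> - TY \<sigma> = p * TZ \<sigma>"
    using laplace_integration_by_parts[OF du \<sigma> I(4) i2 yz_limits(3) yz_growth(3)]
    unfolding e2 by (simp add: YZ_E p_def)
  have TZ: "TZ \<sigma> = p * TY \<sigma> - Y \<sigma>"
    using A by (metis add_diff_cancel_left')
  show "(1 + p\<^sup>2) * TY \<sigma> = of_real (2 * (\<kappa> + 1)) * p * Y \<sigma>"
    using B unfolding Z TZ by (simp add: algebra_simps power2_eq_square)
qed

lemma Y_has_derivative:
  assumes "\<sigma> > 0"
  shows "(Y has_vector_derivative - TY \<sigma>) (at \<sigma>)"
  unfolding Y_def[abs_def] TY_def
  by (rule laplace_has_vector_derivative) (use laplace_integrable_yz assms in auto)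

end

lemma Gamma_real_duplication:
  fixes x :: real
  assumes "x > 0"
  shows "Gamma x * Gamma (x + 1 / 2) = 2 powr (1 - 2 * x) * sqrt pi * Gamma (2 * x)"
proof -
  have ni: "complex_of_real y \<notin> \<int>\<^sub>\<le>\<^sub>0" if "y > 0" for y
    using that by (auto elim!: nonpos_Ints_cases simp: complex_eq_iff)
  have dup: "Gamma (complex_of_real x) * Gamma (of_real x + 1 / 2)
      = exp ((1 - 2 * of_real x) * of_real (ln 2)) * of_real (sqrt pi) * Gamma (2 * of_real x)"
    using ni[of x] ni[of "x + 1 / 2"] assms by (intro Gamma_legendre_duplication) auto
  have "complex_of_real x + 1 / 2 = of_real (x + 1 / 2)" "2 * complex_of_real x = of_real (2 * x)"
    "(1 - complex_of_real (2 * x)) * of_real (ln 2) = of_real ((1 - 2 * x) * ln 2)"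
    by simp_all
  from dup[unfolded this Gamma_complex_of_real exp_of_real]
  have "complex_of_real (Gamma x * Gamma (x + 1 / 2))
      = of_real (exp ((1 - 2 * x) * ln 2) * sqrt pi * Gamma (2 * x))"
    by (simp only: of_real_mult)
  then show ?thesis
    unfolding of_real_eq_iff by (simp add: powr_def)
qed

section \<open>The conserved quantity along the line p = \<sigma> + i and its two limits\<close>

context bessel_pair
begin

lemma norm_Y_scaled_constant:
  obtains c where "\<And>\<sigma>. \<sigma> > 0 \<Longrightarrow> norm (Y \<sigma>) * (\<sigma> * sqrt (\<sigma>\<^sup>2 + 4)) powr (\<kappa> + 1) = c"
proof -
  define q where "q = (\<lambda>\<sigma>. 1 + (complex_of_real \<sigma> + \<i>)\<^sup>2)"
  have q_eq: "q \<sigma> = of_real (\<sigma>\<^sup>2) + \<i> * of_real (2 * \<sigma>)" for \<sigma>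
    by (simp add: q_def power2_eq_square algebra_simps)
  have q_ne: "q \<sigma> \<notin> \<real>\<^sub>\<le>\<^sub>0" "q \<sigma> \<noteq> 0" if "\<sigma> > 0" for \<sigma>
    using that by (auto simp: q_eq complex_nonpos_Reals_iff complex_eq_iff)
  define F where "F = (\<lambda>\<sigma>. Y \<sigma> * q \<sigma> powr of_real (\<kappa> + 1))"
  have "(F has_vector_derivative 0) (at \<sigma> within {0<..})" if \<sigma>: "\<sigma> \<in> {0<..}" for \<sigma>
  proof -
    let ?p = "complex_of_real \<sigma> + \<i>"
    have \<sigma>': "\<sigma> > 0" using \<sigma> by simp
    have "((\<lambda>z. (1 + (z + \<i>)\<^sup>2) powr of_real (\<kappa> + 1)) has_field_derivative
        of_real (\<kappa> + 1) * (q \<sigma> powr (of_real (\<kappa> + 1) - 1)) * (2 * ?p)) (at (of_real \<sigma>))"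
      using q_ne[OF \<sigma>'] unfolding q_def by (auto intro!: derivative_eq_intros simp: q_def)
    then have dq: "((\<lambda>\<sigma>. q \<sigma> powr of_real (\<kappa> + 1)) has_vector_derivative
        of_real (\<kappa> + 1) * (q \<sigma> powr (of_real (\<kappa> + 1) - 1)) * (2 * ?p)) (at \<sigma>)"
      unfolding q_def by (rule has_vector_derivative_real_field)
    have pw: "q \<sigma> powr of_real (\<kappa> + 1) = q \<sigma> * q \<sigma> powr (of_real (\<kappa> + 1) - 1)"
      using q_ne[OF \<sigma>'] by (simp add: powr_add)
    have ode: "q \<sigma> * TY \<sigma> = of_real (2 * (\<kappa> + 1)) * ?p * Y \<sigma>"
      unfolding q_def using laplace_ode(2)[OF \<sigma>'] .
    have "Y \<sigma> * (of_real (\<kappa> + 1) * (q \<sigma> powr (of_real (\<kappa> + 1) - 1)) * (2 * ?p)) + (- TY \<sigma>) * q \<sigma> powr of_real (\<kappa> + 1)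
        = q \<sigma> powr (of_real (\<kappa> + 1) - 1) * (of_real (2 * (\<kappa> + 1)) * ?p * Y \<sigma> - q \<sigma> * TY \<sigma>)"
      unfolding pw by (simp add: algebra_simps)
    also have "\<dots> = 0"
      unfolding ode by simp
    finally show ?thesis
      using has_vector_derivative_mult[OF Y_has_derivative[OF \<sigma>'] dq]
      unfolding F_def by (simp add: has_vector_derivative_at_within)
  qed
  then obtain c where c: "\<And>\<sigma>. \<sigma> \<in> {0<..} \<Longrightarrow> F \<sigma> = c"
    using has_vector_derivative_zero_constant[of "{0<..}" F] by auto
  have "norm (Y \<sigma>) * (\<sigma> * sqrt (\<sigma>\<^sup>2 + 4)) powr (\<kappa> + 1) = norm c" if \<sigma>: "\<sigma> > 0" for \<sigma>
  proof -
    have "norm (q \<sigma>) = \<sigma> * sqrt (\<sigma>\<^sup>2 + 4)"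
    proof -
      have "norm (q \<sigma>) = sqrt ((\<sigma>\<^sup>2)\<^sup>2 + (2 * \<sigma>)\<^sup>2)"
        by (simp add: q_eq cmod_def)
      also have "(\<sigma>\<^sup>2)\<^sup>2 + (2 * \<sigma>)\<^sup>2 = \<sigma>\<^sup>2 * (\<sigma>\<^sup>2 + 4)"
        by (simp add: power2_eq_square algebra_simps)
      finally show ?thesis
        using \<sigma> by (simp add: real_sqrt_mult)
    qed
    moreover have "norm (q \<sigma> powr of_real (\<kappa> + 1)) = norm (q \<sigma>) powr (\<kappa> + 1)"
      using q_ne[OF \<sigma>] by (simp add: powr_def norm_exp_eq_Re)
    moreover have "norm c = norm (Y \<sigma>) * norm (q \<sigma> powr of_real (\<kappa> + 1))"
      using c[of \<sigma>] \<sigma> unfolding F_def norm_mult[symmetric] by simp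
    ultimately show ?thesis by simp
  qed
  then show ?thesis by (rule that)
qed

text \<open>Watson's lemma at leading order: after t = s/\<sigma> only the behaviour of v at 0
  matters. The quotient h(t) = v(t) / t^(\<kappa>+1) is bounded and tends to the leading coefficient
  of v, so dominated convergence leaves a Gamma integral.\<close>

lemma Y_at_infinity:
  "((\<lambda>\<sigma>. of_real (\<sigma> powr (2 * \<kappa> + 2)) * Y \<sigma>) \<longlongrightarrow>
     of_real (Gamma (2 * \<kappa> + 2) * (2 powr (- (\<nu> + 1)) / Gamma (\<nu> + 2)))) at_top"
proof -
  define h where "h = (\<lambda>t. v t / t powr (\<kappa> + 1))"
  define h0 where "h0 = 2 powr (- (\<nu> + 1)) / Gamma (\<nu> + 2)"
  have [measurable]: "h \<in> borel_measurable borel"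
    unfolding h_def by measurable
  have h_bound: "\<bar>h t\<bar> \<le> K" if "t > 0" for t
  proof -
    have "t powr \<kappa> * \<bar>v t\<bar> \<le> t powr \<kappa> * (K * t powr (\<kappa> + 1))"
      using yz_bound(3)[OF that] that by (simp add: abs_mult mult_ac flip: powr_add)
    then have "\<bar>v t\<bar> \<le> K * t powr (\<kappa> + 1)"
      using that by (subst (asm) mult_le_cancel_left_pos) auto
    then show ?thesis
      using that by (simp add: h_def divide_le_eq)
  qed
  have h_lim: "(h \<longlongrightarrow> h0) (at_right 0)"
  proof -
    have nu1: "\<nu> + 1 > -1" using nu by simp
    have "isCont (bessel_entire (\<nu> + 1)) 0"
      using bessel_entire_has_derivative[OF nu1] by (rule DERIV_isCont)
    moreover have "bessel_entire (\<nu> + 1) 0 = 1 / Gamma (\<nu> + 2)"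
      using powser_zero[of "bessel_coeff (\<nu> + 1)"] by (simp add: bessel_entire_def bessel_coeff_def add_ac)
    moreover have "((\<lambda>t. t\<^sup>2 / 4) \<longlongrightarrow> 0) (at_right (0::real))"
      by real_asymp
    ultimately have "((\<lambda>t. bessel_entire (\<nu> + 1) (t\<^sup>2 / 4)) \<longlongrightarrow> 1 / Gamma (\<nu> + 2)) (at_right 0)"
      using isCont_tendsto_compose by metis
    then have "((\<lambda>t. 2 powr (- (\<nu> + 1)) * bessel_entire (\<nu> + 1) (t\<^sup>2 / 4)) \<longlongrightarrow> 2 powr (- (\<nu> + 1)) * (1 / Gamma (\<nu> + 2))) (at_right 0)"
      by (intro tendsto_intros)
    moreover have "\<forall>\<^sub>F t in at_right 0. 2 powr (- (\<nu> + 1)) * bessel_entire (\<nu> + 1) (t\<^sup>2 / 4) = h t"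
      using eventually_at_right_less[of 0]
    proof eventually_elim
      case (elim t)
      have "\<nu> + 1 + 1 / 2 = \<kappa> + 1" by (simp add: \<kappa>_def)
      then show ?case
        using elim bessel_u_eq[OF nu1 elim] by (simp add: h_def v_def)
    qed
    ultimately show ?thesis
      unfolding h0_def using Lim_transform_eventually by fastforce
  qed
  define g where "g = (\<lambda>\<sigma> s. of_real (s powr (2 * \<kappa> + 1) * exp (- s)) * (exp (- \<i> * of_real (s / \<sigma>)) * complex_of_real (h (s / \<sigma>))))"
  have "((\<lambda>\<sigma>. LINT s|half_line. g \<sigma> s) \<longlongrightarrow> (LINT s|half_line. of_real (s powr (2 * \<kappa> + 1) * exp (- s)) * complex_of_real h0)) at_top"
  proof (rule integral_dominated_convergence_at_top)
    show "integrable half_line (\<lambda>s. K * (s powr (2 * \<kappa> + 1) * exp (- s)))"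
      using kappa by (intro integrable_mult_right half_line_gamma) auto
    show "g \<sigma> \<in> borel_measurable half_line" for \<sigma>
      unfolding g_def by (rule measurable_restrict_space1) measurable
    show "(\<lambda>s. of_real (s powr (2 * \<kappa> + 1) * exp (- s)) * complex_of_real h0) \<in> borel_measurable half_line"
      by (rule measurable_restrict_space1) measurable
    show "\<forall>\<^sub>F \<sigma> in at_top. AE s in half_line. norm (g \<sigma> s) \<le> K * (s powr (2 * \<kappa> + 1) * exp (- s))"
      using eventually_gt_at_top[of 0]
    proof eventually_elim
      case (elim \<sigma>)
      show ?case
        using AE_half_line_pos
      proof eventually_elim
        case (elim s)
        have "norm (g \<sigma> s) = s powr (2 * \<kappa> + 1) * exp (- s) * \<bar>h (s / \<sigma>)\<bar>"
          by (simp add: g_def norm_mult norm_exp_eq_Re)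
        also have "\<dots> \<le> s powr (2 * \<kappa> + 1) * exp (- s) * K"
          using \<open>\<sigma> > 0\<close> elim by (intro mult_left_mono h_bound) auto
        finally show ?case by (simp add: mult_ac)
      qed
    qed
    show "AE s in half_line. ((\<lambda>\<sigma>. g \<sigma> s) \<longlongrightarrow> of_real (s powr (2 * \<kappa> + 1) * exp (- s)) * complex_of_real h0) at_top"
      using AE_half_line_pos
    proof eventually_elim
      case (elim s)
      have lim0: "((\<lambda>\<sigma>. s / \<sigma>) \<longlongrightarrow> 0) at_top"
        by real_asymp
      have "filterlim (\<lambda>\<sigma>. s / \<sigma>) (at_right 0) at_top"
        unfolding filterlim_at
        by (intro conjI lim0 eventually_mono[OF eventually_gt_at_top[of 0]]) (use elim in auto)
      from filterlim_compose[OF h_lim this] have "((\<lambda>\<sigma>. h (s / \<sigma>)) \<longlongrightarrow> h0) at_top" .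
      moreover have "((\<lambda>\<sigma>. exp (- \<i> * complex_of_real (s / \<sigma>))) \<longlongrightarrow> exp (- \<i> * of_real 0)) at_top"
        by (intro tendsto_intros lim0)
      ultimately have "((\<lambda>\<sigma>. g \<sigma> s) \<longlongrightarrow> of_real (s powr (2 * \<kappa> + 1) * exp (- s)) * (exp (- \<i> * of_real 0) * complex_of_real h0)) at_top"
        unfolding g_def by (intro tendsto_intros lim0)
      then show ?case by simp
    qed
  qed
  moreover have "(LINT s|half_line. of_real (s powr (2 * \<kappa> + 1) * exp (- s)) * complex_of_real h0) = of_real (Gamma (2 * \<kappa> + 2) * h0)"
  proof -
    have "(LINT s|half_line. of_real (s powr (2 * \<kappa> + 1) * exp (- s)) * complex_of_real h0)
        = of_real (LINT s|half_line. s powr (2 * \<kappa> + 1) * exp (- s)) * of_real h0"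
      by (simp only: integral_mult_left_zero integral_complex_of_real)
    also have "(LINT s|half_line. s powr (2 * \<kappa> + 1) * exp (- s)) = Gamma (2 * \<kappa> + 1 + 1)"
      using kappa by (intro half_line_gamma) auto
    finally show ?thesis by (simp add: add_ac)
  qed
  moreover have "\<forall>\<^sub>F \<sigma> in at_top. (LINT s|half_line. g \<sigma> s) = of_real (\<sigma> powr (2 * \<kappa> + 2)) * Y \<sigma>"
    using eventually_gt_at_top[of 0]
  proof eventually_elim
    case (elim \<sigma>)
    have "Y \<sigma> = (1 / \<sigma>) *\<^sub>R (LINT s|half_line. E \<sigma> (1 / \<sigma> * s) * of_real ((1 / \<sigma> * s) powr \<kappa> * v (1 / \<sigma> * s)))"
      unfolding YZ_E(1) using elim by (intro half_line_scale(2)) auto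
    then have "of_real (\<sigma> powr (2 * \<kappa> + 2)) * Y \<sigma> = of_real (\<sigma> powr (2 * \<kappa> + 2) / \<sigma>)
        * (LINT s|half_line. E \<sigma> (1 / \<sigma> * s) * of_real ((1 / \<sigma> * s) powr \<kappa> * v (1 / \<sigma> * s)))"
      by (simp add: scaleR_conv_of_real)
    also have "\<dots> = (LINT s|half_line. of_real (\<sigma> powr (2 * \<kappa> + 2) / \<sigma>)
        * (E \<sigma> (1 / \<sigma> * s) * of_real ((1 / \<sigma> * s) powr \<kappa> * v (1 / \<sigma> * s))))"
      by (rule integral_mult_right_zero[symmetric])
    also have "\<dots> = (LINT s|half_line. g \<sigma> s)"
    proof (rule half_line_integral_cong)
      fix s :: real assume s: "s > 0"
      have "\<sigma> powr (2 * \<kappa> + 2) / \<sigma> * ((s / \<sigma>) powr \<kappa> * v (s / \<sigma>)) = s powr (2 * \<kappa> + 1) * h (s / \<sigma>)"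
      proof -
        have "(s / \<sigma>) powr \<kappa> * v (s / \<sigma>) = (s / \<sigma>) powr (2 * \<kappa> + 1) * h (s / \<sigma>)"
        proof -
          have "(s / \<sigma>) powr (2 * \<kappa> + 1) = (s / \<sigma>) powr \<kappa> * (s / \<sigma>) powr (\<kappa> + 1)"
            by (simp flip: powr_add)
          then show ?thesis
            using s elim by (simp add: h_def)
        qed
        moreover have "\<sigma> powr (2 * \<kappa> + 2) / \<sigma> * (s / \<sigma>) powr (2 * \<kappa> + 1) = s powr (2 * \<kappa> + 1)"
        proof -
          have "\<sigma> powr (2 * \<kappa> + 2) = \<sigma> powr (2 * \<kappa> + 1) * \<sigma>"
            using elim powr_add[of \<sigma> "2 * \<kappa> + 1" 1] by (simp add: add_ac)
          then show ?thesis
            using elim s by (simp add: powr_divide)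
        qed
        ultimately show ?thesis
          by (metis mult.assoc)
      qed
      then have r: "complex_of_real (\<sigma> powr (2 * \<kappa> + 2) / \<sigma>) * of_real ((s / \<sigma>) powr \<kappa> * v (s / \<sigma>))
          = of_real (s powr (2 * \<kappa> + 1) * h (s / \<sigma>))"
        unfolding of_real_mult[symmetric] by simp
      have "E \<sigma> (s / \<sigma>) = of_real (exp (- s)) * exp (- \<i> * of_real (s / \<sigma>))"
        using elim by (simp add: E_def)
      then have "of_real (\<sigma> powr (2 * \<kappa> + 2) / \<sigma>) * (E \<sigma> (s / \<sigma>) * of_real ((s / \<sigma>) powr \<kappa> * v (s / \<sigma>)))
        = of_real (exp (- s)) * exp (- \<i> * of_real (s / \<sigma>)) * of_real (s powr (2 * \<kappa> + 1) * h (s / \<sigma>))"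
        unfolding r[symmetric] by (simp only: mult_ac)
      then show "of_real (\<sigma> powr (2 * \<kappa> + 2) / \<sigma>) * (E \<sigma> (1 / \<sigma> * s) * of_real ((1 / \<sigma> * s) powr \<kappa> * v (1 / \<sigma> * s))) = g \<sigma> s"
        unfolding g_def by (simp add: mult_ac)
    qed
    finally show ?case by simp
  qed
  ultimately show ?thesis
    unfolding h0_def using Lim_transform_eventually by force
qed

lemma w_tendsto: "((\<lambda>t. exp (- \<i> * of_real t) * Complex (u t) (v t)) \<longlongrightarrow> \<Theta>) at_top"
proof (rule LIM_zero_cancel, rule Lim_null_comparison)
  show "\<forall>\<^sub>F t in at_top. norm (exp (- \<i> * of_real t) * Complex (u t) (v t) - \<Theta>) \<le> K / t"
    using eventually_ge_at_top[of 1]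
  proof eventually_elim
    case (elim t)
    have "exp (- \<i> * of_real t) * Complex (u t) (v t) - \<Theta>
        = exp (- \<i> * of_real t) * (Complex (u t) (v t) - exp (\<i> * of_real t) * \<Theta>)"
      by (simp add: right_diff_distrib mult.assoc[symmetric] flip: exp_add)
    then show ?case
      using asym[OF elim] by (simp add: norm_mult norm_exp_eq_Re)
  qed
  show "((\<lambda>t. K / t) \<longlongrightarrow> 0) at_top"
    by real_asymp
qed

text \<open>Since Z = (\<sigma> + i) Y, the product (\<sigma> + 2i) Y equals Z + iY, the transform
  of t^\<kappa> e^(-it) (u + iv). The last two factors converge to \<Theta>, with no
  counter-rotating part left. Scaling by \<tau> = 1/\<sigma> turns this into a Gamma integral in the
  limit.\<close>

lemma Y_at_zero:
  "((\<lambda>\<tau>. of_real (\<tau> powr (- (\<kappa> + 1))) * ((of_real (1 / \<tau>) + 2 * \<i>) * Y (1 / \<tau>))) \<longlongrightarrow>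
     of_real (Gamma (\<kappa> + 1)) * \<Theta>) at_top"
proof -
  define w where "w = (\<lambda>t. Complex (u t) (v t))"
  have w_eq: "w = (\<lambda>t. complex_of_real (u t) + \<i> * of_real (v t))"
    by (simp add: w_def Complex_eq)
  have [measurable]: "w \<in> borel_measurable borel"
    unfolding w_eq by measurable
  \<comment> \<open>A majorant uniform in \<tau>: for small arguments (\<tau>s)^\<kappa> is at most
    1 if \<kappa> \<ge> 0, and at most s^\<kappa> if \<kappa> < 0, because \<tau> \<ge> 1.\<close>
  have w_bound: "norm (w (\<tau> * s)) \<le> 2 * K * (1 + s powr \<kappa>)" if "s > 0" "\<tau> \<ge> 1" for s \<tau>
  proof -
    have ts: "\<tau> * s > 0" "\<tau> * s \<ge> s"
      using that by auto
    have "\<bar>u (\<tau> * s)\<bar> \<le> K * (1 + s powr \<kappa>) \<and> \<bar>v (\<tau> * s)\<bar> \<le> K * (1 + s powr \<kappa>)"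
    proof (cases "\<tau> * s \<le> 1")
      case True
      have "(\<tau> * s) powr \<kappa> \<le> 1 + s powr \<kappa>"
      proof (cases "\<kappa> \<ge> 0")
        case True
        then have "(\<tau> * s) powr \<kappa> \<le> 1"
          using \<open>\<tau> * s \<le> 1\<close> ts by (intro powr_le1) auto
        then show ?thesis by (simp add: add_increasing2)
      next
        case False
        then have "(\<tau> * s) powr \<kappa> \<le> s powr \<kappa>"
          using ts that by (intro powr_mono2') auto
        then show ?thesis by simp
      qed
      moreover have "(\<tau> * s) powr (\<kappa> + 1) \<le> 1 + s powr \<kappa>"
      proof -
        have "(\<tau> * s) powr (\<kappa> + 1) \<le> 1"
          using True ts kappa by (intro powr_le1) auto
        then show ?thesis by (simp add: add_increasing2)
      qed
      ultimately show ?thesis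
        using near[OF ts(1) True] K_nonneg by (meson mult_left_mono order_trans)
    next
      case False
      have "K * 1 \<le> K * (1 + s powr \<kappa>)"
        using K_nonneg by (intro mult_left_mono) auto
      then show ?thesis
        using far[of "\<tau> * s"] False by auto
    qed
    then show ?thesis
      using cmod_le[of "w (\<tau> * s)"] by (simp add: w_def)
  qed
  define g where "g = (\<lambda>\<tau> s. of_real (s powr \<kappa> * exp (- s)) * (exp (- \<i> * of_real (\<tau> * s)) * w (\<tau> * s)))"
  have "((\<lambda>\<tau>. LINT s|half_line. g \<tau> s) \<longlongrightarrow> (LINT s|half_line. of_real (s powr \<kappa> * exp (- s)) * \<Theta>)) at_top"
  proof (rule integral_dominated_convergence_at_top)
    show "integrable half_line (\<lambda>s. 2 * K * (s powr \<kappa> * exp (- s) + s powr (2 * \<kappa>) * exp (- s)))"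
      using kappa by (intro integrable_mult_right Bochner_Integration.integrable_add half_line_gamma) auto
    show "g \<tau> \<in> borel_measurable half_line" for \<tau>
      unfolding g_def by (rule measurable_restrict_space1) measurable
    show "(\<lambda>s. of_real (s powr \<kappa> * exp (- s)) * \<Theta>) \<in> borel_measurable half_line"
      by (rule measurable_restrict_space1) measurable
    show "\<forall>\<^sub>F \<tau> in at_top. AE s in half_line. norm (g \<tau> s) \<le> 2 * K * (s powr \<kappa> * exp (- s) + s powr (2 * \<kappa>) * exp (- s))"
      using eventually_ge_at_top[of 1]
    proof eventually_elim
      case (elim \<tau>)
      show ?case
        using AE_half_line_pos
      proof eventually_elim
        case (elim s)
        have "norm (g \<tau> s) = s powr \<kappa> * exp (- s) * norm (w (\<tau> * s))"
          by (simp add: g_def norm_mult norm_exp_eq_Re)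
        also have "\<dots> \<le> s powr \<kappa> * exp (- s) * (2 * K * (1 + s powr \<kappa>))"
          using \<open>\<tau> \<ge> 1\<close> elim by (intro mult_left_mono w_bound) auto
        also have "\<dots> = 2 * K * (s powr \<kappa> * exp (- s) + (s powr \<kappa> * s powr \<kappa>) * exp (- s))"
          by (simp add: algebra_simps)
        finally show ?case
          by (simp flip: powr_add)
      qed
    qed
    show "AE s in half_line. ((\<lambda>\<tau>. g \<tau> s) \<longlongrightarrow> of_real (s powr \<kappa> * exp (- s)) * \<Theta>) at_top"
      using AE_half_line_pos
    proof eventually_elim
      case (elim s)
      then have "filterlim (\<lambda>\<tau>. \<tau> * s) at_top at_top"
        by real_asymp
      from filterlim_compose[OF w_tendsto this]
      show ?case
        unfolding g_def w_def by (intro tendsto_intros)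
    qed
  qed
  moreover have "(LINT s|half_line. of_real (s powr \<kappa> * exp (- s)) * \<Theta>) = of_real (Gamma (\<kappa> + 1)) * \<Theta>"
  proof -
    have "(LINT s|half_line. of_real (s powr \<kappa> * exp (- s)) * \<Theta>)
        = of_real (LINT s|half_line. s powr \<kappa> * exp (- s)) * \<Theta>"
      by (simp only: integral_mult_left_zero integral_complex_of_real)
    also have "(LINT s|half_line. s powr \<kappa> * exp (- s)) = Gamma (\<kappa> + 1)"
      using kappa by (intro half_line_gamma) auto
    finally show ?thesis .
  qed
  moreover have "\<forall>\<^sub>F \<tau> in at_top. (LINT s|half_line. g \<tau> s)
      = of_real (\<tau> powr (- (\<kappa> + 1))) * ((of_real (1 / \<tau>) + 2 * \<i>) * Y (1 / \<tau>))"
    using eventually_gt_at_top[of 0]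
  proof eventually_elim
    case (elim \<tau>)
    define \<sigma> where "\<sigma> = 1 / \<tau>"
    have \<sigma>: "\<sigma> > 0"
      using elim by (simp add: \<sigma>_def)
    have "(of_real \<sigma> + 2 * \<i>) * Y \<sigma> = Z \<sigma> + \<i> * Y \<sigma>"
      unfolding laplace_ode(1)[OF \<sigma>] by (simp add: algebra_simps)
    also have "\<dots> = (LINT t|half_line. E \<sigma> t * of_real (t powr \<kappa> * u t) + \<i> * (E \<sigma> t * of_real (t powr \<kappa> * v t)))"
      unfolding YZ_E integral_mult_right_zero[symmetric]
      by (rule Bochner_Integration.integral_add[symmetric, OF laplace_integrable_E(2)[OF \<sigma>]
            integrable_mult_right[OF laplace_integrable_E(1)[OF \<sigma>]]])
    also have "\<dots> = (LINT t|half_line. E \<sigma> t * (of_real (t powr \<kappa>) * w t))"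
      by (intro Bochner_Integration.integral_cong refl) (simp add: w_eq algebra_simps)
    also have "\<dots> = \<tau> *\<^sub>R (LINT s|half_line. E \<sigma> (\<tau> * s) * (of_real ((\<tau> * s) powr \<kappa>) * w (\<tau> * s)))"
      by (rule half_line_scale(2)[OF elim])
    also have "(LINT s|half_line. E \<sigma> (\<tau> * s) * (of_real ((\<tau> * s) powr \<kappa>) * w (\<tau> * s)))
        = (LINT s|half_line. of_real (\<tau> powr \<kappa>) * g \<tau> s)"
    proof (rule half_line_integral_cong)
      fix s :: real assume "s > 0"
      moreover have "E \<sigma> (\<tau> * s) = of_real (exp (- s)) * exp (- \<i> * of_real (\<tau> * s))"
        using elim by (simp add: E_def \<sigma>_def)
      ultimately show "E \<sigma> (\<tau> * s) * (of_real ((\<tau> * s) powr \<kappa>) * w (\<tau> * s)) = of_real (\<tau> powr \<kappa>) * g \<tau> s"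
        using elim by (simp add: g_def powr_mult)
    qed
    also have "\<dots> = of_real (\<tau> powr \<kappa>) * (LINT s|half_line. g \<tau> s)"
      by (rule integral_mult_right_zero)
    finally have "(of_real \<sigma> + 2 * \<i>) * Y \<sigma> = of_real (\<tau> * \<tau> powr \<kappa>) * (LINT s|half_line. g \<tau> s)"
      by (simp add: scaleR_conv_of_real)
    moreover have "\<tau> powr (- (\<kappa> + 1)) * (\<tau> * \<tau> powr \<kappa>) = 1"
      unfolding powr_minus_divide powr_add using elim by simp
    then have "complex_of_real (\<tau> powr (- (\<kappa> + 1))) * of_real (\<tau> * \<tau> powr \<kappa>) = 1"
      by (metis of_real_1 of_real_mult)
    ultimately show ?case
      unfolding \<sigma>_def by (simp only: mult.assoc[symmetric] mult_1)
  qed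
  ultimately show ?thesis
    using Lim_transform_eventually by force
qed

text \<open>The constant c of \<open>norm_Y_scaled_constant\<close> is evaluated twice. As \<sigma>
  grows, sqrt(\<sigma>^2 + 4) behaves like \<sigma> and c = A. As \<sigma> tends to 0, one factor
  sqrt(\<sigma>^2 + 4) is |\<sigma> + 2i| and belongs to \<open>Y_at_zero\<close>; the remaining
  power tends to 2^\<kappa>.\<close>

theorem norm_Theta: "norm \<Theta> ^ 2 = 2 / pi"
proof -
  obtain c where c: "\<And>\<sigma>. \<sigma> > 0 \<Longrightarrow> norm (Y \<sigma>) * (\<sigma> * sqrt (\<sigma>\<^sup>2 + 4)) powr (\<kappa> + 1) = c"
    using norm_Y_scaled_constant by blast
  define A where "A = Gamma (2 * \<kappa> + 2) * (2 powr (- (\<nu> + 1)) / Gamma (\<nu> + 2))"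
  have k: "\<kappa> + 1 > 0" using kappa by simp
  have A0: "A \<ge> 0"
    using kappa nu by (simp add: A_def Gamma_real_nonneg)
  have "((\<lambda>\<sigma>. norm (of_real (\<sigma> powr (2 * \<kappa> + 2)) * Y \<sigma>) * (sqrt (1 + 4 / \<sigma>\<^sup>2)) powr (\<kappa> + 1)) \<longlongrightarrow> norm (complex_of_real A) * (sqrt 1) powr (\<kappa> + 1)) at_top"
  proof (intro tendsto_mult tendsto_norm tendsto_powr)
    show "((\<lambda>\<sigma>. of_real (\<sigma> powr (2 * \<kappa> + 2)) * Y \<sigma>) \<longlongrightarrow> complex_of_real A) at_top"
      unfolding A_def by (rule Y_at_infinity)
    show "((\<lambda>\<sigma>. sqrt (1 + 4 / \<sigma>\<^sup>2)) \<longlongrightarrow> sqrt 1) at_top"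
      by real_asymp
  qed auto
  moreover have "\<forall>\<^sub>F \<sigma> in at_top. norm (of_real (\<sigma> powr (2 * \<kappa> + 2)) * Y \<sigma>) * (sqrt (1 + 4 / \<sigma>\<^sup>2)) powr (\<kappa> + 1) = c"
    using eventually_gt_at_top[of 0]
  proof eventually_elim
    case (elim \<sigma>)
    have "sqrt (\<sigma>\<^sup>2 + 4) = \<sigma> * sqrt (1 + 4 / \<sigma>\<^sup>2)"
    proof -
      have "\<sigma>\<^sup>2 + 4 = \<sigma>\<^sup>2 * (1 + 4 / \<sigma>\<^sup>2)"
        using elim by (simp add: field_simps)
      then show ?thesis
        using elim by (simp add: real_sqrt_mult)
    qed
    then have "\<sigma> * sqrt (\<sigma>\<^sup>2 + 4) = (\<sigma> * \<sigma>) * sqrt (1 + 4 / \<sigma>\<^sup>2)"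
      by simp
    then have "(\<sigma> * sqrt (\<sigma>\<^sup>2 + 4)) powr (\<kappa> + 1) = (\<sigma> powr (\<kappa> + 1) * \<sigma> powr (\<kappa> + 1)) * sqrt (1 + 4 / \<sigma>\<^sup>2) powr (\<kappa> + 1)"
      using elim by (simp only: powr_mult less_imp_le mult_nonneg_nonneg real_sqrt_ge_zero)
    also have "\<sigma> powr (\<kappa> + 1) * \<sigma> powr (\<kappa> + 1) = \<sigma> powr (2 * \<kappa> + 2)"
      by (simp flip: powr_add add: algebra_simps)
    finally show ?case
      using c[OF elim] by (simp add: norm_mult mult_ac)
  qed
  ultimately have "norm (complex_of_real A) * (sqrt 1) powr (\<kappa> + 1) = c"
    by (rule tendsto_unique[OF trivial_limit_at_top_linorder _ tendsto_eventually])
  then have cA: "c = A"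
    using A0 by simp
  have "((\<lambda>\<tau>. norm (of_real (\<tau> powr (- (\<kappa> + 1))) * ((of_real (1 / \<tau>) + 2 * \<i>) * Y (1 / \<tau>)))
        * (sqrt ((1 / \<tau>)\<^sup>2 + 4)) powr \<kappa>) \<longlongrightarrow> norm (of_real (Gamma (\<kappa> + 1)) * \<Theta>) * 2 powr \<kappa>) at_top"
  proof (rule tendsto_mult[OF tendsto_norm[OF Y_at_zero] tendsto_powr[OF _ tendsto_const]])
    show "((\<lambda>\<tau>. sqrt ((1 / \<tau>)\<^sup>2 + 4)) \<longlongrightarrow> 2) at_top"
      by real_asymp
  qed auto
  moreover have "\<forall>\<^sub>F \<tau> in at_top. norm (of_real (\<tau> powr (- (\<kappa> + 1))) * ((of_real (1 / \<tau>) + 2 * \<i>) * Y (1 / \<tau>)))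
        * (sqrt ((1 / \<tau>)\<^sup>2 + 4)) powr \<kappa> = c"
    using eventually_gt_at_top[of 0]
  proof eventually_elim
    case (elim \<tau>)
    define \<sigma> where "\<sigma> = 1 / \<tau>"
    have \<sigma>: "\<sigma> > 0"
      using elim by (simp add: \<sigma>_def)
    define R where "R = sqrt (\<sigma>\<^sup>2 + 4)"
    have R: "R > 0"
      unfolding R_def by (simp add: add_nonneg_pos)
    have "norm (complex_of_real \<sigma> + 2 * \<i>) = R"
      by (simp add: cmod_def R_def)
    moreover have "\<tau> powr (- (\<kappa> + 1)) = \<sigma> powr (\<kappa> + 1)"
      unfolding powr_minus_divide \<sigma>_def using elim by (simp add: powr_divide)
    ultimately have "norm (of_real (\<tau> powr (- (\<kappa> + 1))) * ((of_real \<sigma> + 2 * \<i>) * Y \<sigma>)) * R powr \<kappa>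
        = \<sigma> powr (\<kappa> + 1) * (R powr \<kappa> * R) * norm (Y \<sigma>)"
      by (simp add: norm_mult mult_ac)
    also have "R powr \<kappa> * R = R powr (\<kappa> + 1)"
      using R by (simp add: powr_add)
    also have "\<sigma> powr (\<kappa> + 1) * R powr (\<kappa> + 1) * norm (Y \<sigma>) = c"
      using c[OF \<sigma>] \<sigma> R by (simp add: R_def powr_mult mult_ac)
    finally show ?case
      unfolding R_def \<sigma>_def .
  qed
  ultimately have "norm (of_real (Gamma (\<kappa> + 1)) * \<Theta>) * 2 powr \<kappa> = c"
    by (rule tendsto_unique[OF trivial_limit_at_top_linorder _ tendsto_eventually])
  then have eq: "Gamma (\<kappa> + 1) * norm \<Theta> * 2 powr \<kappa> = A"
    using cA k by (simp add: norm_mult Gamma_real_nonneg)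
  have G: "Gamma (\<kappa> + 1) > 0" "Gamma (\<nu> + 2) > 0"
    using k nu by (auto intro: Gamma_real_pos)
  \<comment> \<open>Duplication at \<kappa> + 1, whose shift by 1/2 is \<nu> + 2; it removes every
    Gamma value from the comparison.\<close>
  have "Gamma (\<kappa> + 1) * Gamma (\<nu> + 2) = 2 powr (1 - 2 * (\<kappa> + 1)) * sqrt pi * Gamma (2 * \<kappa> + 2)"
    using Gamma_real_duplication[OF k] by (simp add: \<kappa>_def algebra_simps)
  then have "Gamma (2 * \<kappa> + 2) / Gamma (\<nu> + 2) = Gamma (\<kappa> + 1) / (2 powr (1 - 2 * (\<kappa> + 1)) * sqrt pi)"
    using G by (simp add: field_simps)
  moreover have "A = Gamma (2 * \<kappa> + 2) / Gamma (\<nu> + 2) * 2 powr (- (\<nu> + 1))"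
    by (simp add: A_def)
  ultimately have "A = Gamma (\<kappa> + 1) * (2 powr (- (\<nu> + 1)) / 2 powr (1 - 2 * (\<kappa> + 1)) / sqrt pi)"
    by simp
  then have "Gamma (\<kappa> + 1) * (norm \<Theta> * 2 powr \<kappa>)
      = Gamma (\<kappa> + 1) * (2 powr (- (\<nu> + 1)) / 2 powr (1 - 2 * (\<kappa> + 1)) / sqrt pi)"
    using eq by (simp only: mult.assoc)
  then have "norm \<Theta> * 2 powr \<kappa> = 2 powr (- (\<nu> + 1)) / 2 powr (1 - 2 * (\<kappa> + 1)) / sqrt pi"
    by (rule mult_left_cancel[THEN iffD1, rotated]) (use G in simp)
  also have "2 powr (- (\<nu> + 1)) / 2 powr (1 - 2 * (\<kappa> + 1)) = 2 powr (\<kappa> + 1 / 2)"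
    by (simp add: \<kappa>_def algebra_simps flip: powr_diff)
  also have "2 powr (\<kappa> + 1 / 2) = sqrt 2 * 2 powr \<kappa>"
    by (simp add: powr_add powr_half_sqrt)
  finally have "norm \<Theta> = sqrt 2 / sqrt pi"
    by (simp add: field_simps)
  then show ?thesis
    by (simp add: power_divide)
qed

end

section \<open>Piecewise \<open>C\<^sup>2\<close> symbols\<close>

lemma half_line_deriv_eqI:
  assumes "t > 0" "(f has_vector_derivative d) (at t)"
  shows "half_line_deriv f t = d"
proof -
  have "at t within {0..} = at t"
    using assms(1) by (intro at_within_interior) auto
  then show ?thesis
    using assms(2) by (simp add: half_line_deriv_def vector_derivative_at)
qed

text \<open>\<open>C2_on\<close> supplies derivatives that are continuous up to the endpoints, while
  \<open>half_line_deriv\<close> is determined only where a two-sided derivative exists. They are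
  identified in the interior, and the continuous versions are kept for the closed interval.\<close>

lemma C2_on_half_line_deriv:
  assumes "C2_on I a" and I: "interior I \<subseteq> {0<..}"
  shows "\<exists>b b'. continuous_on I b \<and> continuous_on I b' \<and>
    (\<forall>t\<in>I. (b has_vector_derivative b' t) (at t within I)) \<and>
    (\<forall>t\<in>interior I. (a has_vector_derivative b t) (at t) \<and> half_line_deriv a t = b t
      \<and> half_line_deriv (half_line_deriv a) t = b' t)"
proof -
  obtain b b' where b: "\<And>t. t \<in> I \<Longrightarrow> (a has_vector_derivative b t) (at t within I)"
    and b': "\<And>t. t \<in> I \<Longrightarrow> (b has_vector_derivative b' t) (at t within I)"
    and cont: "continuous_on I b'"
    using assms(1) unfolding C2_on_def by blast
  have bi: "(a has_vector_derivative b t) (at t)" "(b has_vector_derivative b' t) (at t)"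
    if "t \<in> interior I" for t
    using that b[of t] b'[of t] interior_subset[of I] at_within_interior[OF that] by auto
  have d1: "half_line_deriv a t = b t" if "t \<in> interior I" for t
    using that bi I by (intro half_line_deriv_eqI) auto
  have d2: "half_line_deriv (half_line_deriv a) t = b' t" if "t \<in> interior I" for t
  proof (rule half_line_deriv_eqI)
    show "(half_line_deriv a has_vector_derivative b' t) (at t)"
      by (rule has_vector_derivative_transform_within_open[OF bi(2)[OF that] open_interior that])
        (simp add: d1)
  qed (use that I in auto)
  have "continuous_on I b"
    using b' has_vector_derivative_continuous continuous_on_eq_continuous_within by blast
  then show ?thesis
    using cont b' bi(1) d1 d2 by (intro exI[of _ b] exI[of _ b']) blast
qed

text \<open>One integration by parts against the exponential. The value at \<open>q\<close> is
  estimated by the value at \<open>p\<close> plus the variation, which accounts for the factor 2 and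
  keeps the bound usable as q tends to infinity.\<close>

lemma oscillatory_integral_C1_bound:
  fixes b b' :: "real \<Rightarrow> complex"
  assumes pq: "p \<le> q" and s: "s \<noteq> 0" and cont: "continuous_on {p..q} b" "continuous_on {p..q} b'"
    and b': "\<And>t. t \<in> {p<..<q} \<Longrightarrow> (b has_vector_derivative b' t) (at t)"
  shows "norm (integral {p..q} (\<lambda>t. exp (\<i> * of_real (s * t)) * b t))
    \<le> 2 * (norm (b p) + integral {p..q} (\<lambda>t. norm (b' t))) / \<bar>s\<bar>"
proof -
  define E where "E = (\<lambda>t. exp (\<i> * of_real (s * t)) :: complex)"
  define J where "J = integral {p..q} (\<lambda>t. norm (b' t))"
  have nE: "norm (E t) = 1" for t
    unfolding E_def by simp
  have contE: "continuous_on A E" for A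
    unfolding E_def by (intro continuous_intros)
  have dE: "(E has_vector_derivative (\<i> * of_real s) * E t) (at t)" for t
    using has_vector_derivative_exp_of_real[of "\<i> * of_real s" t UNIV] by (simp add: E_def mult.assoc)
  have i1: "(\<lambda>t. norm (b' t)) integrable_on {p..q}"
    by (intro integrable_continuous_interval continuous_intros cont)
  have "((\<lambda>t. E t * b' t + (\<i> * of_real s) * E t * b t) has_integral (E q * b q - E p * b p)) {p..q}"
  proof (rule fundamental_theorem_of_calculus_interior[OF pq])
    show "continuous_on {p..q} (\<lambda>t. E t * b t)"
      by (intro continuous_intros contE cont)
    show "((\<lambda>t. E t * b t) has_vector_derivative E t * b' t + (\<i> * of_real s) * E t * b t) (at t)"
      if "t \<in> {p<..<q}" for t
      using has_vector_derivative_mult[OF dE b'[OF that]] by simp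
  qed
  moreover have "((\<lambda>t. E t * b' t) has_integral integral {p..q} (\<lambda>t. E t * b' t)) {p..q}"
    by (intro integrable_integral integrable_continuous_interval continuous_intros contE cont)
  ultimately have "((\<lambda>t. (E t * b' t + (\<i> * of_real s) * E t * b t) - E t * b' t) has_integral
      (E q * b q - E p * b p - integral {p..q} (\<lambda>t. E t * b' t))) {p..q}"
    by (rule has_integral_diff)
  then have "((\<lambda>t. (\<i> * of_real s) * (E t * b t)) has_integral
      (E q * b q - E p * b p - integral {p..q} (\<lambda>t. E t * b' t))) {p..q}"
    by (simp add: mult.assoc)
  then have "(\<i> * of_real s) * integral {p..q} (\<lambda>t. E t * b t)
      = E q * b q - E p * b p - integral {p..q} (\<lambda>t. E t * b' t)"
    by (subst integral_mult_right[symmetric]) (rule integral_unique)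
  moreover have "norm (E q * b q - E p * b p - z) \<le> norm (b q) + norm (b p) + norm z" for z
    using norm_triangle_ineq4[of "E q * b q - E p * b p" z] norm_triangle_ineq4[of "E q * b q" "E p * b p"]
    by (simp add: norm_mult nE)
  ultimately have "norm ((\<i> * of_real s) * integral {p..q} (\<lambda>t. E t * b t))
      \<le> norm (b q) + norm (b p) + norm (integral {p..q} (\<lambda>t. E t * b' t))"
    by metis
  moreover have "norm (integral {p..q} (\<lambda>t. E t * b' t)) \<le> J"
    unfolding J_def
    by (rule integral_norm_bound_integral)
      (auto simp: norm_mult nE intro!: i1 integrable_continuous_interval continuous_intros contE cont)
  moreover have "norm (b q) \<le> norm (b p) + J"
  proof -
    have "(b' has_integral (b q - b p)) {p..q}"
      by (rule fundamental_theorem_of_calculus_interior[OF pq cont(1)]) (use b' in auto)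
    then have "norm (b q - b p) \<le> J"
      unfolding J_def using integral_norm_bound_integral[of b' "{p..q}" "\<lambda>t. norm (b' t)"] i1
      by (metis has_integral_iff order_refl)
    then show ?thesis
      using norm_triangle_sub[of "b q" "b p"] by linarith
  qed
  ultimately have "\<bar>s\<bar> * norm (integral {p..q} (\<lambda>t. E t * b t)) \<le> 2 * (norm (b p) + J)"
    using s by (simp add: norm_mult)
  then show ?thesis
    using s by (simp add: E_def J_def field_simps)
qed

text \<open>Endpoints are null sets; this exchanges the derivative, known only inside the interval,
  for its continuous extension to the closed interval.\<close>

lemma set_integrable_interval_cong:
  fixes f g :: "real \<Rightarrow> complex"
  assumes "\<And>t. p < t \<Longrightarrow> t < q \<Longrightarrow> f t = g t"
  shows "set_integrable lborel {p<..q} f \<longleftrightarrow> set_integrable lborel {p..q} g"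
    and "(LINT t:{p<..q}|lborel. f t) = (LINT t:{p..q}|lborel. g t)"
proof -
  have eq: "indicator {p<..q} t *\<^sub>R f t = indicator {p..q} t *\<^sub>R g t" if "t \<notin> {p, q}" for t
    using that assms[of t] by (auto simp: indicator_def)
  show "set_integrable lborel {p<..q} f \<longleftrightarrow> set_integrable lborel {p..q} g"
    unfolding set_integrable_def
    by (rule integrable_discrete_difference[where X="{p, q}"]) (auto simp: eq emeasure_lborel_countable)
  show "(LINT t:{p<..q}|lborel. f t) = (LINT t:{p..q}|lborel. g t)"
    unfolding set_lebesgue_integral_def
    by (rule integral_discrete_difference[where X="{p, q}"]) (auto simp: eq emeasure_lborel_countable)
qed

text \<open>Landau's argument: \<open>f'\<close> at a point is controlled by \<open>f\<close> and \<open>f''\<close> on the next unit interval.\<close>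

lemma derivative_integrable_of_second_derivative:
  fixes a b b' :: "real \<Rightarrow> complex"
  assumes a: "set_integrable lborel {p<..} a" and b': "set_integrable lborel {p<..} b'"
    and da: "\<And>t. t > p \<Longrightarrow> (a has_vector_derivative b t) (at t)"
    and db: "\<And>t. t > p \<Longrightarrow> (b has_vector_derivative b' t) (at t)"
  shows "set_integrable lborel {p<..} b"
proof -
  define A where "A = (\<lambda>t. norm (indicator {p<..} t *\<^sub>R a t))"
  define c where "c = (\<lambda>t. norm (indicator {p<..} t *\<^sub>R b' t))"
  have A: "integrable lborel A" and c: "integrable lborel c"
    using a b' unfolding A_def c_def set_integrable_def by (auto intro: integrable_norm simp del: norm_scaleR)
  have [measurable]: "A \<in> borel_measurable borel" "c \<in> borel_measurable borel"
    using A c by auto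
  have cont: "continuous_on {p<..} b"
    using db by (intro continuous_at_imp_continuous_on) (auto intro: has_vector_derivative_continuous)
  then have bm: "(\<lambda>t. indicator {p<..} t *\<^sub>R b t) \<in> borel_measurable borel"
    by (intro borel_measurable_continuous_on_indicator) auto
  have le: "ennreal (norm (indicator {p<..} t *\<^sub>R b t))
      \<le> ennreal (A (t + 1)) + ennreal (A t) + (\<integral>\<^sup>+r. indicator {0..1} r * ennreal (c (t + r)) \<partial>lborel)" for t
  proof (cases "t > p")
    case True
    have sh: "((\<lambda>r. f (t + r)) has_vector_derivative d) (at r)"
      if "(f has_vector_derivative d) (at (t + r))" for f :: "real \<Rightarrow> complex" and d r
    proof -
      have "((\<lambda>r. t + r) has_vector_derivative 1) (at r)"
        unfolding has_vector_derivative_def by (auto intro!: derivative_eq_intros)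
      from vector_diff_chain_at[OF this that] show ?thesis
        by (simp add: o_def)
    qed
    \<comment> \<open>Taylor's formula with integral remainder over one unit step: a(t+1) - a(t) -
      b(t) is the integral of (1-r) b'(t+r).\<close>
    have hi: "((\<lambda>r. of_real (1 - r) * b' (t + r)) has_integral
        (of_real (1 - 1) * b (t + 1) + a (t + 1) - (of_real (1 - 0) * b (t + 0) + a (t + 0)))) {0..1}"
    proof (rule fundamental_theorem_of_calculus)
      fix r :: real assume r: "r \<in> {0..1}"
      have "((\<lambda>r. of_real (1 - r) * b (t + r) + a (t + r)) has_vector_derivative
          (of_real (1 - r) * b' (t + r) + (- 1) * b (t + r)) + b (t + r)) (at r within {0..1})"
        using r True by (intro has_vector_derivative_add has_vector_derivative_mult
            has_vector_derivative_at_within[OF sh] da db)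
          (auto intro!: derivative_eq_intros simp: has_vector_derivative_def scaleR_conv_of_real)
      then show "((\<lambda>r. of_real (1 - r) * b (t + r) + a (t + r)) has_vector_derivative
          of_real (1 - r) * b' (t + r)) (at r within {0..1})"
        by simp
    qed simp
    have int: "set_integrable lborel {0..1} (\<lambda>r. c (t + r))"
    proof -
      have "integrable lborel (\<lambda>r. c (t + 1 * r))"
        using c by (subst lborel_integrable_real_affine_iff) auto
      then show ?thesis
        unfolding set_integrable_def by (intro integrable_mult_indicator) auto
    qed
    have hc: "((\<lambda>r. c (t + r)) has_integral (LINT r:{0..1}|lborel. c (t + r))) {0..1}"
      using set_borel_integral_eq_integral[OF int] by (simp add: has_integral_iff)
    have "norm (a (t + 1) - b t - a t) \<le> (LINT r:{0..1}|lborel. c (t + r))"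
    proof -
      have "norm (integral {0..1} (\<lambda>r. of_real (1 - r) * b' (t + r))) \<le> integral {0..1} (\<lambda>r. c (t + r))"
      proof (rule integral_norm_bound_integral)
        show "norm (of_real (1 - r) * b' (t + r)) \<le> c (t + r)" if "r \<in> {0..1}" for r
          using that True mult_right_mono[of "1 - r" 1 "norm (b' (t + r))"]
          by (auto simp: c_def norm_mult simp flip: of_real_diff)
      qed (use hi hc in \<open>auto simp: has_integral_iff\<close>)
      moreover have "integral {0..1} (\<lambda>r. of_real (1 - r) * b' (t + r)) = a (t + 1) - b t - a t"
        using integral_unique[OF hi] by simp
      ultimately show ?thesis
        using integral_unique[OF hc] by simp
    qed
    then have "norm (b t) \<le> A (t + 1) + A t + (LINT r:{0..1}|lborel. c (t + r))"
      using True norm_triangle_ineq4[of "a (t + 1) - a t" "a (t + 1) - b t - a t"]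
        norm_triangle_ineq4[of "a (t + 1)" "a t"] by (simp add: A_def)
    moreover have "ennreal (LINT r:{0..1}|lborel. c (t + r)) = (\<integral>\<^sup>+r. indicator {0..1} r * ennreal (c (t + r)) \<partial>lborel)"
      using int unfolding set_lebesgue_integral_def set_integrable_def
      by (subst nn_integral_eq_integral[symmetric])
        (auto simp: c_def indicator_def intro!: nn_integral_cong)
    moreover have "A s \<ge> 0" "(LINT r:{0..1}|lborel. c (t + r)) \<ge> 0" for s
      by (auto simp: A_def c_def set_lebesgue_integral_def)
    ultimately have "ennreal (norm (b t)) \<le> ennreal (A (t + 1)) + ennreal (A t)
        + (\<integral>\<^sup>+r. indicator {0..1} r * ennreal (c (t + r)) \<partial>lborel)"
      by (metis add_nonneg_nonneg ennreal_leI ennreal_plus)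
    then show ?thesis
      using True by simp
  qed simp
  have "(\<integral>\<^sup>+t. ennreal (norm (indicator {p<..} t *\<^sub>R b t)) \<partial>lborel)
    \<le> (\<integral>\<^sup>+t. ennreal (A (t + 1)) + ennreal (A t)
        + (\<integral>\<^sup>+r. indicator {0..1} r * ennreal (c (t + r)) \<partial>lborel) \<partial>lborel)"
    by (intro nn_integral_mono le)
  also have "\<dots> = (\<integral>\<^sup>+t. ennreal (A (t + 1)) \<partial>lborel) + (\<integral>\<^sup>+t. ennreal (A t) \<partial>lborel)
      + (\<integral>\<^sup>+t. (\<integral>\<^sup>+r. indicator {0..1} r * ennreal (c (t + r)) \<partial>lborel) \<partial>lborel)"
    by (simp add: nn_integral_add)
  also have "(\<integral>\<^sup>+t. ennreal (A (t + 1)) \<partial>lborel) = (\<integral>\<^sup>+t. ennreal (A t) \<partial>lborel)"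
    using nn_integral_real_affine[of "\<lambda>t. ennreal (A t)" 1 1] by (simp add: add.commute)
  \<comment> \<open>Exchanging the integrals, each shift r in [0,1] contributes the full integral of
    \<open>c\<close>; so the L1 norm of \<open>b\<close> is at most twice that of \<open>a\<close>
    plus that of \<open>b'\<close>.\<close>
  also have "(\<integral>\<^sup>+t. (\<integral>\<^sup>+r. indicator {0..1} r * ennreal (c (t + r)) \<partial>lborel) \<partial>lborel)
     = (\<integral>\<^sup>+r. (\<integral>\<^sup>+t. indicator {0..1} r * ennreal (c (t + r)) \<partial>lborel) \<partial>lborel)"
    by (rule lborel_pair.Fubini') measurable
  also have "\<dots> = (\<integral>\<^sup>+r. indicator {0..1::real} r * (\<integral>\<^sup>+t. ennreal (c t) \<partial>lborel) \<partial>lborel)"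
  proof (rule nn_integral_cong)
    fix r :: real
    show "(\<integral>\<^sup>+t. indicator {0..1} r * ennreal (c (t + r)) \<partial>lborel) = indicator {0..1} r * (\<integral>\<^sup>+t. ennreal (c t) \<partial>lborel)"
      using nn_integral_real_affine[of "\<lambda>t. ennreal (c t)" 1 r]
      by (subst nn_integral_cmult) (auto simp: add.commute)
  qed
  also have "\<dots> = (\<integral>\<^sup>+t. ennreal (c t) \<partial>lborel)"
    by (subst nn_integral_multc) auto
  also have "(\<integral>\<^sup>+t. ennreal (A t) \<partial>lborel) + (\<integral>\<^sup>+t. ennreal (A t) \<partial>lborel) + (\<integral>\<^sup>+t. ennreal (c t) \<partial>lborel) < \<infinity>"
    using A c by (auto simp: integrable_iff_bounded A_def c_def)
  finally show ?thesis
    using bm by (simp add: set_integrable_def integrable_iff_bounded)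
qed

text \<open>Below \<delta> the function is bounded and the weight integrable; beyond \<delta> the
  weight is bounded and the function integrable.\<close>

lemma half_line_integrable_powr_weight:
  fixes f :: "real \<Rightarrow> complex"
  assumes f: "integrable half_line f" and bd: "\<And>t. 0 < t \<Longrightarrow> t < \<delta> \<Longrightarrow> norm (f t) \<le> B"
    and "\<delta> > 0" and \<gamma>: "0 \<le> \<gamma>" "\<gamma> < 1"
  shows "integrable half_line (\<lambda>t. t powr (- \<gamma>) * norm (f t))"
proof (rule half_line_integrable_bound)
  have [measurable]: "f \<in> borel_measurable half_line"
    using f by auto
  show "(\<lambda>t. t powr (- \<gamma>) * norm (f t)) \<in> borel_measurable half_line"
  proof -
    have [measurable]: "(\<lambda>t. t powr (- \<gamma>)) \<in> borel_measurable half_line"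
      by (rule measurable_restrict_space1) measurable
    show ?thesis by measurable
  qed
  have "set_integrable lborel {0..\<delta>} (\<lambda>t. t powr (- \<gamma>))"
    using assms has_integral_powr_from_0[of "- \<gamma>" \<delta>]
    by (intro set_integrable_of_has_integral) auto
  then have "integrable lborel (\<lambda>t. indicator {0<..} t *\<^sub>R (indicator {0..\<delta>} t *\<^sub>R t powr (- \<gamma>)))"
    unfolding set_integrable_def by (rule integrable_mult_indicator[rotated]) auto
  then have "integrable half_line (\<lambda>t. indicator {0..\<delta>} t *\<^sub>R t powr (- \<gamma>))"
    by (simp add: half_line_integrable_iff set_integrable_def)
  then show "integrable half_line (\<lambda>t. \<bar>B\<bar> * (indicator {0..\<delta>} t *\<^sub>R t powr (- \<gamma>)) + \<delta> powr (- \<gamma>) * norm (f t))"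
    using f by (intro Bochner_Integration.integrable_add integrable_mult_right integrable_norm)
  fix t :: real assume t: "t > 0"
  show "norm (t powr (- \<gamma>) * norm (f t))
      \<le> \<bar>B\<bar> * (indicator {0..\<delta>} t *\<^sub>R t powr (- \<gamma>)) + \<delta> powr (- \<gamma>) * norm (f t)"
  proof (cases "t < \<delta>")
    case True
    then have "t powr (- \<gamma>) * norm (f t) \<le> t powr (- \<gamma>) * \<bar>B\<bar>"
      using bd[OF t] by (intro mult_left_mono) auto
    then show ?thesis
      using True t by (simp add: mult.commute add_increasing2)
  next
    case False
    then have "t powr (- \<gamma>) \<le> \<delta> powr (- \<gamma>)"
      using \<open>\<delta> > 0\<close> \<gamma> by (intro powr_mono2') auto
    then show ?thesis
      by (simp add: mult_right_mono add_increasing)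
  qed
qed

lemma C2_on_subset:
  assumes "C2_on I a" and sub: "J \<subseteq> I"
  shows "C2_on J a"
proof -
  obtain b b' where "\<And>t. t \<in> I \<Longrightarrow> (a has_vector_derivative b t) (at t within I)"
    "\<And>t. t \<in> I \<Longrightarrow> (b has_vector_derivative b' t) (at t within I)" "continuous_on I b'"
    using assms(1) unfolding C2_on_def by blast
  then show ?thesis
    unfolding C2_on_def using sub
    by (intro exI[of _ b] exI[of _ b'])
      (auto intro: has_vector_derivative_within_subset continuous_on_subset)
qed

text \<open>Half-open intervals let consecutive pieces partition the half-line. All three claims are
  read off the continuous extension of the derivative to the closed interval.\<close>

lemma oscillatory_integral_C2_piece:
  assumes C2: "C2_on {p..q} a" and pq: "0 \<le> p" "p < q"
  shows "set_integrable lborel {p<..q} (half_line_deriv a)"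
    and "\<exists>V. \<forall>s. s \<noteq> 0 \<longrightarrow> norm (LINT t:{p<..q}|lborel. exp (\<i> * of_real (s * t)) * half_line_deriv a t) \<le> V / \<bar>s\<bar>"
    and "\<exists>B. \<forall>t. p < t \<longrightarrow> t < q \<longrightarrow> norm (half_line_deriv a t) \<le> B"
proof -
  have "interior {p..q} \<subseteq> {0<..}"
    using pq by auto
  then obtain b b' where b: "continuous_on {p..q} b" "continuous_on {p..q} b'"
    "\<forall>t\<in>{p..q}. (b has_vector_derivative b' t) (at t within {p..q})"
    "\<forall>t\<in>{p<..<q}. (a has_vector_derivative b t) (at t) \<and> half_line_deriv a t = b t
      \<and> half_line_deriv (half_line_deriv a) t = b' t"
    using C2_on_half_line_deriv[OF C2] by (auto simp: interior_atLeastAtMost_real)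
  have db: "(b has_vector_derivative b' t) (at t)" if "t \<in> {p<..<q}" for t
    using b(3)[rule_format, of t] that at_within_interior[of t "{p..q}"] by (simp add: interior_atLeastAtMost_real)
  have eq: "half_line_deriv a t = b t" if "p < t" "t < q" for t
    using b(4) that by simp
  show "set_integrable lborel {p<..q} (half_line_deriv a)"
    using set_integrable_interval_cong(1)[of p q "half_line_deriv a" b] eq
      borel_integrable_atLeastAtMost'[OF b(1)] by simp
  have "norm (LINT t:{p<..q}|lborel. exp (\<i> * of_real (s * t)) * half_line_deriv a t)
      \<le> 2 * (norm (b p) + integral {p..q} (\<lambda>t. norm (b' t))) / \<bar>s\<bar>" if s: "s \<noteq> 0" for s
  proof -
    have "(LINT t:{p<..q}|lborel. exp (\<i> * of_real (s * t)) * half_line_deriv a t)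
        = (LINT t:{p..q}|lborel. exp (\<i> * of_real (s * t)) * b t)"
      by (rule set_integrable_interval_cong(2)) (simp add: eq)
    also have "\<dots> = integral {p..q} (\<lambda>t. exp (\<i> * of_real (s * t)) * b t)"
      by (intro set_borel_integral_eq_integral borel_integrable_atLeastAtMost' continuous_intros b)
    also have "norm \<dots> \<le> 2 * (norm (b p) + integral {p..q} (\<lambda>t. norm (b' t))) / \<bar>s\<bar>"
      using pq s by (intro oscillatory_integral_C1_bound b db) auto
    finally show ?thesis .
  qed
  then show "\<exists>V. \<forall>s. s \<noteq> 0 \<longrightarrow> norm (LINT t:{p<..q}|lborel. exp (\<i> * of_real (s * t)) * half_line_deriv a t) \<le> V / \<bar>s\<bar>"
    by blast
  have "compact (b ` {p..q})"
    by (intro compact_continuous_image b) auto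
  then obtain B where "\<And>t. t \<in> {p..q} \<Longrightarrow> norm (b t) \<le> B"
    using compact_imp_bounded bounded_iff by (metis imageI)
  then show "\<exists>B. \<forall>t. p < t \<longrightarrow> t < q \<longrightarrow> norm (half_line_deriv a t) \<le> B"
    using eq by (metis atLeastAtMost_iff less_imp_le)
qed

text \<open>Integrability of the first derivative follows from that of \<open>a\<close> and of its
  second derivative. The oscillation bound on (p, q] does not depend on q, because the variation is
  at most \<open>J\<close>, and so it survives the limit.\<close>

lemma oscillatory_integral_C2_tail:
  assumes C2: "C2_on {p..} a" and p: "0 \<le> p"
    and a: "integrable half_line a" and a2: "integrable half_line (half_line_deriv (half_line_deriv a))"
  shows "set_integrable lborel {p<..} (half_line_deriv a)"
    and "\<exists>V. \<forall>s. s \<noteq> 0 \<longrightarrow> norm (LINT t:{p<..}|lborel. exp (\<i> * of_real (s * t)) * half_line_deriv a t) \<le> V / \<bar>s\<bar>"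
proof -
  have int: "interior {p..} = {p<..}"
    by (rule interior_Ici[of "p - 1"]) auto
  have "interior {p..} \<subseteq> {0<..}"
    using p by (simp add: int)
  then obtain b b' where b: "continuous_on {p..} b" "continuous_on {p..} b'"
    "\<forall>t\<in>{p..}. (b has_vector_derivative b' t) (at t within {p..})"
    "\<forall>t\<in>{p<..}. (a has_vector_derivative b t) (at t) \<and> half_line_deriv a t = b t
      \<and> half_line_deriv (half_line_deriv a) t = b' t"
    using C2_on_half_line_deriv[OF C2] by (auto simp: int)
  have db: "(b has_vector_derivative b' t) (at t)" if "t > p" for t
    using b(3)[rule_format, of t] that at_within_interior[of t "{p..}"] by (simp add: int)
  have "set_integrable lborel {p<..} (half_line_deriv (half_line_deriv a))"
    by (rule set_integrable_subset[OF a2[unfolded half_line_integrable_iff]]) (use p in auto)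
  then have b'_int: "set_integrable lborel {p<..} b'"
    by (rule set_integrable_cong[THEN iffD1, rotated -1]) (use b in auto)
  have "set_integrable lborel {p<..} a"
    by (rule set_integrable_subset[OF a[unfolded half_line_integrable_iff]]) (use p in auto)
  then have b_int: "set_integrable lborel {p<..} b"
    by (rule derivative_integrable_of_second_derivative[OF _ b'_int]) (use b db in auto)
  then show "set_integrable lborel {p<..} (half_line_deriv a)"
    by (rule set_integrable_cong[THEN iffD1, rotated -1]) (use b in auto)
  define J where "J = (LINT t:{p<..}|lborel. norm (b' t))"
  have "norm (LINT t:{p<..}|lborel. exp (\<i> * of_real (s * t)) * half_line_deriv a t)
      \<le> 2 * (norm (b p) + J) / \<bar>s\<bar>" if s: "s \<noteq> 0" for s
  proof -
    define f where "f = (\<lambda>t. exp (\<i> * of_real (s * t)) * b t)"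
    have f_cont: "continuous_on {p..} f"
      unfolding f_def by (intro continuous_intros b)
    have f_int: "set_integrable lborel {p<..} f"
      using b_int
    proof (rule set_integrable_bound)
      show "set_borel_measurable lborel {p<..} f"
        unfolding set_borel_measurable_def
        by (auto intro!: borel_measurable_continuous_on_indicator continuous_on_subset[OF f_cont])
    qed (auto simp: f_def norm_mult)
    have eqs: "(LINT t:{p<..}|lborel. exp (\<i> * of_real (s * t)) * half_line_deriv a t) = (LINT t:{p<..}|lborel. f t)"
      using b(4) by (intro set_lebesgue_integral_cong) (auto simp: f_def)
    have le: "norm (LINT t:{p<..q}|lborel. f t) \<le> 2 * (norm (b p) + J) / \<bar>s\<bar>" if "q > p" for q
    proof -
      have cq: "continuous_on {p..q} b" "continuous_on {p..q} b'" "continuous_on {p..q} f"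
        using b f_cont by (auto intro: continuous_on_subset)
      have "(LINT t:{p<..q}|lborel. f t) = (LINT t:{p..q}|lborel. f t)"
        by (rule set_integrable_interval_cong(2)) simp
      also have "\<dots> = integral {p..q} f"
        by (intro set_borel_integral_eq_integral borel_integrable_atLeastAtMost' cq)
      also have "norm \<dots> \<le> 2 * (norm (b p) + integral {p..q} (\<lambda>t. norm (b' t))) / \<bar>s\<bar>"
        unfolding f_def using that s by (intro oscillatory_integral_C1_bound cq db) auto
      also have "integral {p..q} (\<lambda>t. norm (b' t)) = (LINT t:{p..q}|lborel. norm (b' t))"
        by (intro set_borel_integral_eq_integral(2)[symmetric] borel_integrable_atLeastAtMost'
            continuous_intros cq)
      also have "\<dots> = (LINT t:{p<..q}|lborel. norm (b' t))"
        unfolding set_lebesgue_integral_def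
        by (rule integral_discrete_difference[where X="{p}"]) (auto simp: indicator_def)
      also have "\<dots> \<le> J"
      proof -
        have i: "set_integrable lborel {p<..} (\<lambda>t. norm (b' t))"
          using b'_int by (rule set_integrable_norm)
        then have "set_integrable lborel {p<..q} (\<lambda>t. norm (b' t))"
          by (rule set_integrable_subset) auto
        then show ?thesis
          using i unfolding J_def set_lebesgue_integral_def set_integrable_def
          by (intro integral_mono) (auto simp: indicator_def)
      qed
      finally show ?thesis
        using s by (simp add: divide_right_mono)
    qed
    have "((\<lambda>q. LINT t:{p<..q}|lborel. f t) \<longlongrightarrow> (LINT t:{p<..}|lborel. f t)) at_top"
      unfolding set_lebesgue_integral_def
    proof (rule integral_dominated_convergence_at_top)
      show "integrable lborel (\<lambda>t. norm (indicator {p<..} t *\<^sub>R f t))"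
        using f_int by (intro integrable_norm) (simp add: set_integrable_def)
      show "(\<lambda>t. indicator {p<..} t *\<^sub>R f t) \<in> borel_measurable lborel"
        using f_int unfolding set_integrable_def by (rule borel_measurable_integrable)
      show "(\<lambda>t. indicator {p<..q} t *\<^sub>R f t) \<in> borel_measurable lborel" for q
      proof -
        have "set_integrable lborel {p<..q} f"
          by (rule set_integrable_subset[OF f_int]) auto
        then show ?thesis
          unfolding set_integrable_def by (rule borel_measurable_integrable)
      qed
      show "\<forall>\<^sub>F q in at_top. AE t in lborel. norm (indicator {p<..q} t *\<^sub>R f t) \<le> norm (indicator {p<..} t *\<^sub>R f t)"
        by (intro always_eventually allI AE_I2) (auto simp: indicator_def)
      show "AE t in lborel. ((\<lambda>q. indicator {p<..q} t *\<^sub>R f t) \<longlongrightarrow> indicator {p<..} t *\<^sub>R f t) at_top"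
      proof (rule AE_I2)
        fix t
        have "\<forall>\<^sub>F q in at_top. indicator {p<..q} t *\<^sub>R f t = indicator {p<..} t *\<^sub>R f t"
          using eventually_ge_at_top[of t] by eventually_elim (auto simp: indicator_def)
        then show "((\<lambda>q. indicator {p<..q} t *\<^sub>R f t) \<longlongrightarrow> indicator {p<..} t *\<^sub>R f t) at_top"
          by (rule tendsto_eventually)
      qed
    qed
    then have "norm (LINT t:{p<..}|lborel. f t) \<le> 2 * (norm (b p) + J) / \<bar>s\<bar>"
      by (rule Lim_norm_ubound[OF trivial_limit_at_top_linorder])
        (rule eventually_mono[OF eventually_gt_at_top[of p]], rule le)
    then show ?thesis
      by (simp only: eqs)
  qed
  then show "\<exists>V. \<forall>s. s \<noteq> 0 \<longrightarrow> norm (LINT t:{p<..}|lborel. exp (\<i> * of_real (s * t)) * half_line_deriv a t) \<le> V / \<bar>s\<bar>"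
    by blast
qed

text \<open>Downward induction over the break points: starting from the unbounded tail, one bounded
  piece is attached on the left at a time and the oscillation constants add up. For the existence of
  the derivative the same induction locates the piece containing t.\<close>

theorem piecewise_C2_symbol:
  assumes pw: "piecewise_C2_half_line a" and a: "integrable half_line a"
    and a2: "integrable half_line (half_line_deriv (half_line_deriv a))"
  shows "\<exists>S V B \<delta>. finite S \<and> (\<forall>t>0. t \<notin> S \<longrightarrow> (a has_vector_derivative half_line_deriv a t) (at t)) \<and>
    integrable half_line (half_line_deriv a) \<and> \<delta> > 0 \<and> (\<forall>t>0. t < \<delta> \<longrightarrow> norm (half_line_deriv a t) \<le> B) \<and>
    (\<forall>s. s \<noteq> 0 \<longrightarrow> norm (LINT t|half_line. exp (\<i> * of_real (s * t)) * half_line_deriv a t) \<le> V / \<bar>s\<bar>)"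
proof -
  obtain N \<tau> where \<tau>: "\<tau> 0 = 0" "\<And>i. i < N \<Longrightarrow> \<tau> i < \<tau> (Suc i)"
    "\<And>i. i < N \<Longrightarrow> C2_on {\<tau> i..\<tau> (Suc i)} a" "C2_on {\<tau> N..} a"
    using pw unfolding piecewise_C2_half_line_def by blast
  have \<tau>_nonneg: "i \<le> N \<Longrightarrow> 0 \<le> \<tau> i" for i
  proof (induction i)
    case (Suc i)
    then show ?case
      using \<tau>(2)[of i] by simp
  qed (simp add: \<tau>)
  have der: "(a has_vector_derivative half_line_deriv a t) (at t)" if "t \<in> interior I" "C2_on I a" "interior I \<subseteq> {0<..}" for I t
    using C2_on_half_line_deriv[OF that(2,3)] that(1) by metis
  have "(a has_vector_derivative half_line_deriv a t) (at t)" if "t > \<tau> i" "t \<notin> \<tau> ` {..N}" "i \<le> N" for i t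
    using that(3,1)
  proof (induction rule: inc_induct)
    case base
    have "interior {\<tau> N..} = {\<tau> N<..}"
      by (rule interior_Ici[of "\<tau> N - 1"]) auto
    then show ?case
      using \<tau>_nonneg[of N] base \<tau>(4) by (intro der[of t "{\<tau> N..}"]) auto
  next
    case (step n)
    show ?case
    proof (cases "t > \<tau> (Suc n)")
      case False
      then have "t < \<tau> (Suc n)"
        using that(2) step by (metis Suc_leI atMost_iff image_eqI linorder_neqE_linordered_idom)
      then show ?thesis
        using step \<tau>(3)[of n] \<tau>_nonneg[of n]
        by (intro der[of t "{\<tau> n..\<tau> (Suc n)}"]) (auto simp: interior_atLeastAtMost_real)
    qed (use step in auto)
  qed
  from this[of 0] have D: "(a has_vector_derivative half_line_deriv a t) (at t)" if "t > 0" "t \<notin> \<tau> ` {..N}" for t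
    using that \<tau>(1) by auto
  have "set_integrable lborel {\<tau> i<..} (half_line_deriv a) \<and>
    (\<exists>V. \<forall>s. s \<noteq> 0 \<longrightarrow> norm (LINT t:{\<tau> i<..}|lborel. exp (\<i> * of_real (s * t)) * half_line_deriv a t) \<le> V / \<bar>s\<bar>)"
    if "i \<le> N" for i
    using that
  proof (induction rule: inc_induct)
    case base
    show ?case
      using oscillatory_integral_C2_tail[OF \<tau>(4) \<tau>_nonneg a a2] by simp
  next
    case (step n)
    let ?a1 = "half_line_deriv a"
    let ?f = "\<lambda>s t. exp (\<i> * of_real (s * t)) * ?a1 t"
    have n: "\<tau> n < \<tau> (Suc n)" "0 \<le> \<tau> n"
      using \<tau>(2)[of n] \<tau>_nonneg[of n] step by auto
    have un: "{\<tau> n<..} = {\<tau> n<..\<tau> (Suc n)} \<union> {\<tau> (Suc n)<..}"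
      using n by auto
    note piece = oscillatory_integral_C2_piece[OF \<tau>(3)[OF step(2)] n(2,1)]
    obtain V W where V: "\<And>s. s \<noteq> 0 \<Longrightarrow> norm (LINT t:{\<tau> (Suc n)<..}|lborel. ?f s t) \<le> V / \<bar>s\<bar>"
      and W: "\<And>s. s \<noteq> 0 \<Longrightarrow> norm (LINT t:{\<tau> n<..\<tau> (Suc n)}|lborel. ?f s t) \<le> W / \<bar>s\<bar>"
      using step.IH piece(2) by auto
    have osc: "set_integrable lborel A (?f s)" if A: "set_integrable lborel A ?a1" "A \<in> sets borel" for A s
      using A(1)
    proof (rule set_integrable_bound)
      have "(\<lambda>t. exp (\<i> * of_real (s * t)) * (indicator A t *\<^sub>R ?a1 t)) \<in> borel_measurable lborel"
        using A(1) unfolding set_integrable_def by measurable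
      then show "set_borel_measurable lborel A (?f s)"
        unfolding set_borel_measurable_def by (simp add: mult.left_commute scaleR_conv_of_real)
    qed (auto simp: norm_mult)
    have "norm (LINT t:{\<tau> n<..}|lborel. ?f s t) \<le> (V + W) / \<bar>s\<bar>" if s: "s \<noteq> 0" for s
    proof -
      have "(LINT t:{\<tau> n<..}|lborel. ?f s t)
          = (LINT t:{\<tau> n<..\<tau> (Suc n)}|lborel. ?f s t) + (LINT t:{\<tau> (Suc n)<..}|lborel. ?f s t)"
        unfolding un using step.IH piece(1) by (intro set_integral_Un osc) auto
      also have "norm \<dots> \<le> W / \<bar>s\<bar> + V / \<bar>s\<bar>"
        using norm_triangle_le[OF add_mono[OF W[OF s] V[OF s]]] .
      finally show ?thesis
        by (simp add: add_divide_distrib)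
    qed
    moreover have "set_integrable lborel {\<tau> n<..} ?a1"
      unfolding un using step.IH piece(1) by (intro set_integrable_Un) auto
    ultimately show ?case by blast
  qed
  from this[of 0] obtain V where a1: "integrable half_line (half_line_deriv a)"
    and V: "\<And>s. s \<noteq> 0 \<Longrightarrow> norm (LINT t|half_line. exp (\<i> * of_real (s * t)) * half_line_deriv a t) \<le> V / \<bar>s\<bar>"
    by (auto simp: \<tau>(1) half_line_integrable_iff half_line_integral_eq)
  \<comment> \<open>The first positive break point, or 1 if there is none: up to it the derivative
    extends continuously and is therefore bounded.\<close>
  define \<delta> where "\<delta> = (if N = 0 then 1 else \<tau> 1)"
  have \<delta>: "\<delta> > 0"
    using \<tau>(1) \<tau>(2)[of 0] by (auto simp: \<delta>_def)
  have "C2_on {0..\<delta>} a"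
  proof (cases "N = 0")
    case True
    then show ?thesis
      using \<tau> by (auto intro: C2_on_subset)
  next
    case False
    then show ?thesis
      using \<tau>(1) \<tau>(3)[of 0] by (auto simp: \<delta>_def)
  qed
  then obtain B where "\<And>t. 0 < t \<Longrightarrow> t < \<delta> \<Longrightarrow> norm (half_line_deriv a t) \<le> B"
    using oscillatory_integral_C2_piece(3)[of 0 \<delta> a] \<delta> by auto
  then show ?thesis
    using D a1 \<delta> V by (intro exI[of _ "\<tau> ` {..N}"] exI[of _ V] exI[of _ B] exI[of _ \<delta>]) auto
qed

section \<open>Estimates for the difference of the kernels\<close>

text \<open>The piecewise structure of the symbol is forgotten here; the kernel estimates work from
  these consequences alone, with \<open>a1\<close> standing for the derivative off the finite set
  \<open>S\<close>.\<close>

locale bessel_symbol = bessel_pair \<nu> K \<Theta> u v \<kappa>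
  for \<nu> K :: real and \<Theta> :: complex and u v \<kappa> +
  fixes a a1 :: "real \<Rightarrow> complex" and S :: "real set" and V B \<delta> :: real
  assumes S: "finite S" and deriv_a: "\<And>t. t > 0 \<Longrightarrow> t \<notin> S \<Longrightarrow> (a has_vector_derivative a1 t) (at t)"
    and cont_a: "continuous_on {0..} a" and lim_a: "(a \<longlongrightarrow> 0) at_top"
    and int_a: "integrable half_line a" and int_a1: "integrable half_line a1" and delta: "\<delta> > 0"
    and bound_a: "\<And>t. 0 < t \<Longrightarrow> t < \<delta> \<Longrightarrow> norm (a t) \<le> B"
    and bound_a1: "\<And>t. 0 < t \<Longrightarrow> t < \<delta> \<Longrightarrow> norm (a1 t) \<le> B"
    and osc_a1: "\<And>s. s \<noteq> 0 \<Longrightarrow> norm (LINT t|half_line. exp (\<i> * of_real (s * t)) * a1 t) \<le> V / \<bar>s\<bar>"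
begin

section \<open>Integration by parts and oscillatory integrals against the symbol\<close>

lemma cont_a_pos: "continuous_on {0<..} a"
  using cont_a by (rule continuous_on_subset) auto

lemma a_at_zero: "(a \<longlongrightarrow> a 0) (at_right 0)"
proof -
  have "(a \<longlongrightarrow> a 0) (at 0 within {0..})"
    using cont_a unfolding continuous_on_def by auto
  then show ?thesis
    by (rule tendsto_within_subset) auto
qed

lemma half_line_measurable:
  fixes f :: "real \<Rightarrow> 'b::topological_space"
  shows "f \<in> borel_measurable borel \<Longrightarrow> f \<in> borel_measurable half_line"
  by (rule measurable_restrict_space1) simp

lemma meas_mult:
  assumes "f \<in> borel_measurable borel"
  shows "(\<lambda>t. of_real (f t) * a t) \<in> borel_measurable half_line"
    and "(\<lambda>t. of_real (f t) * a1 t) \<in> borel_measurable half_line"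
proof -
  have m: "(\<lambda>t. complex_of_real (f t)) \<in> borel_measurable half_line"
    using assms by (intro half_line_measurable) measurable
  show "(\<lambda>t. of_real (f t) * a t) \<in> borel_measurable half_line"
    using m borel_measurable_integrable[OF int_a] by (rule borel_measurable_times)
  show "(\<lambda>t. of_real (f t) * a1 t) \<in> borel_measurable half_line"
    using m borel_measurable_integrable[OF int_a1] by (rule borel_measurable_times)
qed

lemma int_exp:
  "integrable half_line (\<lambda>t. exp (\<i> * of_real (s * t)) * a t)"
  "integrable half_line (\<lambda>t. exp (\<i> * of_real (s * t)) * a1 t)"
proof -
  have m: "(\<lambda>t. exp (\<i> * complex_of_real (s * t))) \<in> borel_measurable half_line"
    by (rule half_line_measurable) measurable
  show "integrable half_line (\<lambda>t. exp (\<i> * of_real (s * t)) * a t)"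
    using int_a m by (intro half_line_integrable_bound[OF integrable_norm[OF int_a]]) (auto simp: norm_mult)
  show "integrable half_line (\<lambda>t. exp (\<i> * of_real (s * t)) * a1 t)"
    using int_a1 m by (intro half_line_integrable_bound[OF integrable_norm[OF int_a1]]) (auto simp: norm_mult)
qed

text \<open>The constant in \<open>osc_a\<close>: the boundary term at 0 plus the total variation of
  the symbol.\<close>

definition V0 :: real where
  "V0 = norm (a 0) + (LINT t|half_line. norm (a1 t))"

text \<open>Continuity of \<open>a\<close> excludes jump terms at the break points, and its decay
  kills the boundary term at infinity for bounded \<open>F\<close>. Only the contribution of 0
  remains.\<close>

lemma integration_by_parts_symbol:
  fixes F f :: "real \<Rightarrow> complex"
  assumes F: "\<And>t. t > 0 \<Longrightarrow> (F has_vector_derivative f t) (at t)"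
    and int: "integrable half_line (\<lambda>t. f t * a t)" "integrable half_line (\<lambda>t. F t * a1 t)"
    and F0: "(F \<longlongrightarrow> F0) (at_right 0)" and Fb: "\<And>t. t > 1 \<Longrightarrow> norm (F t) \<le> C"
  shows "(LINT t|half_line. f t * a t) = - (F0 * a 0) - (LINT t|half_line. F t * a1 t)"
proof -
  have "(LINT t|half_line. F t * a1 t + f t * a t) = 0 - F0 * a 0"
  proof (rule fundamental_theorem_half_line[OF S])
    show "((\<lambda>t. F t * a t) has_vector_derivative F t * a1 t + f t * a t) (at t)" if "t > 0" "t \<notin> S" for t
      using that by (intro has_vector_derivative_mult F deriv_a)
    have "continuous_on {0<..} F"
      by (intro continuous_at_imp_continuous_on ballI has_vector_derivative_continuous[OF F]) auto
    then show "continuous_on {0<..} (\<lambda>t. F t * a t)"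
      by (intro continuous_on_mult cont_a_pos)
    show "integrable half_line (\<lambda>t. F t * a1 t + f t * a t)"
      using int(2,1) by (rule Bochner_Integration.integrable_add)
    show "((\<lambda>t. F t * a t) \<longlongrightarrow> F0 * a 0) (at_right 0)"
      by (intro tendsto_mult F0 a_at_zero)
    show "((\<lambda>t. F t * a t) \<longlongrightarrow> 0) at_top"
    proof (rule Lim_null_comparison)
      show "\<forall>\<^sub>F t in at_top. norm (F t * a t) \<le> C * norm (a t)"
        using eventually_gt_at_top[of 1] by eventually_elim (auto simp: norm_mult intro!: mult_right_mono Fb)
      show "((\<lambda>t. C * norm (a t)) \<longlongrightarrow> 0) at_top"
        using tendsto_mult_left[OF tendsto_norm_zero[OF lim_a], of C] by simp
    qed
  qed
  then have "(LINT t|half_line. F t * a1 t) + (LINT t|half_line. f t * a t) = 0 - F0 * a 0"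
    using Bochner_Integration.integral_add[OF int(2,1)] by simp
  moreover have "y = - z - x" if "x + y = 0 - z" for x y z :: complex
  proof -
    have "y = (x + y) - x" by simp
    then show ?thesis unfolding that by simp
  qed
  ultimately show ?thesis by blast
qed

lemma osc_a:
  assumes "s \<noteq> 0"
  shows "norm (LINT t|half_line. exp (\<i> * of_real (s * t)) * a t) \<le> V0 / \<bar>s\<bar>"
proof -
  have "(LINT t|half_line. (\<i> * of_real s * exp (\<i> * of_real s * of_real t)) * a t)
      = - (1 * a 0) - (LINT t|half_line. exp (\<i> * of_real s * of_real t) * a1 t)"
  proof (rule integration_by_parts_symbol)
    show "integrable half_line (\<lambda>t. (\<i> * of_real s * exp (\<i> * of_real s * of_real t)) * a t)"
      using integrable_mult_right[OF int_exp(1)[of s], of "\<i> * of_real s"] by (simp add: mult_ac)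
    show "integrable half_line (\<lambda>t. exp (\<i> * of_real s * of_real t) * a1 t)"
      using int_exp(2)[of s] by (simp add: mult_ac)
    have "((\<lambda>t. exp (\<i> * of_real s * of_real t)) \<longlongrightarrow> exp (\<i> * of_real s * of_real 0)) (at_right 0)"
      by (intro tendsto_intros)
    then show "((\<lambda>t. exp (\<i> * of_real s * of_real t)) \<longlongrightarrow> 1) (at_right 0)"
      by simp
    show "norm (exp (\<i> * of_real s * of_real t)) \<le> 1" for t
      by (simp add: norm_exp_eq_Re)
  qed (rule has_vector_derivative_exp_of_real)
  then have eq: "(\<i> * of_real s) * (LINT t|half_line. exp (\<i> * of_real (s * t)) * a t)
      = - a 0 - (LINT t|half_line. exp (\<i> * of_real (s * t)) * a1 t)"
    by (simp add: mult.assoc)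
  have "\<bar>s\<bar> * norm (LINT t|half_line. exp (\<i> * of_real (s * t)) * a t)
      = norm (a 0 + (LINT t|half_line. exp (\<i> * of_real (s * t)) * a1 t))"
  proof -
    have "norm (- x - y) = norm (x + y)" for x y :: complex
      using norm_minus_cancel[of "x + y"] by simp
    then show ?thesis
      using arg_cong[OF eq, of norm] by (simp add: norm_mult)
  qed
  also have "\<dots> \<le> norm (a 0) + norm (LINT t|half_line. exp (\<i> * of_real (s * t)) * a1 t)"
    by (rule norm_triangle_ineq)
  also have "norm (LINT t|half_line. exp (\<i> * of_real (s * t)) * a1 t) \<le> (LINT t|half_line. norm (a1 t))"
    by (rule half_line_integral_norm_le[OF integrable_norm[OF int_a1]]) (simp add: norm_mult)
  finally show ?thesis
    using assms by (simp add: V0_def field_simps)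
qed

text \<open>As \<open>f\<close> is complex, the real part cannot be moved outside the integral.
  Instead it is written as half the sum of z and its conjugate, which reduces the claim to the
  frequencies s and -s; the imaginary part is analogous.\<close>

lemma osc_Re_Im:
  fixes f :: "real \<Rightarrow> complex"
  assumes int: "\<And>s. integrable half_line (\<lambda>t. exp (\<i> * of_real (s * t)) * f t)"
    and osc: "\<And>s. s \<noteq> 0 \<Longrightarrow> norm (LINT t|half_line. exp (\<i> * of_real (s * t)) * f t) \<le> W / \<bar>s\<bar>"
    and s: "s > 0"
  shows "norm (LINT t|half_line. of_real (Re (exp (\<i> * of_real (s * t)) * c)) * f t) \<le> norm c * W / s"
    and "norm (LINT t|half_line. of_real (Im (exp (\<i> * of_real (s * t)) * c)) * f t) \<le> norm c * W / s"
    and "integrable half_line (\<lambda>t. of_real (Re (exp (\<i> * of_real (s * t)) * c)) * f t)"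
    and "integrable half_line (\<lambda>t. of_real (Im (exp (\<i> * of_real (s * t)) * c)) * f t)"
proof -
  let ?I = "\<lambda>s. LINT t|half_line. exp (\<i> * of_real (s * t)) * f t"
  have cnj: "cnj (exp (\<i> * of_real (s * t)) * c) = exp (\<i> * of_real (- s * t)) * cnj c" for t
    by (simp add: exp_cnj)
  have i1: "integrable half_line (\<lambda>t. (d * c) * (exp (\<i> * of_real (s * t)) * f t))" for d
    by (intro integrable_mult_right int)
  have i2: "integrable half_line (\<lambda>t. (d * cnj c) * (exp (\<i> * of_real (- s * t)) * f t))" for d
    by (intro integrable_mult_right int)
  have Re: "of_real (Re (exp (\<i> * of_real (s * t)) * c)) * f t
      = (1 / 2 * c) * (exp (\<i> * of_real (s * t)) * f t) + (1 / 2 * cnj c) * (exp (\<i> * of_real (- s * t)) * f t)" for t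
  proof -
    have "complex_of_real (Re z) = 1 / 2 * z + 1 / 2 * cnj z" for z
      by (simp add: complex_eq_iff)
    from this[of "exp (\<i> * of_real (s * t)) * c", unfolded cnj] show ?thesis
      by (simp only: distrib_left mult_ac)
  qed
  have Im: "of_real (Im (exp (\<i> * of_real (s * t)) * c)) * f t
      = (- \<i> / 2 * c) * (exp (\<i> * of_real (s * t)) * f t) + (\<i> / 2 * cnj c) * (exp (\<i> * of_real (- s * t)) * f t)" for t
  proof -
    have "complex_of_real (Im z) = - \<i> / 2 * z + \<i> / 2 * cnj z" for z
      by (simp add: complex_eq_iff)
    from this[of "exp (\<i> * of_real (s * t)) * c", unfolded cnj] show ?thesis
      by (simp only: distrib_left mult_ac)
  qed
  show "integrable half_line (\<lambda>t. of_real (Re (exp (\<i> * of_real (s * t)) * c)) * f t)"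
    unfolding Re by (intro Bochner_Integration.integrable_add i1 i2)
  show "integrable half_line (\<lambda>t. of_real (Im (exp (\<i> * of_real (s * t)) * c)) * f t)"
    unfolding Im by (intro Bochner_Integration.integrable_add i1 i2)
  have bound: "norm ((d * c) * ?I s + (d' * cnj c) * ?I (- s)) \<le> norm c * W / s"
    if "norm d = 1 / 2" "norm d' = 1 / 2" for d d'
  proof -
    have "norm ((d * c) * ?I s + (d' * cnj c) * ?I (- s)) \<le> norm ((d * c) * ?I s) + norm ((d' * cnj c) * ?I (- s))"
      by (rule norm_triangle_ineq)
    also have "\<dots> = norm c / 2 * norm (?I s) + norm c / 2 * norm (?I (- s))"
      using that by (simp only: norm_mult complex_mod_cnj)
    also have "\<dots> \<le> norm c / 2 * (W / s) + norm c / 2 * (W / s)"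
      using osc[of s] osc[of "- s"] s by (intro add_mono mult_left_mono) auto
    also have "\<dots> = norm c * W / s"
      by (simp add: field_simps)
    finally show ?thesis .
  qed
  show "norm (LINT t|half_line. of_real (Re (exp (\<i> * of_real (s * t)) * c)) * f t) \<le> norm c * W / s"
    unfolding Re Bochner_Integration.integral_add[OF i1 i2] integral_mult_right_zero
    by (rule bound) (simp_all add: norm_divide)
  show "norm (LINT t|half_line. of_real (Im (exp (\<i> * of_real (s * t)) * c)) * f t) \<le> norm c * W / s"
    unfolding Im Bochner_Integration.integral_add[OF i1 i2] integral_mult_right_zero
    by (rule bound) (simp_all add: norm_divide)
qed

text \<open>
  \<open>\<beta>\<close> is the order of the singularity of \<open>u\<close> at \<open>0\<close>. The decay rate \<open>\<theta>\<close> of the errors has to satisfy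
  \<open>\<theta> > 1/2\<close>, so that the squared bounds are integrable at infinity, and \<open>\<theta> + \<beta> < 1\<close>, so that the
  weights are integrable at \<open>0\<close>.
\<close>

definition \<beta> :: real where "\<beta> = max 0 (- \<kappa>)"
definition \<theta> :: real where "\<theta> = 3 / 4 - \<beta> / 2"
definition \<psi> :: "real \<Rightarrow> real" where "\<psi> t = 1 + t powr (- \<beta>)"
definition M :: real where "M = K + norm \<Theta>"
definition cf :: "real \<Rightarrow> real" where "cf z = Re (exp (\<i> * of_real z) * \<Theta>)"
definition sf :: "real \<Rightarrow> real" where "sf z = Im (exp (\<i> * of_real z) * \<Theta>)"

section \<open>Weights and pointwise bounds for u, v and their leading terms\<close>

lemma beta: "0 \<le> \<beta>" "\<beta> < 1 / 2" "- \<beta> \<le> \<kappa>"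
  using kappa by (auto simp: \<beta>_def)

lemma theta: "1 / 2 < \<theta>" "\<theta> \<le> 3 / 4" "\<beta> \<le> \<theta>" "\<theta> + \<beta> < 1"
  using beta by (auto simp: \<theta>_def)

lemma M_nonneg: "0 \<le> M" "K \<le> M" "norm \<Theta> \<le> M"
  using K_nonneg by (auto simp: M_def)

lemma psi_pos: "1 \<le> \<psi> t"
  by (simp add: \<psi>_def)

text \<open>Submultiplicativity separates the variables: bounds on u(xt) split into a factor in x
  and a weight in t that can be integrated against the symbol.\<close>

lemma psi_mult:
  assumes "x > 0" "t > 0"
  shows "\<psi> (x * t) \<le> \<psi> x * \<psi> t"
  using assms by (simp add: \<psi>_def powr_mult algebra_simps)

lemma psi_mono:
  assumes "0 < x" "x \<le> y"
  shows "\<psi> y \<le> \<psi> x"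
  using assms beta by (simp add: \<psi>_def powr_mono2')

lemma cf_sf_bound: "\<bar>cf z\<bar> \<le> M" "\<bar>sf z\<bar> \<le> M"
  using abs_Re_le_cmod[of "exp (\<i> * of_real z) * \<Theta>"] abs_Im_le_cmod[of "exp (\<i> * of_real z) * \<Theta>"] M_nonneg
  by (auto simp: cf_def sf_def norm_mult)

lemma powr_ge_one:
  assumes "0 < z" "z \<le> 1" "p \<ge> (0::real)"
  shows "1 \<le> z powr (- p)"
  using powr_mono2'[of "- p" z 1] assms by simp

lemma u_bound:
  assumes "z > 0"
  shows "\<bar>u z\<bar> \<le> M * \<psi> z"
proof (cases "z \<le> 1")
  case True
  have "z powr \<kappa> \<le> z powr (- \<beta>)"
    using True assms beta by (intro powr_mono') auto
  then have "z powr \<kappa> \<le> \<psi> z"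
    by (simp add: \<psi>_def)
  then have "K * z powr \<kappa> \<le> M * \<psi> z"
    using M_nonneg by (intro mult_mono) auto
  then show ?thesis
    using near(1)[OF assms True] by linarith
next
  case False
  have "K * 1 \<le> M * \<psi> z"
    using M_nonneg psi_pos by (intro mult_mono) auto
  then show ?thesis
    using far(1)[of z] False by simp
qed

lemma v_bound:
  assumes "z > 0"
  shows "\<bar>v z\<bar> \<le> M"
proof (cases "z \<le> 1")
  case True
  have "z powr (\<kappa> + 1) \<le> 1"
    using True assms kappa by (intro powr_le1) auto
  then have "K * z powr (\<kappa> + 1) \<le> M * 1"
    using M_nonneg by (intro mult_mono) auto
  then show ?thesis
    using near(2)[OF assms True] by linarith
next
  case False
  then show ?thesis
    using far(2)[of z] M_nonneg by simp
qed

text \<open>\<open>cf\<close> and \<open>sf\<close> are the leading terms of u and v. For z > 1 the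
  true error 1/z is weakened to z^(-\<theta>). For z \<le> 1 nothing is compared: u, v and the
  leading terms are bounded separately, which works because the singularity of u has order \<beta>
  \<le> \<theta>.\<close>

lemma error_bound:
  assumes "z > 0"
  shows "\<bar>u z - cf z\<bar> \<le> M * z powr (- \<theta>)" "\<bar>v z - sf z\<bar> \<le> M * z powr (- \<theta>)"
proof -
  have "\<bar>u z - cf z\<bar> \<le> M * z powr (- \<theta>) \<and> \<bar>v z - sf z\<bar> \<le> M * z powr (- \<theta>)"
  proof (cases "z \<le> 1")
    case True
    have p: "z powr \<kappa> \<le> z powr (- \<theta>)" "z powr (\<kappa> + 1) \<le> z powr (- \<theta>)" "1 \<le> z powr (- \<theta>)"
      using True assms beta theta by (auto intro!: powr_mono' powr_ge_one)
    have "K * z powr \<kappa> \<le> K * z powr (- \<theta>)" "K * z powr (\<kappa> + 1) \<le> K * z powr (- \<theta>)"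
      using p K_nonneg by (auto intro!: mult_left_mono)
    moreover have "norm \<Theta> * 1 \<le> norm \<Theta> * z powr (- \<theta>)"
      using p by (intro mult_left_mono) auto
    moreover have "\<bar>cf z\<bar> \<le> norm \<Theta>" "\<bar>sf z\<bar> \<le> norm \<Theta>"
      using abs_Re_le_cmod[of "exp (\<i> * of_real z) * \<Theta>"] abs_Im_le_cmod[of "exp (\<i> * of_real z) * \<Theta>"]
      by (auto simp: cf_def sf_def norm_mult)
    moreover have "M * z powr (- \<theta>) = K * z powr (- \<theta>) + norm \<Theta> * z powr (- \<theta>)"
      by (simp add: M_def algebra_simps)
    ultimately show ?thesis
      using near[OF assms True] by linarith
  next
    case False
    then have "norm (Complex (u z) (v z) - exp (\<i> * of_real z) * \<Theta>) \<le> K / z"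
      by (intro asym) simp
    also have "K / z \<le> M * z powr (- \<theta>)"
    proof -
      have "K / z = K * z powr (- 1)"
        using assms by (simp add: powr_minus_divide)
      also have "\<dots> \<le> M * z powr (- \<theta>)"
        using False theta M_nonneg by (intro mult_mono powr_mono) auto
      finally show ?thesis .
    qed
    finally show ?thesis
      using abs_Re_le_cmod[of "Complex (u z) (v z) - exp (\<i> * of_real z) * \<Theta>"]
        abs_Im_le_cmod[of "Complex (u z) (v z) - exp (\<i> * of_real z) * \<Theta>"]
      by (simp add: cf_def sf_def)
  qed
  then show "\<bar>u z - cf z\<bar> \<le> M * z powr (- \<theta>)" "\<bar>v z - sf z\<bar> \<le> M * z powr (- \<theta>)"
    by auto
qed

lemma weighted_integrable:
  assumes "0 \<le> \<gamma>" "\<gamma> < 1"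
  shows "integrable half_line (\<lambda>t. t powr (- \<gamma>) * norm (a t))"
    and "integrable half_line (\<lambda>t. t powr (- \<gamma>) * norm (a1 t))"
  using half_line_integrable_powr_weight[OF int_a bound_a delta assms]
    half_line_integrable_powr_weight[OF int_a1 bound_a1 delta assms] by auto

text \<open>Expanding \<psi> leaves pure powers whose singularity at 0 has order at most 2\<beta> or
  \<theta> + \<beta>, both below 1.\<close>

lemma psi_weights_integrable:
  "integrable half_line (\<lambda>t. (\<psi> t * \<psi> t) * norm (a t))"
  "integrable half_line (\<lambda>t. \<psi> t * norm (a1 t))"
  "integrable half_line (\<lambda>t. (t powr (- \<theta>) * \<psi> t) * norm (a t))"
  "integrable half_line (\<lambda>t. (t powr (- \<theta>) * \<psi> t) * norm (a1 t))"
proof -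
  have i: "integrable half_line (\<lambda>t. norm (a t))" "integrable half_line (\<lambda>t. norm (a1 t))"
    using int_a int_a1 by auto
  have sq: "(\<psi> t * \<psi> t) * x = x + 2 * (t powr (- \<beta>) * x) + t powr (- (2 * \<beta>)) * x" for t x
  proof -
    have "t powr (- (2 * \<beta>)) = t powr (- \<beta>) * t powr (- \<beta>)"
      by (simp flip: powr_add)
    then show ?thesis by (simp add: \<psi>_def algebra_simps)
  qed
  have th: "(t powr (- \<theta>) * \<psi> t) * x = t powr (- \<theta>) * x + t powr (- (\<theta> + \<beta>)) * x" for t x
  proof -
    have "t powr (- (\<theta> + \<beta>)) = t powr (- \<theta>) * t powr (- \<beta>)"
      by (simp flip: powr_add)
    then show ?thesis by (simp add: \<psi>_def algebra_simps)
  qed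
  have one: "\<psi> t * x = x + t powr (- \<beta>) * x" for t x
    by (simp add: \<psi>_def algebra_simps)
  show "integrable half_line (\<lambda>t. (\<psi> t * \<psi> t) * norm (a t))"
    unfolding sq using beta by (intro Bochner_Integration.integrable_add integrable_mult_right weighted_integrable i) auto
  show "integrable half_line (\<lambda>t. \<psi> t * norm (a1 t))"
    unfolding one using beta by (intro Bochner_Integration.integrable_add weighted_integrable i) auto
  show "integrable half_line (\<lambda>t. (t powr (- \<theta>) * \<psi> t) * norm (a t))"
    unfolding th using theta beta by (intro Bochner_Integration.integrable_add weighted_integrable) auto
  show "integrable half_line (\<lambda>t. (t powr (- \<theta>) * \<psi> t) * norm (a1 t))"
    unfolding th using theta beta by (intro Bochner_Integration.integrable_add weighted_integrable) auto
qed

definition kB :: "real \<Rightarrow> real \<Rightarrow> complex" where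
  "kB x y = (LINT t|half_line. of_real (u (x * t) * u (y * t)) * a t)"

text \<open>The Wiener-Hopf kernel of the even extension as a function of the difference of the
  variables, with the Fourier integral folded to a cosine integral on the half-line.\<close>

definition kW :: "real \<Rightarrow> complex" where
  "kW s = of_real (1 / pi) * (LINT t|half_line. of_real (cos (s * t)) * a t)"

definition L :: "real \<Rightarrow> real \<Rightarrow> real \<Rightarrow> real" where
  "L x y t = x * v (x * t) * u (y * t) - y * u (x * t) * v (y * t)"

lemma uu_bound:
  assumes "x > 0" "y > 0" "t > 0"
  shows "\<bar>u (x * t) * u (y * t)\<bar> \<le> M\<^sup>2 * \<psi> x * \<psi> y * (\<psi> t * \<psi> t)"
proof -
  have "\<bar>u (x * t)\<bar> \<le> M * (\<psi> x * \<psi> t)" "\<bar>u (y * t)\<bar> \<le> M * (\<psi> y * \<psi> t)"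
    using u_bound[of "x * t"] u_bound[of "y * t"] psi_mult[of x t] psi_mult[of y t] assms M_nonneg(1)
    by (auto intro: order_trans mult_left_mono)
  then have "\<bar>u (x * t)\<bar> * \<bar>u (y * t)\<bar> \<le> (M * (\<psi> x * \<psi> t)) * (M * (\<psi> y * \<psi> t))"
    by (intro mult_mono) (auto intro: order_trans[OF abs_ge_zero])
  then show ?thesis
    by (simp add: abs_mult power2_eq_square mult_ac)
qed

lemma uu_integrable:
  assumes "x > 0" "y > 0"
  shows "integrable half_line (\<lambda>t. of_real (u (x * t) * u (y * t)) * a t)"
proof (rule half_line_integrable_bound)
  show "integrable half_line (\<lambda>t. M\<^sup>2 * \<psi> x * \<psi> y * ((\<psi> t * \<psi> t) * norm (a t)))"
    by (intro integrable_mult_right psi_weights_integrable)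
  show "(\<lambda>t. of_real (u (x * t) * u (y * t)) * a t) \<in> borel_measurable half_line"
    by (rule meas_mult) measurable
  show "norm (of_real (u (x * t) * u (y * t)) * a t) \<le> M\<^sup>2 * \<psi> x * \<psi> y * ((\<psi> t * \<psi> t) * norm (a t))" if "t > 0" for t
    using mult_right_mono[OF uu_bound[OF assms that], of "norm (a t)"] by (simp add: norm_mult mult_ac abs_mult)
qed

lemma kB_bound:
  obtains C where "C \<ge> 0" "\<And>x y. x > 0 \<Longrightarrow> y > 0 \<Longrightarrow> norm (kB x y) \<le> C * \<psi> x * \<psi> y"
proof
  let ?I = "LINT t|half_line. (\<psi> t * \<psi> t) * norm (a t)"
  show "0 \<le> M\<^sup>2 * ?I"
    using psi_pos by (intro mult_nonneg_nonneg integral_nonneg) (auto simp: order_trans[OF zero_le_one])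
  fix x y :: real assume xy: "x > 0" "y > 0"
  have "norm (kB x y) \<le> (LINT t|half_line. M\<^sup>2 * \<psi> x * \<psi> y * ((\<psi> t * \<psi> t) * norm (a t)))"
    unfolding kB_def
  proof (rule half_line_integral_norm_le)
    show "integrable half_line (\<lambda>t. M\<^sup>2 * \<psi> x * \<psi> y * ((\<psi> t * \<psi> t) * norm (a t)))"
      by (intro integrable_mult_right psi_weights_integrable)
    show "norm (of_real (u (x * t) * u (y * t)) * a t) \<le> M\<^sup>2 * \<psi> x * \<psi> y * ((\<psi> t * \<psi> t) * norm (a t))" if "t > 0" for t
      using mult_right_mono[OF uu_bound[OF xy that], of "norm (a t)"] by (simp add: norm_mult mult_ac abs_mult)
  qed
  also have "\<dots> = M\<^sup>2 * ?I * \<psi> x * \<psi> y"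
    by (subst integral_mult_right_zero) (simp add: mult_ac)
  finally show "norm (kB x y) \<le> M\<^sup>2 * ?I * \<psi> x * \<psi> y" .
qed

text \<open>Inside each of the two products the terms with \<kappa>/t cancel, and the terms xy v(xt)
  v(yt) cancel between them. What remains are the multiples x^2 and y^2 of u(xt) u(yt).\<close>

lemma L_has_derivative:
  assumes "x > 0" "y > 0" "t > 0"
  shows "(L x y has_real_derivative (x\<^sup>2 - y\<^sup>2) * (u (x * t) * u (y * t))) (at t)"
proof -
  have du: "((\<lambda>t. u (x * t)) has_real_derivative (\<kappa> * u (x * t) / (x * t) - v (x * t)) * x) (at t)" if "x > 0" for x
    by (rule DERIV_chain'[OF _ derivs(1)]) (use that assms in \<open>auto intro!: derivative_eq_intros\<close>)
  have dv: "((\<lambda>t. v (x * t)) has_real_derivative (u (x * t) - \<kappa> * v (x * t) / (x * t)) * x) (at t)" if "x > 0" for x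
    by (rule DERIV_chain'[OF _ derivs(2)]) (use that assms in \<open>auto intro!: derivative_eq_intros\<close>)
  show ?thesis
    unfolding L_def[abs_def]
    by (rule DERIV_cong[OF DERIV_diff[OF DERIV_mult[OF DERIV_cmult[OF dv[OF assms(1)], of x] du[OF assms(2)]]
            DERIV_mult[OF DERIV_cmult[OF du[OF assms(1)], of y] dv[OF assms(2)]]]])
      (use assms in \<open>simp add: field_simps power2_eq_square\<close>)
qed

lemma L_bound:
  assumes "x > 0" "y > 0" "t > 0"
  shows "\<bar>L x y t\<bar> \<le> M\<^sup>2 * (x * \<psi> y + y * \<psi> x) * \<psi> t"
proof -
  have uv: "\<bar>v (x * t)\<bar> * \<bar>u (y * t)\<bar> \<le> M * (M * (\<psi> y * \<psi> t))" if "x > 0" "y > 0" for x y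
  proof (rule mult_mono)
    show "\<bar>v (x * t)\<bar> \<le> M"
      using that assms by (intro v_bound) auto
    have "\<bar>u (y * t)\<bar> \<le> M * \<psi> (y * t)"
      using that assms by (intro u_bound) auto
    also have "\<dots> \<le> M * (\<psi> y * \<psi> t)"
      using that assms M_nonneg psi_mult by (intro mult_left_mono) auto
    finally show "\<bar>u (y * t)\<bar> \<le> M * (\<psi> y * \<psi> t)" .
  qed (use M_nonneg in auto)
  have "\<bar>L x y t\<bar> \<le> x * (\<bar>v (x * t)\<bar> * \<bar>u (y * t)\<bar>) + y * (\<bar>v (y * t)\<bar> * \<bar>u (x * t)\<bar>)"
    unfolding L_def using assms abs_triangle_ineq4[of "x * v (x * t) * u (y * t)" "y * u (x * t) * v (y * t)"]
    by (simp add: abs_mult mult_ac)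
  also have "\<dots> \<le> x * (M * (M * (\<psi> y * \<psi> t))) + y * (M * (M * (\<psi> x * \<psi> t)))"
    using assms by (intro add_mono mult_left_mono uv) auto
  finally show ?thesis
    by (simp add: power2_eq_square algebra_simps)
qed

lemma measurable_L [measurable]: "L x y \<in> borel_measurable borel"
  unfolding L_def[abs_def] by measurable

lemma L_integrable:
  assumes "x > 0" "y > 0"
  shows "integrable half_line (\<lambda>t. of_real (L x y t) * a1 t)"
proof (rule half_line_integrable_bound)
  show "integrable half_line (\<lambda>t. M\<^sup>2 * (x * \<psi> y + y * \<psi> x) * (\<psi> t * norm (a1 t)))"
    by (intro integrable_mult_right psi_weights_integrable)
  show "(\<lambda>t. of_real (L x y t) * a1 t) \<in> borel_measurable half_line"
    by (rule meas_mult) measurable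
  show "norm (of_real (L x y t) * a1 t) \<le> M\<^sup>2 * (x * \<psi> y + y * \<psi> x) * (\<psi> t * norm (a1 t))" if "t > 0" for t
    using mult_right_mono[OF L_bound[OF assms that], of "norm (a1 t)"] by (simp add: norm_mult mult_ac)
qed

text \<open>u may be unbounded at 0, but v is smaller by one order: the products are
  O(t^(2\<kappa>+1)), and 2\<kappa> + 1 > 0 since \<nu> > -1. Hence the integration by parts has no
  boundary term at 0.\<close>

lemma L_at_zero:
  assumes "x > 0" "y > 0"
  shows "(L x y \<longlongrightarrow> 0) (at_right 0)"
proof -
  have lim: "((\<lambda>t. v (x * t) * u (y * t)) \<longlongrightarrow> 0) (at_right 0)" if xy: "x > 0" "y > 0" for x y
  proof (rule Lim_null_comparison)
    show "\<forall>\<^sub>F t in at_right 0. norm (v (x * t) * u (y * t)) \<le> (K * x powr (\<kappa> + 1) * (K * y powr \<kappa>)) * t powr (2 * \<kappa> + 1)"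
      unfolding eventually_at_right_field
    proof (intro exI[of _ "min (1 / x) (1 / y)"] conjI allI impI)
      show "0 < min (1 / x) (1 / y)" using xy by simp
      fix t assume t: "0 < t" "t < min (1 / x) (1 / y)"
      then have "0 < x * t" "x * t \<le> 1" "0 < y * t" "y * t \<le> 1"
        using xy by (auto simp: field_simps)
      then have "\<bar>v (x * t)\<bar> * \<bar>u (y * t)\<bar> \<le> (K * (x * t) powr (\<kappa> + 1)) * (K * (y * t) powr \<kappa>)"
        using K_nonneg by (intro mult_mono near) auto
      moreover have "t powr (2 * \<kappa> + 1) = t powr (\<kappa> + 1) * t powr \<kappa>"
        by (simp flip: powr_add add: add_ac)
      ultimately show "norm (v (x * t) * u (y * t)) \<le> (K * x powr (\<kappa> + 1) * (K * y powr \<kappa>)) * t powr (2 * \<kappa> + 1)"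
        using xy t by (simp add: abs_mult powr_mult mult_ac)
    qed
    have "((\<lambda>t. t powr (2 * \<kappa> + 1)) \<longlongrightarrow> 0) (at_right 0)"
      using kappa by (intro powr_tendsto_0_at_right) simp
    from tendsto_mult_left[OF this] show "((\<lambda>t. (K * x powr (\<kappa> + 1) * (K * y powr \<kappa>)) * t powr (2 * \<kappa> + 1)) \<longlongrightarrow> 0) (at_right 0)"
      by simp
  qed
  have "((\<lambda>t. x * (v (x * t) * u (y * t)) - y * (v (y * t) * u (x * t))) \<longlongrightarrow> x * 0 - y * 0) (at_right 0)"
    using assms by (intro tendsto_diff tendsto_mult_left lim)
  then show ?thesis
    by (simp add: L_def[abs_def] mult_ac)
qed

lemma kB_by_parts:
  assumes "x > 0" "y > 0"
  shows "of_real (x\<^sup>2 - y\<^sup>2) * kB x y = - (LINT t|half_line. of_real (L x y t) * a1 t)"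
proof -
  have "(LINT t|half_line. of_real ((x\<^sup>2 - y\<^sup>2) * (u (x * t) * u (y * t))) * a t)
      = - (0 * a 0) - (LINT t|half_line. of_real (L x y t) * a1 t)"
  proof (rule integration_by_parts_symbol)
    show "((\<lambda>t. complex_of_real (L x y t)) has_vector_derivative of_real ((x\<^sup>2 - y\<^sup>2) * (u (x * t) * u (y * t)))) (at t)"
      if "t > 0" for t
      using L_has_derivative[OF assms that]
      by (intro has_vector_derivative_of_real) (simp add: has_real_derivative_iff_has_vector_derivative)
    show "integrable half_line (\<lambda>t. of_real ((x\<^sup>2 - y\<^sup>2) * (u (x * t) * u (y * t))) * a t)"
      using integrable_mult_right[OF uu_integrable[OF assms], of "of_real (x\<^sup>2 - y\<^sup>2)"] by (simp add: mult_ac)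
    show "integrable half_line (\<lambda>t. of_real (L x y t) * a1 t)"
      by (rule L_integrable[OF assms])
    show "((\<lambda>t. complex_of_real (L x y t)) \<longlongrightarrow> 0) (at_right 0)"
      using tendsto_of_real[OF L_at_zero[OF assms]] by simp
    show "norm (complex_of_real (L x y t)) \<le> M\<^sup>2 * (x * \<psi> y + y * \<psi> x) * \<psi> 1" if "t > 1" for t
    proof -
      have "M\<^sup>2 * (x * \<psi> y + y * \<psi> x) \<ge> 0"
        using assms psi_pos[of x] psi_pos[of y] by (intro mult_nonneg_nonneg add_nonneg_nonneg) auto
      then have "M\<^sup>2 * (x * \<psi> y + y * \<psi> x) * \<psi> t \<le> M\<^sup>2 * (x * \<psi> y + y * \<psi> x) * \<psi> 1"
        using that by (intro mult_left_mono psi_mono) auto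
      then show ?thesis
        using L_bound[OF assms, of t] that by simp
    qed
  qed
  then show ?thesis
    unfolding kB_def integral_mult_right_zero[symmetric] by (simp add: mult.assoc)
qed

lemma bounded_integrable:
  assumes [measurable]: "f \<in> borel_measurable borel" and f: "\<And>t. \<bar>f t\<bar> \<le> C"
  shows "integrable half_line (\<lambda>t. of_real (f t) * a t)" "integrable half_line (\<lambda>t. of_real (f t) * a1 t)"
proof -
  show "integrable half_line (\<lambda>t. of_real (f t) * a t)"
    using f by (intro half_line_integrable_bound[OF integrable_mult_right[OF integrable_norm[OF int_a], of C]] meas_mult)
      (auto simp: norm_mult intro!: mult_right_mono)
  show "integrable half_line (\<lambda>t. of_real (f t) * a1 t)"
    using f by (intro half_line_integrable_bound[OF integrable_mult_right[OF integrable_norm[OF int_a1], of C]] meas_mult)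
      (auto simp: norm_mult intro!: mult_right_mono)
qed

lemma kW_by_parts:
  assumes "s \<noteq> 0"
  shows "kW s = - of_real (1 / (pi * s)) * (LINT t|half_line. of_real (sin (s * t)) * a1 t)"
proof -
  have "(LINT t|half_line. of_real (s * cos (s * t)) * a t) = - (0 * a 0) - (LINT t|half_line. of_real (sin (s * t)) * a1 t)"
  proof (rule integration_by_parts_symbol)
    show "((\<lambda>t. complex_of_real (sin (s * t))) has_vector_derivative of_real (s * cos (s * t))) (at t)" for t

      by (rule has_vector_derivative_of_real)
        (auto simp flip: has_real_derivative_iff_has_vector_derivative intro!: derivative_eq_intros)
    show "integrable half_line (\<lambda>t. of_real (s * cos (s * t)) * a t)"
      by (rule bounded_integrable(1)[of _ "\<bar>s\<bar>"]) (auto simp: abs_mult mult_left_le)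
    show "integrable half_line (\<lambda>t. of_real (sin (s * t)) * a1 t)"
      by (rule bounded_integrable(2)[of _ 1]) auto
    have "((\<lambda>t. complex_of_real (sin (s * t))) \<longlongrightarrow> of_real (sin (s * 0))) (at_right 0)"
      by (intro tendsto_intros)
    then show "((\<lambda>t. complex_of_real (sin (s * t))) \<longlongrightarrow> 0) (at_right 0)"
      by simp
    show "norm (complex_of_real (sin (s * t))) \<le> 1" for t
      by simp
  qed
  then have "of_real s * (LINT t|half_line. of_real (cos (s * t)) * a t) = - (LINT t|half_line. of_real (sin (s * t)) * a1 t)"
    unfolding integral_mult_right_zero[symmetric] by (simp add: mult.assoc)
  then have "(LINT t|half_line. of_real (cos (s * t)) * a t) = - (LINT t|half_line. of_real (sin (s * t)) * a1 t) / of_real s"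
    using assms by (simp add: field_simps)
  then show ?thesis
    unfolding kW_def by (simp add: field_simps)
qed

end

text \<open>The common shape of all majorants: order p at 0 and order q at infinity, integrable on
  the half-line when p < 1 < q.\<close>

definition two_powers :: "real \<Rightarrow> real \<Rightarrow> real \<Rightarrow> real" where
  "two_powers p q x = (if x \<le> 1 then x powr (- p) else x powr (- q))"

section \<open>Estimates of the kernel difference in the different regions\<close>

context bessel_symbol
begin

lemma kW_bound:
  obtains C where "C \<ge> 0" "\<And>s. norm (kW s) \<le> C" "\<And>s. s > 0 \<Longrightarrow> norm (kW s) \<le> C / s"
proof
  let ?A = "LINT t|half_line. norm (a t)" and ?A1 = "LINT t|half_line. norm (a1 t)"
  have pos: "?A \<ge> 0" "?A1 \<ge> 0" by auto
  show "0 \<le> ?A + ?A1" using pos by simp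
  have pi1: "1 / pi \<le> 1"
    using pi_gt3 by simp
  have b: "norm (LINT t|half_line. of_real (f t) * h t) \<le> (LINT t|half_line. norm (h t))"
    if "integrable half_line h" "\<And>t. \<bar>f t\<bar> \<le> 1" for h :: "real \<Rightarrow> complex" and f :: "real \<Rightarrow> real"
    using that by (intro half_line_integral_norm_le) (auto simp: norm_mult intro!: mult_left_le_one_le)
  show "norm (kW s) \<le> ?A + ?A1" for s
  proof -
    have "norm (kW s) = 1 / pi * norm (LINT t|half_line. of_real (cos (s * t)) * a t)"
      by (simp add: kW_def norm_mult norm_divide)
    also have "\<dots> \<le> 1 * ?A"
      using pi1 b[OF int_a] by (intro mult_mono) auto
    finally show ?thesis using pos by linarith
  qed
  show "norm (kW s) \<le> (?A + ?A1) / s" if "s > 0" for s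
  proof -
    have "norm (kW s) = (1 / pi * norm (LINT t|half_line. of_real (sin (s * t)) * a1 t)) / s"
      using that by (subst kW_by_parts) (auto simp: norm_mult norm_divide)
    also have "\<dots> \<le> (1 * ?A1) / s"
      using pi1 b[OF int_a1] that by (intro divide_right_mono mult_mono) auto
    also have "\<dots> \<le> (?A + ?A1) / s"
      using that pos by (intro divide_right_mono) auto
    finally show ?thesis .
  qed
qed

text \<open>Let z and w be the rotated amplitudes at p and q. Products of real and imaginary parts
  are half sums of those of zw and of z times the conjugate of w. The latter depends on \<Theta>
  only through |\<Theta>|^2 = 2/\<pi> and gives the Wiener-Hopf part; the former oscillates with p +
  q.\<close>

lemma trig_products:
  "cf p * cf q = (1 / pi) * cos (p - q) + 1 / 2 * Re (exp (\<i> * of_real (p + q)) * \<Theta>\<^sup>2)"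
  "sf p * cf q = (1 / pi) * sin (p - q) + 1 / 2 * Im (exp (\<i> * of_real (p + q)) * \<Theta>\<^sup>2)"
proof -
  define z w where "z = exp (\<i> * of_real p) * \<Theta>" and "w = exp (\<i> * of_real q) * \<Theta>"
  have zw: "z * w = exp (\<i> * of_real (p + q)) * \<Theta>\<^sup>2"
    by (simp add: z_def w_def power2_eq_square distrib_left exp_add)
  have TT: "\<Theta> * cnj \<Theta> = of_real (2 / pi)"
    using norm_Theta by (simp add: complex_norm_square[symmetric] flip: of_real_power)
  have "z * cnj w = (exp (\<i> * of_real p) * exp (- \<i> * of_real q)) * (\<Theta> * cnj \<Theta>)"
    by (simp add: z_def w_def exp_cnj mult_ac)
  also have "exp (\<i> * of_real p) * exp (- \<i> * of_real q) = cis (p - q)"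
    by (simp add: cis_conv_exp algebra_simps flip: exp_add)
  finally have zcw: "z * cnj w = cis (p - q) * of_real (2 / pi)"
    unfolding TT .
  have "Re z * Re w = 1 / 2 * Re (z * w) + 1 / 2 * Re (z * cnj w)"
    by (simp add: algebra_simps)
  then show "cf p * cf q = (1 / pi) * cos (p - q) + 1 / 2 * Re (exp (\<i> * of_real (p + q)) * \<Theta>\<^sup>2)"
    unfolding zw zcw by (simp add: cf_def z_def w_def)
  have "Im z * Re w = 1 / 2 * Im (z * w) + 1 / 2 * Im (z * cnj w)"
    by (simp add: algebra_simps)
  then show "sf p * cf q = (1 / pi) * sin (p - q) + 1 / 2 * Im (exp (\<i> * of_real (p + q)) * \<Theta>\<^sup>2)"
    unfolding zw zcw by (simp add: cf_def sf_def z_def w_def)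
qed

text \<open>The splitting f1 g1 - c1 d1 = (f1 - c1) g1 + c1 (g1 - d1). As y < x, both errors are
  governed by y^(-\<theta>), and y \<ge> 1 allows replacing \<psi>(yt) by \<psi>(t). It is kept
  abstract to serve for the product of two u and for both mixed products in
  \<open>L\<close>.\<close>

lemma product_error:
  assumes f: "\<bar>f1 - c1\<bar> \<le> M * (x * t) powr (- \<theta>)" and g: "\<bar>g1 - d1\<bar> \<le> M * (y * t) powr (- \<theta>)"
    and g1: "\<bar>g1\<bar> \<le> M * \<psi> (y * t)" and c1: "\<bar>c1\<bar> \<le> M" and xy: "1 \<le> y" "y < x" and t: "t > 0"
  shows "\<bar>f1 * g1 - c1 * d1\<bar> \<le> 2 * M\<^sup>2 * y powr (- \<theta>) * (t powr (- \<theta>) * \<psi> t)"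
proof -
  let ?e = "y powr (- \<theta>) * t powr (- \<theta>)"
  have yt: "(y * t) powr (- \<theta>) = ?e"
    using xy t by (simp add: powr_mult)
  have "x * t \<ge> y * t"
    using xy t by (intro mult_right_mono) auto
  then have xt: "(x * t) powr (- \<theta>) \<le> ?e"
    unfolding yt[symmetric] using xy t theta by (intro powr_mono2') auto
  have ps: "\<psi> (y * t) \<le> \<psi> t"
    using xy t by (intro psi_mono) auto
  have e0: "?e \<ge> 0" by simp
  have "\<bar>f1 - c1\<bar> * \<bar>g1\<bar> \<le> (M * ?e) * (M * \<psi> t)"
  proof (rule mult_mono)
    show "\<bar>f1 - c1\<bar> \<le> M * ?e"
      using f mult_left_mono[OF xt M_nonneg(1)] by linarith
    show "\<bar>g1\<bar> \<le> M * \<psi> t"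
      using g1 mult_left_mono[OF ps M_nonneg(1)] by linarith
  qed (use M_nonneg e0 in auto)
  moreover have "\<bar>c1\<bar> * \<bar>g1 - d1\<bar> \<le> (M * ?e) * (M * \<psi> t)"
  proof -
    have "\<bar>c1\<bar> * \<bar>g1 - d1\<bar> \<le> M * (M * ?e)"
      using c1 g M_nonneg unfolding yt by (intro mult_mono) auto
    also have "\<dots> \<le> M * (M * ?e) * \<psi> t"
      using mult_left_mono[OF psi_pos[of t], of "M * (M * ?e)"] M_nonneg e0 by simp
    finally show ?thesis by (simp add: mult_ac)
  qed
  moreover have "f1 * g1 - c1 * d1 = (f1 - c1) * g1 + c1 * (g1 - d1)"
    by (simp add: algebra_simps)
  then have "\<bar>f1 * g1 - c1 * d1\<bar> \<le> \<bar>f1 - c1\<bar> * \<bar>g1\<bar> + \<bar>c1\<bar> * \<bar>g1 - d1\<bar>"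
    using abs_triangle_ineq[of "(f1 - c1) * g1" "c1 * (g1 - d1)"] by (simp add: abs_mult)
  ultimately show ?thesis
    by (simp add: power2_eq_square mult_ac)
qed

definition D :: "real \<Rightarrow> real \<Rightarrow> complex" where
  "D x y = kB x y - kW (x - y)"

lemma measurable_cf_sf [measurable]: "cf \<in> borel_measurable borel" "sf \<in> borel_measurable borel"
  unfolding cf_def[abs_def] sf_def[abs_def] by measurable

text \<open>Replacing u by \<open>cf\<close> in the original integral costs y^(-\<theta>) times a
  weighted integral of the symbol. The product of the leading terms is exactly the Wiener-Hopf
  kernel plus a part of frequency x + y, which is O(1/(x+y)). Nothing is divided by x - y, so the
  bound is uniform up to the diagonal.\<close>

lemma D_near_diagonal:
  obtains C where "C \<ge> 0" "\<And>x y. 1 \<le> y \<Longrightarrow> y < x \<Longrightarrow> norm (D x y) \<le> C * y powr (- \<theta>)"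
proof
  let ?I = "LINT t|half_line. (t powr (- \<theta>) * \<psi> t) * norm (a t)"
  let ?C = "2 * M\<^sup>2 * ?I + norm (\<Theta>\<^sup>2) * V0"
  have I: "?I \<ge> 0"
    by (intro integral_nonneg_AE AE_I2) (simp add: \<psi>_def)
  have V0: "V0 \<ge> 0" by (simp add: V0_def)
  show "?C \<ge> 0" using I V0 by simp
  fix x y :: real assume xy: "1 \<le> y" "y < x"
  have pos: "x > 0" "y > 0" "x + y > 0" using xy by auto
  let ?R = "\<lambda>t. Re (exp (\<i> * of_real ((x + y) * t)) * \<Theta>\<^sup>2)"
  have i1: "integrable half_line (\<lambda>t. of_real (u (x * t) * u (y * t)) * a t)"
    by (rule uu_integrable[OF pos(1,2)])
  have i2: "integrable half_line (\<lambda>t. of_real (cf (x * t) * cf (y * t)) * a t)"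
    by (rule bounded_integrable(1)[of _ "M * M"]) (auto simp: abs_mult intro!: mult_mono cf_sf_bound M_nonneg)
  have i3: "integrable half_line (\<lambda>t. of_real (1 / pi) * (of_real (cos ((x - y) * t)) * a t))"
    by (intro integrable_mult_right bounded_integrable(1)[of _ 1]) auto
  have i4: "integrable half_line (\<lambda>t. of_real (1 / 2) * (of_real (?R t) * a t))"
    by (intro integrable_mult_right osc_Re_Im(3)[OF int_exp(1) osc_a pos(3)])
  have "(LINT t|half_line. of_real (cf (x * t) * cf (y * t)) * a t)
      = (LINT t|half_line. of_real (1 / pi) * (of_real (cos ((x - y) * t)) * a t) + of_real (1 / 2) * (of_real (?R t) * a t))"
    by (intro Bochner_Integration.integral_cong refl) (simp add: trig_products algebra_simps)
  also have "\<dots> = kW (x - y) + of_real (1 / 2) * (LINT t|half_line. of_real (?R t) * a t)"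
    unfolding Bochner_Integration.integral_add[OF i3 i4] integral_mult_right_zero kW_def ..
  finally have cc: "kW (x - y) = (LINT t|half_line. of_real (cf (x * t) * cf (y * t)) * a t)
      - of_real (1 / 2) * (LINT t|half_line. of_real (?R t) * a t)"
    by simp
  have D_eq: "D x y = (LINT t|half_line. of_real (u (x * t) * u (y * t)) * a t - of_real (cf (x * t) * cf (y * t)) * a t)
      + of_real (1 / 2) * (LINT t|half_line. of_real (?R t) * a t)"
    unfolding D_def cc kB_def Bochner_Integration.integral_diff[OF i1 i2] by simp
  have "norm (LINT t|half_line. of_real (u (x * t) * u (y * t)) * a t - of_real (cf (x * t) * cf (y * t)) * a t)
      \<le> (LINT t|half_line. 2 * M\<^sup>2 * y powr (- \<theta>) * ((t powr (- \<theta>) * \<psi> t) * norm (a t)))"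
  proof (rule half_line_integral_norm_le)
    show "integrable half_line (\<lambda>t. 2 * M\<^sup>2 * y powr (- \<theta>) * ((t powr (- \<theta>) * \<psi> t) * norm (a t)))"
      by (intro integrable_mult_right psi_weights_integrable)
    fix t :: real assume t: "t > 0"
    have "\<bar>u (x * t) * u (y * t) - cf (x * t) * cf (y * t)\<bar> \<le> 2 * M\<^sup>2 * y powr (- \<theta>) * (t powr (- \<theta>) * \<psi> t)"
      using pos t by (intro product_error[OF _ _ _ _ xy t] error_bound u_bound cf_sf_bound) auto
    then have "\<bar>u (x * t) * u (y * t) - cf (x * t) * cf (y * t)\<bar> * norm (a t)
        \<le> 2 * M\<^sup>2 * y powr (- \<theta>) * (t powr (- \<theta>) * \<psi> t) * norm (a t)"
      by (rule mult_right_mono) simp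
    moreover have "norm (of_real (u (x * t) * u (y * t)) * a t - of_real (cf (x * t) * cf (y * t)) * a t)
        = \<bar>u (x * t) * u (y * t) - cf (x * t) * cf (y * t)\<bar> * norm (a t)"
      unfolding left_diff_distrib[symmetric] of_real_diff[symmetric] norm_mult norm_of_real ..
    ultimately show "norm (of_real (u (x * t) * u (y * t)) * a t - of_real (cf (x * t) * cf (y * t)) * a t)
        \<le> 2 * M\<^sup>2 * y powr (- \<theta>) * ((t powr (- \<theta>) * \<psi> t) * norm (a t))"
      by (simp add: mult_ac)
  qed
  also have "\<dots> = 2 * M\<^sup>2 * ?I * y powr (- \<theta>)"
    by (subst integral_mult_right_zero) (simp add: mult_ac)
  finally have e1: "norm (LINT t|half_line. of_real (u (x * t) * u (y * t)) * a t - of_real (cf (x * t) * cf (y * t)) * a t)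
      \<le> 2 * M\<^sup>2 * ?I * y powr (- \<theta>)" .
  have "norm (complex_of_real (1 / 2) * (LINT t|half_line. of_real (?R t) * a t)) \<le> norm (\<Theta>\<^sup>2) * V0 * y powr (- \<theta>)"
  proof -
    have "norm (complex_of_real (1 / 2) * (LINT t|half_line. of_real (?R t) * a t)) \<le> 1 * (norm (\<Theta>\<^sup>2) * V0 / (x + y))"
      unfolding norm_mult using osc_Re_Im(1)[OF int_exp(1) osc_a pos(3)] by (intro mult_mono) auto
    also have "\<dots> \<le> norm (\<Theta>\<^sup>2) * V0 * y powr (- \<theta>)"
    proof -
      have "1 / (x + y) \<le> 1 / y"
        using pos by (intro divide_left_mono) auto
      also have "1 / y = y powr (- 1)"
        using pos by (simp add: powr_minus_divide)
      also have "\<dots> \<le> y powr (- \<theta>)"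
        using xy theta by (intro powr_mono) auto
      finally have "norm (\<Theta>\<^sup>2) * V0 * (1 / (x + y)) \<le> norm (\<Theta>\<^sup>2) * V0 * y powr (- \<theta>)"
        using V0 by (intro mult_left_mono) auto
      then show ?thesis by simp
    qed
    finally show ?thesis .
  qed
  with e1 show "norm (D x y) \<le> ?C * y powr (- \<theta>)"
    unfolding D_eq distrib_right by (rule norm_triangle_le[OF add_mono])
qed

text \<open>In \<open>L\<close> the leading terms replace u and v. The resulting sine part carries
  the factor x + y, so after division by x^2 - y^2 it is exactly the Wiener-Hopf kernel in its
  integrated form. The replacement error has size x y^(-\<theta>), where x/(x+y) \<le> 1, and the
  part of frequency x + y carries a factor x - y.\<close>

lemma D_off_diagonal:
  obtains C where "C \<ge> 0" "\<And>x y. 1 \<le> y \<Longrightarrow> y < x \<Longrightarrow> norm (D x y) \<le> C * y powr (- \<theta>) / (x - y)"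
proof
  let ?I = "LINT t|half_line. (t powr (- \<theta>) * \<psi> t) * norm (a1 t)"
  let ?C = "4 * M\<^sup>2 * ?I + norm (\<Theta>\<^sup>2) * \<bar>V\<bar>"
  have I: "?I \<ge> 0"
    by (intro integral_nonneg_AE AE_I2) (simp add: \<psi>_def)
  show "?C \<ge> 0" using I by simp
  fix x y :: real assume xy: "1 \<le> y" "y < x"
  have pos: "x > 0" "y > 0" "x + y > 0" "x - y > 0" using xy by auto
  let ?R = "\<lambda>t. Im (exp (\<i> * of_real ((x + y) * t)) * \<Theta>\<^sup>2)"
  define L0 where "L0 = (\<lambda>t. x * (sf (x * t) * cf (y * t)) - y * (sf (y * t) * cf (x * t)))"
  have L0_eq: "L0 t = (x + y) / pi * sin ((x - y) * t) + (x - y) / 2 * ?R t" for t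
  proof -
    have "sin (y * t - x * t) = - sin ((x - y) * t)"
      using sin_minus[of "x * t - y * t"] by (simp add: algebra_simps)
    moreover have "sf (x * t) * cf (y * t) = (1 / pi) * sin ((x - y) * t) + 1 / 2 * ?R t"
      using trig_products(2)[of "x * t" "y * t"] by (simp only: distrib_right left_diff_distrib)
    moreover have "sf (y * t) * cf (x * t) = (1 / pi) * sin (y * t - x * t) + 1 / 2 * ?R t"
      using trig_products(2)[of "y * t" "x * t"] by (simp only: distrib_right add.commute)
    ultimately have "L0 t = x * ((1 / pi) * sin ((x - y) * t) + 1 / 2 * ?R t) - y * ((1 / pi) * (- sin ((x - y) * t)) + 1 / 2 * ?R t)"
      by (simp only: L0_def)
    moreover have "x * (1 / pi * p + 1 / 2 * r) - y * (1 / pi * (- p) + 1 / 2 * r) = (x + y) / pi * p + (x - y) / 2 * r" for p r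
      by (simp add: field_simps)
    ultimately show ?thesis by simp
  qed
  have i1: "integrable half_line (\<lambda>t. of_real (L x y t) * a1 t)"
    by (rule L_integrable[OF pos(1,2)])
  have i3: "integrable half_line (\<lambda>t. of_real ((x + y) / pi) * (of_real (sin ((x - y) * t)) * a1 t))"
    by (intro integrable_mult_right bounded_integrable(2)[of _ 1]) auto
  have i4: "integrable half_line (\<lambda>t. of_real ((x - y) / 2) * (of_real (?R t) * a1 t))"
    by (intro integrable_mult_right osc_Re_Im(4)[OF int_exp(2) osc_a1 pos(3)])
  have L0_split: "of_real (L0 t) * a1 t = of_real ((x + y) / pi) * (of_real (sin ((x - y) * t)) * a1 t)
      + of_real ((x - y) / 2) * (of_real (?R t) * a1 t)" for t
    unfolding L0_eq of_real_add of_real_mult by (simp only: distrib_right mult.assoc)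
  have i2: "integrable half_line (\<lambda>t. of_real (L0 t) * a1 t)"
    unfolding L0_split using i3 i4 by (rule Bochner_Integration.integrable_add)
  define Q where "Q = (LINT t|half_line. of_real (?R t) * a1 t)"
  define P where "P = (LINT t|half_line. of_real (sin ((x - y) * t)) * a1 t)"
  define F where "F = (LINT t|half_line. of_real (L x y t) * a1 t - of_real (L0 t) * a1 t)"
  have L0_int: "(LINT t|half_line. of_real (L0 t) * a1 t) = of_real ((x + y) / pi) * P + of_real ((x - y) / 2) * Q"
    unfolding L0_split Bochner_Integration.integral_add[OF i3 i4] integral_mult_right_zero P_def Q_def ..
  have F_eq: "(LINT t|half_line. of_real (L x y t) * a1 t) = F + (of_real ((x + y) / pi) * P + of_real ((x - y) / 2) * Q)"
    unfolding F_def Bochner_Integration.integral_diff[OF i1 i2] L0_int by simp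
  have "x\<^sup>2 - y\<^sup>2 = (x - y) * (x + y)"
    by (simp add: power2_eq_square algebra_simps)
  then have B: "of_real ((x - y) * (x + y)) * kB x y = - (F + (of_real ((x + y) / pi) * P + of_real ((x - y) / 2) * Q))"
    using kB_by_parts[OF pos(1,2)] unfolding F_eq by simp
  have W: "kW (x - y) = - of_real (1 / (pi * (x - y))) * P"
    unfolding P_def using pos by (intro kW_by_parts) auto
  have ne: "complex_of_real (x - y) \<noteq> 0" "complex_of_real (x + y) \<noteq> 0" "complex_of_real pi \<noteq> 0"
    unfolding of_real_eq_0_iff using pos pi_neq_zero by auto
  \<comment> \<open>The sine integral \<open>P\<close> drops out here: this is the cancellation
    between the two kernels.\<close>
  have "of_real ((x - y) * (x + y)) * D x y = - F - of_real ((x - y) / 2) * Q"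
  proof -
    have "of_real ((x - y) * (x + y)) * kW (x - y) = - (of_real ((x + y) / pi) * P)"
      unfolding W of_real_mult of_real_divide using ne by (simp del: of_real_diff of_real_add add: field_simps)
    then show ?thesis
      unfolding D_def right_diff_distrib B by simp
  qed
  then have "norm (of_real ((x - y) * (x + y)) * D x y) \<le> norm F + (x - y) / 2 * norm Q"
    using norm_triangle_ineq4[of "- F" "of_real ((x - y) / 2) * Q"] pos by (simp add: norm_mult del: of_real_diff of_real_divide)
  then have main: "(x - y) * (x + y) * norm (D x y) \<le> norm F + (x - y) / 2 * norm Q"
    using pos by (simp add: norm_mult del: of_real_diff of_real_add of_real_mult)
  have "norm F \<le> (LINT t|half_line. 4 * M\<^sup>2 * x * y powr (- \<theta>) * ((t powr (- \<theta>) * \<psi> t) * norm (a1 t)))"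
    unfolding F_def
  proof (rule half_line_integral_norm_le)
    show "integrable half_line (\<lambda>t. 4 * M\<^sup>2 * x * y powr (- \<theta>) * ((t powr (- \<theta>) * \<psi> t) * norm (a1 t)))"
      by (intro integrable_mult_right psi_weights_integrable)
    fix t :: real assume t: "t > 0"
    let ?e = "2 * M\<^sup>2 * y powr (- \<theta>) * (t powr (- \<theta>) * \<psi> t)"
    have z: "x * t > 0" "y * t > 0" using pos t by auto
    have "M * 1 \<le> M * \<psi> (y * t)"
      using M_nonneg psi_pos by (intro mult_left_mono) auto
    then have vb: "\<bar>v (y * t)\<bar> \<le> M * \<psi> (y * t)"
      using v_bound[OF z(2)] by linarith
    have e1: "\<bar>v (x * t) * u (y * t) - sf (x * t) * cf (y * t)\<bar> \<le> ?e"
      by (intro product_error[OF error_bound(2)[OF z(1)] error_bound(1)[OF z(2)] u_bound[OF z(2)] cf_sf_bound(2) xy t])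
    have e2: "\<bar>u (x * t) * v (y * t) - cf (x * t) * sf (y * t)\<bar> \<le> ?e"
      by (intro product_error[OF error_bound(1)[OF z(1)] error_bound(2)[OF z(2)] vb cf_sf_bound(1) xy t])
    have "L x y t - L0 t = x * (v (x * t) * u (y * t) - sf (x * t) * cf (y * t)) - y * (u (x * t) * v (y * t) - cf (x * t) * sf (y * t))"
      by (simp add: L_def L0_def algebra_simps)
    also have "\<bar>\<dots>\<bar> \<le> x * \<bar>v (x * t) * u (y * t) - sf (x * t) * cf (y * t)\<bar> + y * \<bar>u (x * t) * v (y * t) - cf (x * t) * sf (y * t)\<bar>"
      using pos abs_triangle_ineq4[of "x * (v (x * t) * u (y * t) - sf (x * t) * cf (y * t))" "y * (u (x * t) * v (y * t) - cf (x * t) * sf (y * t))"]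
      by (simp add: abs_mult)
    also have "\<dots> \<le> x * ?e + x * ?e"
      using pos xy e1 e2 by (intro add_mono mult_mono) auto
    finally have "\<bar>L x y t - L0 t\<bar> \<le> 2 * x * ?e" by (simp add: mult_ac)
    then have "\<bar>L x y t - L0 t\<bar> * norm (a1 t) \<le> 2 * x * ?e * norm (a1 t)"
      by (rule mult_right_mono) simp
    moreover have "norm (of_real (L x y t) * a1 t - of_real (L0 t) * a1 t) = \<bar>L x y t - L0 t\<bar> * norm (a1 t)"
      unfolding left_diff_distrib[symmetric] of_real_diff[symmetric] norm_mult norm_of_real ..
    ultimately show "norm (of_real (L x y t) * a1 t - of_real (L0 t) * a1 t)
        \<le> 4 * M\<^sup>2 * x * y powr (- \<theta>) * ((t powr (- \<theta>) * \<psi> t) * norm (a1 t))"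
      by (simp add: mult_ac)
  qed
  also have "\<dots> = 4 * M\<^sup>2 * x * y powr (- \<theta>) * ?I"
    by (rule integral_mult_right_zero)
  finally have Fb: "norm F \<le> 4 * M\<^sup>2 * x * y powr (- \<theta>) * ?I" .
  have "norm Q \<le> norm (\<Theta>\<^sup>2) * \<bar>V\<bar> / (x + y)"
  proof -
    have "norm Q \<le> norm (\<Theta>\<^sup>2) * V / (x + y)"
      unfolding Q_def by (rule osc_Re_Im(2)[OF int_exp(2) osc_a1 pos(3)])
    also have "\<dots> \<le> norm (\<Theta>\<^sup>2) * \<bar>V\<bar> / (x + y)"
      using pos by (intro divide_right_mono mult_left_mono) auto
    finally show ?thesis .
  qed
  then have "(x - y) / 2 * norm Q \<le> (x - y) / 2 * (norm (\<Theta>\<^sup>2) * \<bar>V\<bar> / (x + y))"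
    using pos by (intro mult_left_mono) auto
  also have "\<dots> = norm (\<Theta>\<^sup>2) * \<bar>V\<bar> * ((x - y) / (2 * (x + y)))"
    by simp
  \<comment> \<open>A deliberate loss: the term contributes O((x+y)^-2) to \<open>D\<close> and is
    only brought to the form of the bound for \<open>F\<close>.\<close>
  also have "\<dots> \<le> norm (\<Theta>\<^sup>2) * \<bar>V\<bar> * ((x + y) * y powr (- \<theta>))"
  proof -
    have "(x - y) / (2 * (x + y)) \<le> 1"
      using pos by (simp add: divide_le_eq)
    also have "1 \<le> y * y powr (- 1)"
      using pos by (simp add: powr_minus_divide)
    also have "\<dots> \<le> (x + y) * y powr (- \<theta>)"
      using pos xy theta by (intro mult_mono powr_mono) auto
    finally show ?thesis
      by (intro mult_left_mono) auto
  qed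
  finally have Qb: "(x - y) / 2 * norm Q \<le> norm (\<Theta>\<^sup>2) * \<bar>V\<bar> * ((x + y) * y powr (- \<theta>))" .
  have "4 * M\<^sup>2 * x * y powr (- \<theta>) * ?I \<le> 4 * M\<^sup>2 * (x + y) * y powr (- \<theta>) * ?I"
    using pos I by (intro mult_right_mono mult_left_mono) auto
  moreover have "(x + y) * (?C * y powr (- \<theta>))
      = 4 * M\<^sup>2 * (x + y) * y powr (- \<theta>) * ?I + norm (\<Theta>\<^sup>2) * \<bar>V\<bar> * ((x + y) * y powr (- \<theta>))"
    by (simp add: algebra_simps)
  ultimately have "(x - y) * (x + y) * norm (D x y) \<le> (x + y) * (?C * y powr (- \<theta>))"
    using main Fb Qb by linarith
  then have "(x + y) * ((x - y) * norm (D x y)) \<le> (x + y) * (?C * y powr (- \<theta>))"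
    by (simp only: mult_ac)
  then have "(x - y) * norm (D x y) \<le> ?C * y powr (- \<theta>)"
    by (rule mult_left_le_imp_le[OF _ pos(3)])
  then show "norm (D x y) \<le> ?C * y powr (- \<theta>) / (x - y)"
    using pos by (simp add: field_simps)
qed

text \<open>No asymptotics are used for y < 1. Up to x = 2 each kernel is bounded separately. Beyond
  2 the variables are well separated: x^2 - y^2 \<ge> x^2/2 and x - y \<ge> x/2, so integration by
  parts gains a factor 1/x in both kernels.\<close>

lemma D_small:
  obtains C where "C \<ge> 0" "\<And>x y. 0 < y \<Longrightarrow> y < 1 \<Longrightarrow> y < x \<Longrightarrow> norm (D x y) \<le> C * \<psi> y * (if x \<le> 2 then \<psi> x else 1 / x)"
proof -
  obtain C1 where C1: "C1 \<ge> 0" "\<And>x y. x > 0 \<Longrightarrow> y > 0 \<Longrightarrow> norm (kB x y) \<le> C1 * \<psi> x * \<psi> y"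
    using kB_bound by blast
  obtain C2 where C2: "C2 \<ge> 0" "\<And>s. norm (kW s) \<le> C2" "\<And>s. s > 0 \<Longrightarrow> norm (kW s) \<le> C2 / s"
    using kW_bound by blast
  define I where "I = (LINT t|half_line. \<psi> t * norm (a1 t))"
  have I: "I \<ge> 0"
    unfolding I_def by (intro integral_nonneg_AE AE_I2) (simp add: \<psi>_def)
  define C where "C = C1 + 2 * C2 + 4 * M\<^sup>2 * I"
  have C: "C \<ge> 0" "C1 + C2 \<le> C" "2 * C2 + 4 * M\<^sup>2 * I \<le> C"
    using C1 C2 I by (auto simp: C_def)
  have "norm (D x y) \<le> C * \<psi> y * (if x \<le> 2 then \<psi> x else 1 / x)" if xy: "0 < y" "y < 1" "y < x" for x y
  proof (cases "x \<le> 2")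
    case True
    have p1: "1 \<le> \<psi> x * \<psi> y"
      using mult_mono[of 1 "\<psi> x" 1 "\<psi> y"] psi_pos[of x] psi_pos[of y] by simp
    have "norm (D x y) \<le> norm (kB x y) + norm (kW (x - y))"
      unfolding D_def by (rule norm_triangle_ineq4)
    also have "\<dots> \<le> C1 * (\<psi> x * \<psi> y) + C2 * 1"
      using C1(2)[of x y] C2(2)[of "x - y"] xy by (simp add: mult.assoc)
    also have "\<dots> \<le> C1 * (\<psi> x * \<psi> y) + C2 * (\<psi> x * \<psi> y)"
      using p1 C2 by (intro add_left_mono mult_left_mono) auto
    also have "\<dots> = (C1 + C2) * (\<psi> x * \<psi> y)"
      by (simp add: algebra_simps)
    also have "\<dots> \<le> C * (\<psi> x * \<psi> y)"
      using C p1 by (intro mult_right_mono) auto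
    finally show ?thesis
      using True by (simp add: mult_ac)
  next
    case False
    then have x: "x > 2" "x > 0" by auto
    have "norm (LINT t|half_line. of_real (L x y t) * a1 t) \<le> (LINT t|half_line. M\<^sup>2 * (2 * x * \<psi> y) * (\<psi> t * norm (a1 t)))"
    proof (rule half_line_integral_norm_le)
      show "integrable half_line (\<lambda>t. M\<^sup>2 * (2 * x * \<psi> y) * (\<psi> t * norm (a1 t)))"
        by (intro integrable_mult_right psi_weights_integrable)
      fix t :: real assume t: "t > 0"
      \<comment> \<open>\<psi> is decreasing and y < x, so the two terms of \<open>L_bound\<close>
        merge into one.\<close>
      have "y * \<psi> x \<le> x * \<psi> y"
        using xy psi_mono[of y x] psi_pos[of x] by (intro mult_mono) auto
      then have "M\<^sup>2 * (x * \<psi> y + y * \<psi> x) * \<psi> t \<le> M\<^sup>2 * (2 * x * \<psi> y) * \<psi> t"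
        using psi_pos[of t] by (intro mult_right_mono mult_left_mono) auto
      then have "\<bar>L x y t\<bar> \<le> M\<^sup>2 * (2 * x * \<psi> y) * \<psi> t"
        using L_bound[OF x(2) xy(1) t] by linarith
      from mult_right_mono[OF this, of "norm (a1 t)"]
      show "norm (of_real (L x y t) * a1 t) \<le> M\<^sup>2 * (2 * x * \<psi> y) * (\<psi> t * norm (a1 t))"
        by (simp add: norm_mult mult_ac)
    qed
    also have "\<dots> = M\<^sup>2 * (2 * x * \<psi> y) * I"
      unfolding I_def by (rule integral_mult_right_zero)
    finally have L: "norm (LINT t|half_line. of_real (L x y t) * a1 t) \<le> M\<^sup>2 * (2 * x * \<psi> y) * I" .
    have "y\<^sup>2 \<le> 1"
      using xy by (simp add: power_le_one)
    moreover have "2 * 2 \<le> x * x"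
      using x by (intro mult_mono) auto
    ultimately have sq: "x\<^sup>2 - y\<^sup>2 \<ge> x\<^sup>2 / 2" "x\<^sup>2 - y\<^sup>2 > 0"
      by (auto simp: power2_eq_square)
    have "(x\<^sup>2 / 2) * norm (kB x y) \<le> (x\<^sup>2 - y\<^sup>2) * norm (kB x y)"
      using sq by (intro mult_right_mono) auto
    also have "\<dots> = norm (of_real (x\<^sup>2 - y\<^sup>2) * kB x y)"
      using sq by (simp add: norm_mult del: of_real_diff of_real_power)
    also have "\<dots> = norm (LINT t|half_line. of_real (L x y t) * a1 t)"
      unfolding kB_by_parts[OF x(2) xy(1)] by simp
    also note L
    finally have "x * (x * norm (kB x y)) \<le> x * (4 * M\<^sup>2 * I * \<psi> y)"
      by (simp add: power2_eq_square mult_ac)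
    then have "x * norm (kB x y) \<le> 4 * M\<^sup>2 * I * \<psi> y"
      by (rule mult_left_le_imp_le[OF _ x(2)])
    then have B: "norm (kB x y) \<le> 4 * M\<^sup>2 * I * \<psi> y / x"
      using x by (simp add: field_simps)
    have "norm (kW (x - y)) \<le> C2 / (x - y)"
      using xy by (intro C2) auto
    also have "\<dots> \<le> C2 / (x / 2)"
      using xy x C2 by (intro divide_left_mono) auto
    also have "\<dots> = 2 * C2 / x * 1"
      by simp
    also have "\<dots> \<le> 2 * C2 / x * \<psi> y"
      using psi_pos[of y] C2 x by (intro mult_left_mono) auto
    finally have "norm (D x y) \<le> 4 * M\<^sup>2 * I * \<psi> y / x + 2 * C2 / x * \<psi> y"
      unfolding D_def using B by (intro norm_triangle_le_diff add_mono)
    also have "\<dots> = (2 * C2 + 4 * M\<^sup>2 * I) * (\<psi> y / x)"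
      using x by (simp add: field_simps)
    also have "\<dots> \<le> C * (\<psi> y / x)"
      using C x psi_pos[of y] by (intro mult_right_mono) auto
    finally show ?thesis
      using False by simp
  qed
  then show ?thesis
    using that C(1) by blast
qed

text \<open>One majorant for all regions: a factor in y, integrable as 2\<beta> < 1 < 2\<theta>,
  times a function of x plus a function of x - y. The first summand covers y < 1. The second covers
  y \<ge> 1, with the near-diagonal estimate for x - y \<le> 1 and the off-diagonal one
  beyond.\<close>

theorem D_square_bound:
  obtains C where "C \<ge> 0" "\<And>x y. 0 < y \<Longrightarrow> y < x \<Longrightarrow>
    (norm (D x y))\<^sup>2 \<le> C * two_powers (2 * \<beta>) (2 * \<theta>) y * (two_powers (2 * \<beta>) 2 x + two_powers 0 2 (x - y))"
proof -
  obtain C1 where C1: "C1 \<ge> 0" "\<And>x y. 0 < y \<Longrightarrow> y < 1 \<Longrightarrow> y < x \<Longrightarrow> norm (D x y) \<le> C1 * \<psi> y * (if x \<le> 2 then \<psi> x else 1 / x)"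
    using D_small by blast
  obtain C2 where C2: "C2 \<ge> 0" "\<And>x y. 1 \<le> y \<Longrightarrow> y < x \<Longrightarrow> norm (D x y) \<le> C2 * y powr (- \<theta>)"
    using D_near_diagonal by blast
  obtain C3 where C3: "C3 \<ge> 0" "\<And>x y. 1 \<le> y \<Longrightarrow> y < x \<Longrightarrow> norm (D x y) \<le> C3 * y powr (- \<theta>) / (x - y)"
    using D_off_diagonal by blast
  \<comment> \<open>The factor 64 is 4 times 16: the constant 4 comes from squaring \<psi>(y) for y
    < 1, the constant 16 from the factor in x, where 1 < x \<le> 2 is compared with 1/x^2.\<close>
  define C where "C = 64 * C1\<^sup>2 + C2\<^sup>2 + C3\<^sup>2"
  have C: "0 \<le> C" "64 * C1\<^sup>2 \<le> C" "C2\<^sup>2 \<le> C" "C3\<^sup>2 \<le> C"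
    by (auto simp: C_def)
  have tp: "0 \<le> two_powers p q x" for p q x
    by (simp add: two_powers_def)
  have sq: "(x powr (- p))\<^sup>2 = x powr (- (2 * p))" for x p :: real
    by (simp add: power2_eq_square flip: powr_add)
  have psi_sq: "(\<psi> z)\<^sup>2 \<le> 4 * z powr (- (2 * \<beta>))" if "0 < z" "z \<le> 1" for z
  proof -
    have "\<psi> z \<le> 2 * z powr (- \<beta>)"
      using powr_ge_one[OF that beta(1)] by (simp add: \<psi>_def)
    then have "(\<psi> z)\<^sup>2 \<le> (2 * z powr (- \<beta>))\<^sup>2"
      using psi_pos[of z] by (intro power_mono) auto
    then show ?thesis
      by (simp add: power_mult_distrib sq)
  qed
  have inv_sq: "z powr (- 2) = 1 / z\<^sup>2" if "z > 0" for z :: real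
    using that by (simp add: powr_minus_divide powr_numeral)
  have "(norm (D x y))\<^sup>2 \<le> C * two_powers (2 * \<beta>) (2 * \<theta>) y * (two_powers (2 * \<beta>) 2 x + two_powers 0 2 (x - y))"
    if xy: "0 < y" "y < x" for x y
  proof (cases "y < 1")
    case True
    have m: "(if x \<le> 2 then \<psi> x else 1 / x)\<^sup>2 \<le> 16 * two_powers (2 * \<beta>) 2 x"
    proof -
      consider "x \<le> 1" | "1 < x" "x \<le> 2" | "2 < x" by linarith
      then show ?thesis
      proof cases
        case 1
        have "(\<psi> x)\<^sup>2 \<le> 16 * x powr (- (2 * \<beta>))"
          using psi_sq[of x] xy 1 powr_ge_zero[of x "- (2 * \<beta>)"] by linarith
        then show ?thesis
          using 1 by (simp add: two_powers_def)
      next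
        case 2
        have "\<psi> x \<le> 2"
          using psi_mono[of 1 x] 2 by (simp add: \<psi>_def)
        then have "(\<psi> x)\<^sup>2 \<le> 2\<^sup>2"
          using psi_pos[of x] by (intro power_mono) auto
        moreover have "x\<^sup>2 \<le> 2\<^sup>2"
          using 2 by (intro power_mono) auto
        then have "2\<^sup>2 \<le> 16 * (1 / x\<^sup>2)"
          using 2 by (simp add: field_simps)
        ultimately show ?thesis
          using 2 inv_sq[of x] by (simp add: two_powers_def)
      next
        case 3
        then show ?thesis
          using inv_sq[of x] by (simp add: two_powers_def power_divide divide_right_mono)
      qed
    qed
    have "(norm (D x y))\<^sup>2 \<le> (C1 * \<psi> y * (if x \<le> 2 then \<psi> x else 1 / x))\<^sup>2"
      using C1(2)[OF xy(1) True xy(2)] by (intro power_mono) auto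
    also have "\<dots> = C1\<^sup>2 * ((\<psi> y)\<^sup>2 * (if x \<le> 2 then \<psi> x else 1 / x)\<^sup>2)"
      by (simp only: power_mult_distrib mult.assoc)
    also have "\<dots> \<le> C1\<^sup>2 * ((4 * y powr (- (2 * \<beta>))) * (16 * two_powers (2 * \<beta>) 2 x))"
      using psi_sq[of y] m xy True by (intro mult_left_mono mult_mono) auto
    also have "\<dots> = 64 * C1\<^sup>2 * (two_powers (2 * \<beta>) (2 * \<theta>) y * two_powers (2 * \<beta>) 2 x)"
      using True by (simp add: two_powers_def[of _ _ y])
    also have "\<dots> \<le> C * (two_powers (2 * \<beta>) (2 * \<theta>) y * (two_powers (2 * \<beta>) 2 x + two_powers 0 2 (x - y)))"
      using C tp by (intro mult_mono mult_left_mono mult_nonneg_nonneg) auto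
    finally show ?thesis by (simp add: mult.assoc)
  next
    case False
    then have y: "1 \<le> y" by simp
    have ty: "two_powers (2 * \<beta>) (2 * \<theta>) y = y powr (- (2 * \<theta>))"
      using y by (auto simp: two_powers_def)
    have "(norm (D x y))\<^sup>2 \<le> C * (y powr (- (2 * \<theta>)) * two_powers 0 2 (x - y))"
    proof (cases "x - y \<le> 1")
      case True
      have "(norm (D x y))\<^sup>2 \<le> (C2 * y powr (- \<theta>))\<^sup>2"
        using C2(2)[OF y xy(2)] by (intro power_mono) auto
      also have "\<dots> = C2\<^sup>2 * y powr (- (2 * \<theta>))"
        by (simp add: power_mult_distrib sq)
      also have "\<dots> \<le> C * y powr (- (2 * \<theta>))"
        using C by (intro mult_right_mono) auto
      finally show ?thesis
        using True xy by (simp add: two_powers_def)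
    next
      case False
      have "(norm (D x y))\<^sup>2 \<le> (C3 * y powr (- \<theta>) / (x - y))\<^sup>2"
        using C3(2)[OF y xy(2)] by (intro power_mono) auto
      also have "\<dots> = C3\<^sup>2 * (y powr (- (2 * \<theta>)) * (1 / (x - y)\<^sup>2))"
        by (simp add: power_mult_distrib power_divide sq)
      also have "\<dots> \<le> C * (y powr (- (2 * \<theta>)) * (1 / (x - y)\<^sup>2))"
        using C by (intro mult_right_mono) auto
      finally show ?thesis
        using False xy inv_sq[of "x - y"] by (simp add: two_powers_def)
    qed
    also have "\<dots> \<le> C * (y powr (- (2 * \<theta>)) * (two_powers (2 * \<beta>) 2 x + two_powers 0 2 (x - y)))"
      using C tp by (intro mult_left_mono) auto
    finally show ?thesis
      unfolding ty by (simp add: mult.assoc)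
  qed
  then show ?thesis
    using that C(1) by blast
qed

end

section \<open>The Hilbert-Schmidt property\<close>

interpretation half_line: sigma_finite_measure half_line
  by (rule sigma_finite_measure_restrict_space) (auto intro: sigma_finite_lborel)

interpretation half_line_pair: pair_sigma_finite half_line half_line ..

lemma two_powers_integrable:
  assumes "p < 1" "q > 1"
  shows "integrable half_line (two_powers p q)"
proof -
  have "set_integrable lborel {0..1} (\<lambda>x. x powr (- p))"
    using assms has_integral_powr_from_0[of "- p" 1] by (intro set_integrable_of_has_integral) auto
  moreover have "set_integrable lborel {1..} (\<lambda>x. x powr (- q))"
    using assms has_integral_powr_to_inf[of "- q" 1] by (intro set_integrable_of_has_integral) auto
  ultimately have "integrable lborel (\<lambda>x. indicator {0..1} x *\<^sub>R x powr (- p) + indicator {1..} x *\<^sub>R x powr (- q))"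
    unfolding set_integrable_def by (rule Bochner_Integration.integrable_add)
  then have "integrable lborel (\<lambda>x. indicator {0<..} x *\<^sub>R
      (indicator {0..1} x *\<^sub>R x powr (- p) + indicator {1..} x *\<^sub>R x powr (- q)))"
    by (rule integrable_mult_indicator[rotated]) simp
  then have "integrable half_line (\<lambda>x. indicator {0..1} x *\<^sub>R x powr (- p) + indicator {1..} x *\<^sub>R x powr (- q))"
    by (simp only: half_line_integrable_iff set_integrable_def)
  then show ?thesis
  proof (rule half_line_integrable_bound)
    show "two_powers p q \<in> borel_measurable half_line"
      unfolding two_powers_def[abs_def] by (rule measurable_restrict_space1) measurable
    show "norm (two_powers p q x) \<le> indicator {0..1} x *\<^sub>R x powr (- p) + indicator {1..} x *\<^sub>R x powr (- q)" if "x > 0" for x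
      using that by (auto simp: two_powers_def indicator_def)
  qed
qed

lemma measurable_id_half_line: "(\<lambda>x. x) \<in> borel_measurable half_line"
  by (rule measurable_restrict_space1) simp

text \<open>Only the triangle y < x needs work; the other one is its mirror image under the second
  bound, and the diagonal is null. On the triangle the x-integral is taken inside by Tonelli:
  translation invariance bounds the integral of W(x - y) independently of y, and the integral of
  \<open>T\<close> is left.\<close>

lemma kernel_square_integral_finite:
  fixes g :: "real \<Rightarrow> real \<Rightarrow> real" and T U W :: "real \<Rightarrow> real"
  assumes T: "integrable half_line T" and U: "integrable half_line U" and W: "integrable half_line W"
    and [measurable]: "T \<in> borel_measurable borel" "U \<in> borel_measurable borel" "W \<in> borel_measurable borel"
    and nonneg: "\<And>x. T x \<ge> 0" "\<And>x. U x \<ge> 0" "\<And>x. W x \<ge> 0"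
    and bound: "\<And>x y. 0 < y \<Longrightarrow> y < x \<Longrightarrow> g x y \<le> T y * (U x + W (x - y))"
      "\<And>x y. 0 < y \<Longrightarrow> y < x \<Longrightarrow> g y x \<le> T y * (U x + W (x - y))"
  shows "(\<integral>\<^sup>+x. \<integral>\<^sup>+y. ennreal (g x y) \<partial>half_line \<partial>half_line) < \<infinity>"
proof -
  define h where "h = (\<lambda>x y. if y < x then ennreal (T y * (U x + W (x - y))) else 0)"
  note [measurable] = measurable_id_half_line
  have [measurable]: "case_prod h \<in> borel_measurable (half_line \<Otimes>\<^sub>M half_line)"
    unfolding h_def by measurable
  define J where "J = (\<integral>\<^sup>+x. ennreal (U x) \<partial>half_line) + (\<integral>\<^sup>+x. ennreal (W x) \<partial>half_line)"
  have J: "J < \<infinity>"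
    using U W nonneg by (simp add: J_def integrable_iff_bounded)
  have inner: "(\<integral>\<^sup>+x. h x y \<partial>half_line) \<le> ennreal (T y) * J" for y
  proof -
    have "(\<integral>\<^sup>+x. h x y \<partial>half_line) \<le> (\<integral>\<^sup>+x. ennreal (T y) * (ennreal (U x) + ennreal (W (x - y)) * indicator {y<..} x) \<partial>half_line)"
      by (intro nn_integral_mono) (auto simp: h_def ennreal_mult nonneg ennreal_plus[symmetric] simp del: ennreal_plus)
    also have "\<dots> = ennreal (T y) * ((\<integral>\<^sup>+x. ennreal (U x) \<partial>half_line) + (\<integral>\<^sup>+x. ennreal (W (x - y)) * indicator {y<..} x \<partial>half_line))"
      by (subst nn_integral_cmult; (measurable)?) (subst nn_integral_add; (measurable)?; simp)
    also have "\<dots> \<le> ennreal (T y) * J"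
      unfolding J_def
    proof (intro mult_left_mono add_left_mono)
      have "(\<integral>\<^sup>+x. ennreal (W (x - y)) * indicator {y<..} x \<partial>half_line)
          \<le> (\<integral>\<^sup>+x. ennreal (W (x - y)) * indicator {y<..} x \<partial>lborel)"
        by (subst nn_integral_restrict_space) (auto intro!: nn_integral_mono simp: indicator_def)
      \<comment> \<open>Translation by y; the indicator of x > y keeps the argument of
        \<open>W\<close> positive, so the integral is again over the half-line.\<close>
      also have "\<dots> = (\<integral>\<^sup>+x. ennreal (W x) * indicator {0<..} x \<partial>lborel)"
        using nn_integral_real_affine[of "\<lambda>x. ennreal (W (x - y)) * indicator {y<..} x" 1 y]
        by (simp add: indicator_def)
      also have "\<dots> \<le> (\<integral>\<^sup>+x. ennreal (W x) \<partial>half_line)"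
        by (subst nn_integral_restrict_space) (auto intro!: nn_integral_mono simp: indicator_def)
      finally show "(\<integral>\<^sup>+x. ennreal (W (x - y)) * indicator {y<..} x \<partial>half_line) \<le> (\<integral>\<^sup>+x. ennreal (W x) \<partial>half_line)" .
    qed simp
    finally show ?thesis .
  qed
  have half: "(\<integral>\<^sup>+y. \<integral>\<^sup>+x. h x y \<partial>half_line \<partial>half_line) < \<infinity>"
  proof -
    have "(\<integral>\<^sup>+y. \<integral>\<^sup>+x. h x y \<partial>half_line \<partial>half_line) \<le> (\<integral>\<^sup>+y. ennreal (T y) * J \<partial>half_line)"
      by (intro nn_integral_mono inner)
    also have "\<dots> = (\<integral>\<^sup>+y. ennreal (T y) \<partial>half_line) * J"
      by (rule nn_integral_multc) measurable
    also have "\<dots> < \<infinity>"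
      using T J nonneg by (simp add: integrable_iff_bounded ennreal_mult_less_top)
    finally show ?thesis .
  qed
  have "(\<integral>\<^sup>+x. \<integral>\<^sup>+y. ennreal (g x y) \<partial>half_line \<partial>half_line)
      \<le> (\<integral>\<^sup>+x. \<integral>\<^sup>+y. h x y + h y x \<partial>half_line \<partial>half_line)"
  proof (rule nn_integral_mono_AE)
    show "AE x in half_line. (\<integral>\<^sup>+y. ennreal (g x y) \<partial>half_line) \<le> (\<integral>\<^sup>+y. h x y + h y x \<partial>half_line)"
      using AE_half_line_pos
    proof eventually_elim
      case (elim x)
      have ne: "AE y in half_line. y \<noteq> x"
        using AE_lborel_singleton[of x] by (subst AE_restrict_space_iff) auto
      show ?case
      proof (rule nn_integral_mono_AE)
        show "AE y in half_line. ennreal (g x y) \<le> h x y + h y x"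
          using AE_half_line_pos ne
        proof eventually_elim
          case (elim y)
          consider "y < x" | "x < y" using elim by linarith
          then show ?case
          proof cases
            case 1
            then show ?thesis
              using bound(1)[of y x] elim by (auto simp: h_def intro: ennreal_leI)
          next
            case 2
            then show ?thesis
              using bound(2)[of x y] \<open>0 < x\<close> by (auto simp: h_def intro: ennreal_leI)
          qed
        qed
      qed
    qed
  qed
  also have "\<dots> = (\<integral>\<^sup>+x. (\<integral>\<^sup>+y. h x y \<partial>half_line) + (\<integral>\<^sup>+y. h y x \<partial>half_line) \<partial>half_line)"
    by (intro nn_integral_cong nn_integral_add) measurable
  also have "\<dots> = (\<integral>\<^sup>+x. \<integral>\<^sup>+y. h x y \<partial>half_line \<partial>half_line) + (\<integral>\<^sup>+x. \<integral>\<^sup>+y. h y x \<partial>half_line \<partial>half_line)"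
    by (rule nn_integral_add) measurable
  also have "(\<integral>\<^sup>+x. \<integral>\<^sup>+y. h x y \<partial>half_line \<partial>half_line) = (\<integral>\<^sup>+y. \<integral>\<^sup>+x. h x y \<partial>half_line \<partial>half_line)"
    by (rule half_line_pair.Fubini'[symmetric]) measurable
  also have "\<dots> + (\<integral>\<^sup>+x. \<integral>\<^sup>+y. h y x \<partial>half_line \<partial>half_line) < \<infinity>"
    using half by simp
  finally show ?thesis .
qed

text \<open>Reflecting the negative half-line adds the conjugate exponential; the two sum to twice a
  cosine, which turns 1/(2\<pi>) into 1/\<pi>.\<close>

lemma fourier_hat_even_extension:
  assumes a: "integrable half_line a"
  shows "fourier_hat (even_extension a) s = of_real (1 / pi) * (LINT t|half_line. of_real (cos (s * t)) * a t)"
proof -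
  define f where "f = (\<lambda>t. exp (- \<i> * of_real (s * t)) * even_extension a t)"
  define F G where "F = (\<lambda>t. indicator {0<..} t *\<^sub>R (exp (- \<i> * of_real (s * t)) * a t))"
    and "G = (\<lambda>t. indicator {0<..} t *\<^sub>R (exp (\<i> * of_real (s * t)) * a t))"
  have osc: "integrable half_line (\<lambda>t. exp (c * complex_of_real t) * a t)" if "Re c = 0" for c
  proof (rule half_line_integrable_bound[OF integrable_norm[OF a]])
    have "(\<lambda>t. exp (c * complex_of_real t)) \<in> borel_measurable half_line"
      by (rule measurable_restrict_space1) measurable
    then show "(\<lambda>t. exp (c * complex_of_real t) * a t) \<in> borel_measurable half_line"
      using borel_measurable_integrable[OF a] by (rule borel_measurable_times)
  qed (use that in \<open>simp add: norm_mult norm_exp_eq_Re\<close>)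
  have FG: "integrable lborel F" "integrable lborel G"
    using osc[of "- \<i> * of_real s"] osc[of "\<i> * of_real s"]
    unfolding F_def G_def half_line_integrable_iff set_integrable_def by (simp_all add: mult.assoc)
  have G': "integrable lborel (\<lambda>t. G (- t))" "(LINT t|lborel. G (- t)) = (LINT t|lborel. G t)"
    using FG(2) lborel_integrable_real_affine_iff[of "-1" G 0] lborel_integral_real_affine[of "-1" G 0] by auto
  have "(LINT t|lborel. f t) = (LINT t|lborel. F t + G (- t))"
  proof (rule integral_discrete_difference[where X="{0::real}"])
    fix t :: real assume "t \<notin> {0}"
    then show "f t = F t + G (- t)"
      by (auto simp: f_def F_def G_def even_extension_def indicator_def)
  qed (auto simp: emeasure_lborel_countable)
  also have "\<dots> = (LINT t|lborel. F t) + (LINT t|lborel. G t)"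
    unfolding Bochner_Integration.integral_add[OF FG(1) G'(1)] G'(2) ..
  also have "\<dots> = (LINT t|lborel. F t + G t)"
    by (rule Bochner_Integration.integral_add[OF FG, symmetric])
  also have "\<dots> = (LINT t|lborel. indicator {0<..} t *\<^sub>R (2 * (of_real (cos (s * t)) * a t)))"
  proof (rule Bochner_Integration.integral_cong[OF refl])
    fix t :: real
    have "exp (- \<i> * complex_of_real (s * t)) + exp (\<i> * of_real (s * t)) = 2 * of_real (cos (s * t))"
      by (simp add: cos_of_real[symmetric] cos_exp_eq del: of_real_mult)
    then have "exp (- \<i> * of_real (s * t)) * a t + exp (\<i> * of_real (s * t)) * a t = 2 * (of_real (cos (s * t)) * a t)"
      by (simp only: distrib_right[symmetric] mult.assoc)
    then show "F t + G t = indicator {0<..} t *\<^sub>R (2 * (of_real (cos (s * t)) * a t))"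
      unfolding F_def G_def scaleR_right_distrib[symmetric] by simp
  qed
  also have "\<dots> = 2 * (LINT t|half_line. of_real (cos (s * t)) * a t)"
    unfolding half_line_integral_eq set_lebesgue_integral_def by (subst integral_mult_right_zero[symmetric]) (simp add: mult_ac)
  finally show ?thesis
    unfolding fourier_hat_def f_def by simp
qed

section \<open>Measurability of the kernels and conclusion\<close>

lemma measurable_bessel_J [measurable]: "bessel_J \<nu> \<in> borel_measurable borel"
  unfolding bessel_J_def[abs_def] by measurable

lemma measurable_bessel_kernel:
  assumes [measurable]: "a \<in> borel_measurable half_line"
  shows "case_prod (bessel_kernel \<nu> a) \<in> borel_measurable (half_line \<Otimes>\<^sub>M half_line)"
  supply [measurable] = measurable_id_half_line
  unfolding bessel_kernel_def by measurable

lemma measurable_fourier_kernel: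
  assumes a: "integrable half_line a"
  shows "case_prod (\<lambda>x y. fourier_hat (even_extension a) (x - y)) \<in> borel_measurable (half_line \<Otimes>\<^sub>M half_line)"
proof -
  note [measurable] = measurable_id_half_line
  have [measurable]: "a \<in> borel_measurable half_line"
    using a by simp
  show ?thesis
    unfolding fourier_hat_even_extension[OF a] by measurable
qed

lemma bessel_kernel_eq:
  assumes "x > 0" "y > 0"
  shows "bessel_kernel \<nu> a x y = (LINT t|half_line. of_real (bessel_u \<nu> (x * t) * bessel_u \<nu> (y * t)) * a t)"
  unfolding bessel_kernel_def
proof (rule half_line_integral_cong)
  fix t :: real assume t: "t > 0"
  have "sqrt (x * t) * sqrt (y * t) = t * sqrt (x * y)"
  proof -
    have "sqrt (x * t) * sqrt (y * t) = sqrt (t\<^sup>2 * (x * y))"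
      by (simp add: power2_eq_square mult_ac flip: real_sqrt_mult)
    then show ?thesis
      using t by (simp add: real_sqrt_mult)
  qed
  then have "t * sqrt (x * y) * bessel_J \<nu> (x * t) * bessel_J \<nu> (y * t) = bessel_u \<nu> (x * t) * bessel_u \<nu> (y * t)"
    unfolding bessel_u_def by (metis (no_types, opaque_lifting) mult.assoc mult.commute)
  then show "of_real (t * sqrt (x * y) * bessel_J \<nu> (x * t) * bessel_J \<nu> (y * t)) * a t
      = of_real (bessel_u \<nu> (x * t) * bessel_u \<nu> (y * t)) * a t"
    by simp
qed

theorem proposition2p9:
  fixes \<nu> :: real and a :: "real \<Rightarrow> complex"
  assumes "\<nu> > -1"
    and "a \<in> Linf_set half_line" and "integrable half_line a"
    and "continuous_on {0..} a" and "piecewise_C2_half_line a"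
    and "(a \<longlongrightarrow> 0) at_top"
    and "integrable half_line (\<lambda>t. of_real ((1 + t) powr (- 1 / 2)) * half_line_deriv a t)"
    and "integrable half_line (half_line_deriv (half_line_deriv a))"
  shows "hilbert_schmidt_L2 half_line
           (\<lambda>f x. bessel_operator \<nu> a f x - wiener_hopf_operator (even_extension a) f x)"
proof -
  obtain S V B1 \<delta> where S: "finite S" "integrable half_line (half_line_deriv a)" "\<delta> > 0"
    "\<forall>t>0. t \<notin> S \<longrightarrow> (a has_vector_derivative half_line_deriv a t) (at t)"
    "\<forall>t>0. t < \<delta> \<longrightarrow> norm (half_line_deriv a t) \<le> B1"
    "\<forall>s. s \<noteq> 0 \<longrightarrow> norm (LINT t|half_line. exp (\<i> * of_real (s * t)) * half_line_deriv a t) \<le> V / \<bar>s\<bar>"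
    using piecewise_C2_symbol[OF assms(5,3,8)] by auto
  \<comment> \<open>Continuity on the closed interval bounds \<open>a\<close> near 0, which is
    required for integrating it against singular powers.\<close>
  have "compact (a ` {0..\<delta>})"
    using assms(4) by (intro compact_continuous_image) (auto intro: continuous_on_subset)
  then obtain B2 where B2: "\<And>t. t \<in> {0..\<delta>} \<Longrightarrow> norm (a t) \<le> B2"
    using compact_imp_bounded bounded_iff by (metis imageI)
  obtain K \<Theta> where "bessel_pair \<nu> K \<Theta>"
    using exists_bessel_pair[OF assms(1)] by blast
  then interpret bessel_pair \<nu> K \<Theta> "bessel_u \<nu>" "bessel_u (\<nu> + 1)" "\<nu> + 1 / 2" .
  interpret bessel_symbol \<nu> K \<Theta> "bessel_u \<nu>" "bessel_u (\<nu> + 1)" "\<nu> + 1 / 2" a "half_line_deriv a" S V "max B1 B2" \<delta>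
  proof unfold_locales
    show "norm (a t) \<le> max B1 B2" if "0 < t" "t < \<delta>" for t
      using B2[of t] that by auto
    show "norm (half_line_deriv a t) \<le> max B1 B2" if "0 < t" "t < \<delta>" for t
      using S(5) that by fastforce
  qed (use S assms in auto)
  let ?W = "\<lambda>x y. fourier_hat (even_extension a) (x - y)"
  have W_eq: "fourier_hat (even_extension a) s = kW s" for s
    unfolding kW_def by (rule fourier_hat_even_extension[OF assms(3)])
  have B_eq: "bessel_kernel \<nu> a x y = kB x y" if "x > 0" "y > 0" for x y
    unfolding kB_def by (rule bessel_kernel_eq[OF that])
  have D_eq: "bessel_kernel \<nu> a x y - ?W x y = D x y" if "x > 0" "y > 0" for x y
    unfolding D_def W_eq B_eq[OF that] ..
  \<comment> \<open>Symmetry transfers the estimates, all derived for y < x, to the other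
    triangle.\<close>
  have D_sym: "D y x = D x y" for x y
  proof -
    have "cos ((y - x) * t) = cos ((x - y) * t)" for t
      using cos_minus[of "(x - y) * t"] by (simp add: algebra_simps)
    then show ?thesis
      by (simp add: D_def kB_def kW_def mult.commute)
  qed
  obtain C where C: "C \<ge> 0" "\<And>x y. 0 < y \<Longrightarrow> y < x \<Longrightarrow>
    (norm (D x y))\<^sup>2 \<le> C * two_powers (2 * \<beta>) (2 * \<theta>) y * (two_powers (2 * \<beta>) 2 x + two_powers 0 2 (x - y))"
    using D_square_bound by blast
  have tp: "two_powers p q x \<ge> 0" "two_powers p q \<in> borel_measurable borel" for p q x
    unfolding two_powers_def[abs_def] by auto
  have fin: "(\<integral>\<^sup>+x. \<integral>\<^sup>+y. ennreal ((cmod (bessel_kernel \<nu> a x y - ?W x y))\<^sup>2) \<partial>half_line \<partial>half_line) < \<infinity>"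
  proof (rule kernel_square_integral_finite)
    show "integrable half_line (\<lambda>y. C * two_powers (2 * \<beta>) (2 * \<theta>) y)"
      using beta theta by (intro integrable_mult_right two_powers_integrable) auto
    show "integrable half_line (two_powers (2 * \<beta>) 2)" "integrable half_line (two_powers 0 2)"
      using beta by (auto intro!: two_powers_integrable)
    show "(\<lambda>y. C * two_powers (2 * \<beta>) (2 * \<theta>) y) \<in> borel_measurable borel"
      using tp(2) by measurable
    fix x y :: real assume xy: "0 < y" "y < x"
    then show "(cmod (bessel_kernel \<nu> a x y - ?W x y))\<^sup>2
        \<le> C * two_powers (2 * \<beta>) (2 * \<theta>) y * (two_powers (2 * \<beta>) 2 x + two_powers 0 2 (x - y))"
      using C(2) D_eq[of x y] by simp
    show "(cmod (bessel_kernel \<nu> a y x - ?W y x))\<^sup>2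
        \<le> C * two_powers (2 * \<beta>) (2 * \<theta>) y * (two_powers (2 * \<beta>) 2 x + two_powers 0 2 (x - y))"
      using C(2)[OF xy] D_eq[of y x] D_sym[of y x] xy by simp
  qed (use C(1) tp in auto)
  obtain C2 where C2: "C2 \<ge> 0" "\<And>s. norm (kW s) \<le> C2" "\<And>s. s > 0 \<Longrightarrow> norm (kW s) \<le> C2 / s"
    using kW_bound by blast
  have kW_even: "kW (- s) = kW s" for s
    by (simp add: kW_def)
  \<comment> \<open>This licenses the merging of the two separately defined integrals: for fixed x
    the Wiener-Hopf kernel is bounded and decays like 1/|x - y|.\<close>
  have W_L2: "?W x \<in> L2_set half_line" if x: "x \<in> space half_line" for x
  proof -
    have x0: "x \<ge> 0" using x by (simp add: space_restrict_space)
    have m: "?W x \<in> borel_measurable half_line"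
      using measurable_Pair_compose_split[OF measurable_fourier_kernel[OF assms(3)] measurable_const[OF x] measurable_ident]
      by simp
    have "integrable half_line (\<lambda>y. (cmod (?W x y))\<^sup>2)"
    proof (rule half_line_integrable_bound)
      show "integrable half_line (\<lambda>y. (C2 * (x + 1))\<^sup>2 * two_powers 0 2 y)"
        by (intro integrable_mult_right two_powers_integrable) auto
      show "(\<lambda>y. (cmod (?W x y))\<^sup>2) \<in> borel_measurable half_line"
        using m by measurable
      fix y :: real assume y: "y > 0"
      \<comment> \<open>The factor x + 1 converts decay in y - x into decay in y: for y > x + 1 the
        inequality y \<le> (x+1)(y-x) amounts to x (y-x-1) \<ge> 0. For smaller y the plain bound
        \<open>C2\<close> is enough.\<close>
      have "norm (kW (x - y)) \<le> C2 * (x + 1) * (if y \<le> 1 then 1 else 1 / y)"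
      proof (cases "y \<le> x + 1")
        case True
        have "1 \<le> (x + 1) * (if y \<le> 1 then 1 else 1 / y)"
          using True x0 y by (auto simp: field_simps)
        then have "C2 * 1 \<le> C2 * ((x + 1) * (if y \<le> 1 then 1 else 1 / y))"
          using C2(1) by (intro mult_left_mono)
        then show ?thesis
          using C2(2)[of "x - y"] by (simp only: mult.assoc)
      next
        case False
        have "0 \<le> x * (y - x - 1)"
          using False x0 by (intro mult_nonneg_nonneg) auto
        then have "1 / (y - x) \<le> (x + 1) / y"
          using False x0 y by (simp add: field_simps)
        then have "C2 * (1 / (y - x)) \<le> C2 * ((x + 1) / y)"
          using C2(1) by (rule mult_left_mono)
        moreover have "norm (kW (x - y)) \<le> C2 / (y - x)"
          using C2(3)[of "y - x"] kW_even[of "y - x"] False by simp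
        ultimately show ?thesis
          using False x0 by simp
      qed
      then have "(norm (kW (x - y)))\<^sup>2 \<le> (C2 * (x + 1) * (if y \<le> 1 then 1 else 1 / y))\<^sup>2"
        by (intro power_mono) auto
      also have "\<dots> = (C2 * (x + 1))\<^sup>2 * two_powers 0 2 y"
        using y by (simp add: two_powers_def power_mult_distrib power_divide powr_minus_divide powr_numeral)
      finally show "norm ((cmod (?W x y))\<^sup>2) \<le> (C2 * (x + 1))\<^sup>2 * two_powers 0 2 y"
        by (simp add: W_eq)
    qed
    with m show ?thesis
      by (simp add: L2_set_def)
  qed
  have "hilbert_schmidt_L2 half_line (\<lambda>f x. (LINT y|half_line. bessel_kernel \<nu> a x y * f y) - (LINT y|half_line. ?W x y * f y))"
  proof (rule hilbert_schmidt_L2_kernel_difference)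
    show "sigma_finite_measure half_line" ..
    show "case_prod (bessel_kernel \<nu> a) \<in> borel_measurable (half_line \<Otimes>\<^sub>M half_line)"
      by (rule measurable_bessel_kernel) (use assms(3) in simp)
    show "case_prod ?W \<in> borel_measurable (half_line \<Otimes>\<^sub>M half_line)"
      by (rule measurable_fourier_kernel[OF assms(3)])
    show "AE x in half_line. ?W x \<in> L2_set half_line"
      by (rule AE_I2) (rule W_L2)
  qed (rule fin)
  then show ?thesis
    unfolding bessel_operator_def wiener_hopf_operator_def .
qed

end
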